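(* Let $\mu,\nu$ be Radon measures on $\mathbb{R}$, with $\nu$ globally doubling: $\nu(B(x,2r)) \leq C\nu(B(x,r))$ for all $x\in\mathbb{R}$, $r>0$. Write $\mu = \mu_a+\mu_s$ for the Lebesgue decomposition of $\mu$ relative to $\nu$ ($\mu_a\ll\nu$, $\mu_s\perp\nu$). Define $$\mathcal{S}^2_\nu(\mu)(x) = \int_0^1 \alpha^2_{s,\mu,\nu}(B(x,r))\,\frac{dr}{r}, \qquad x\in\mathbb{R},$$ where $B(x,r) = (x-r,x+r)$. Then (a) $\mathcal{S}_\nu(\mu)(x)<\infty$ for $\mu_a$-almost every $x$, and (b) $\mathcal{S}_\nu(\mu)(x) = \infty$ for $\mu_s$-almost every $x$.
   Context: Wasserstein distance: for finite Borel measures $\nu_1,\nu_2$ on $\mathbb{R}$, $\mathbb{W}_1(\nu_1,\nu_2) := \sup_\psi |\int\psi\,d\nu_1 - \int\psi\,d\nu_2|$, the supremum over all $1$-Lipschitz $\psi\colon\mathbb{R}\to\mathbb{R}$ supported on $[0,1]$ ("test functions"). For an interval $I$, $T_I$ is the increasing affine map taking $\overline I$ onto $[0,1]$. Let $\varphi(x) := \operatorname{dist}(x,\mathbb{R}\setminus(0,1))$ and $\varphi_I := \varphi\circ T_I$. Smooth $\alpha$-numbers: $\alpha_{s,\mu,\nu}(I) := \mathbb{W}_1(\mu_{\varphi,I},\nu_{\varphi,I})$ where $\mu_{\varphi,I} := T_{I\sharp}(\mu|_I)/\int\varphi_I\,d\mu$ and $\nu_{\varphi,I} := T_{I\sharp}(\nu|_I)/\int\varphi_I\,d\nu$,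 with $\mu_{\varphi,I}:\equiv 0$ if $\int\varphi_I\,d\mu = 0$ (similarly for $\nu$). *)

theory Defs
  imports "HOL-Analysis.Analysis"
begin

definition radon_real :: "real measure \<Rightarrow> bool" where
  "radon_real M \<longleftrightarrow> sets M = sets borel \<and> (\<forall>K. compact K \<longrightarrow> emeasure M K < \<infinity>)"

definition doubling_real :: "real measure \<Rightarrow> bool" where
  "doubling_real M \<longleftrightarrow> (\<exists>C::real. \<forall>x r. r > 0 \<longrightarrow>
      emeasure M (ball x (2 * r)) \<le> ennreal C * emeasure M (ball x r))"

definition test_fun :: "(real \<Rightarrow> real) \<Rightarrow> bool" where
  "test_fun \<psi> \<longleftrightarrow> 1-lipschitz_on UNIV \<psi> \<and> (\<forall>t. t \<notin> {0..1} \<longrightarrow> \<psi> t = 0)"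

definition W1 :: "real measure \<Rightarrow> real measure \<Rightarrow> real" where
  "W1 N1 N2 = (SUP \<psi>\<in>{\<psi>. test_fun \<psi>}.
      \<bar>integral\<^sup>L N1 \<psi> - integral\<^sup>L N2 \<psi>\<bar>)"

definition T_int :: "real \<Rightarrow> real \<Rightarrow> real \<Rightarrow> real" where
  "T_int a b y = (y - a) / (b - a)"

definition phi :: "real \<Rightarrow> real" where
  "phi t = infdist t (UNIV - {0<..<1})"

definition norm_meas :: "real measure \<Rightarrow> real \<Rightarrow> real \<Rightarrow> real measure" where
  "norm_meas M a b =
     (let c = integral\<^sup>L M (\<lambda>y. phi (T_int a b y)) in
      if c = 0 then null_measure borel
      else scale_measure (ennreal (1 / c))
             (distr (density M (indicator {a<..<b})) borel (T_int a b)))"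

definition alpha_s :: "real measure \<Rightarrow> real measure \<Rightarrow> real \<Rightarrow> real \<Rightarrow> real" where
  "alpha_s M N a b = W1 (norm_meas M a b) (norm_meas N a b)"

definition S2 :: "real measure \<Rightarrow> real measure \<Rightarrow> real \<Rightarrow> ennreal" where
  "S2 N M x = (\<integral>\<^sup>+ r. indicator {0<..<1} r *
      ennreal ((alpha_s M N (x - r) (x + r))\<^sup>2 / r) \<partial>lborel)"

end

theory Submission
  imports Defs
begin

text \<open>
  The hat functions on the grids of mesh 2^-n refine: each hat is a combination of three hats of half
  the width, so testing a measure against hats turns it into a multiplicative cascade, in the same way
  as a dyadic martingale, but with Lipschitz test functions. For a hat J put mu(J), nu(J) for the
  integrals; the transition probabilities of mu and nu from J to its children differ by at most a
  constant times the alpha-number of any comparable interval around J.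

  Singular part: the entropies mu(J) ln (mu(J)/nu(J)), summed over the hats of generation n meeting a
  compact nu-null set F, grow per step by at most the sum of mu(J) alpha(J)^2, because relative entropy
  is dominated by the chi-squared divergence. If the square function is bounded on F, the entropies stay
  bounded in n, while the nu-mass of the hats tends to 0; hence mu(F) = 0.

  Absolutely continuous part: expanding a test function in the Faber-Schauder basis bounds alpha by a
  geometrically weighted sum of total variations between the cascades started at J, and each of these is
  bounded by the loss of Hellinger affinity, the sum of sqrt (mu(J) nu(J)), from one generation to a
  later one. Those losses telescope, so the sum of sqrt (mu(J) nu(J)) alpha(J)^2 over all hats in a bounded
  region is finite. If f is the density of the absolutely continuous part, then sqrt f nu gives J at most
  the mass sqrt (mu(J) nu(J)), and it has the same null sets as f nu.
\<close>

section \<open>Tent functions and piecewise linear interpolation\<close>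

text \<open>Indicators of dyadic intervals are not Lipschitz, so alpha-numbers do not control dyadic
  transition probabilities; this is why hats are used. The price is overlap: a hat can have two
  parents. The weight \<open>tent 0 R\<close> repairs this, because interpolation reproduces it in
  every generation, so a child receives from its parents exactly its own weight. Only \<nu> is
  doubling. The zero measure \<nu> is doubling too and needs a separate argument, since then no tent
  has positive \<nu>-integral. In the singular part the square function is bounded only on F,
  whereas the hats that meet F also see the \<mu>-mass next to F; the bound has to be carried over
  to those points, and discarding hats away from F requires nonnegative entropy terms. Measurability
  of the alpha-numbers and of \<open>S2\<close> is never established: the estimates pass through
  measurable quantities built from masses of hats, and exceptional sets are only enclosed in null
  sets.\<close>

definition tent :: "real \<Rightarrow> real \<Rightarrow> real \<Rightarrow> real" where
  "tent c \<rho> y = max 0 (1 - \<bar>y - c\<bar> / \<rho>)"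

definition grid :: "nat \<Rightarrow> int \<Rightarrow> real" where
  "grid n i = of_int i / 2 ^ n"

definition hat :: "nat \<Rightarrow> int \<Rightarrow> real \<Rightarrow> real" where
  "hat n i = tent (grid n i) (1 / 2 ^ n)"

definition interp :: "nat \<Rightarrow> (real \<Rightarrow> real) \<Rightarrow> real \<Rightarrow> real" where
  "interp n f y = (let m = \<lfloor>2 ^ n * y\<rfloor>; t = 2 ^ n * y - of_int m
     in (1 - t) * f (grid n m) + t * f (grid n (m + 1)))"

lemma tent_nonneg [simp]: "0 \<le> tent c \<rho> y"
  by (simp add: tent_def)

lemma tent_le_1: "0 < \<rho> \<Longrightarrow> tent c \<rho> y \<le> 1"
  by (simp add: tent_def)

lemma tent_pos_iff: "0 < \<rho> \<Longrightarrow> 0 < tent c \<rho> y \<longleftrightarrow> \<bar>y - c\<bar> < \<rho>"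
  by (auto simp: tent_def less_max_iff_disj field_simps)

lemma tent_eq_0_iff: "0 < \<rho> \<Longrightarrow> tent c \<rho> y = 0 \<longleftrightarrow> \<rho> \<le> \<bar>y - c\<bar>"
  using tent_pos_iff[of \<rho> c y] tent_nonneg[of c \<rho> y] by linarith

lemma tent_ge: "1 - \<bar>y - c\<bar> / \<rho> \<le> tent c \<rho> y"
  by (simp add: tent_def)

lemma tent_lipschitz: 
  assumes "0 < \<rho>" shows "(1 / \<rho>)-lipschitz_on UNIV (tent c \<rho>)"
proof (rule lipschitz_onI)
  fix y z :: real
  have "\<bar>tent c \<rho> y - tent c \<rho> z\<bar> \<le> \<bar>\<bar>z - c\<bar> / \<rho> - \<bar>y - c\<bar> / \<rho>\<bar>"
    unfolding tent_def by linarith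
  also have "\<dots> = \<bar>\<bar>z - c\<bar> - \<bar>y - c\<bar>\<bar> / \<rho>"
    using assms by (simp add: diff_divide_distrib[symmetric])
  also have "\<dots> \<le> \<bar>y - z\<bar> / \<rho>"
    using assms by (intro divide_right_mono) auto
  finally show "dist (tent c \<rho> y) (tent c \<rho> z) \<le> 1 / \<rho> * dist y z"
    by (simp add: dist_real_def)
qed (use assms in simp)

lemma continuous_on_tent: "0 < \<rho> \<Longrightarrow> continuous_on A (tent c \<rho>)"
  using lipschitz_on_continuous_on[OF tent_lipschitz] continuous_on_subset by blast

lemma hat_eq: "hat n i y = max 0 (1 - \<bar>2 ^ n * y - of_int i\<bar>)"
proof -
  have "\<bar>y - of_int i / 2 ^ n\<bar> * 2 ^ n = \<bar>(y - of_int i / 2 ^ n) * 2 ^ n\<bar>"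
    by (simp add: abs_mult)
  also have "(y - of_int i / 2 ^ n) * 2 ^ n = 2 ^ n * y - of_int i"
    by (simp add: field_simps)
  finally show ?thesis
    by (simp add: hat_def tent_def grid_def)
qed

lemma hat_nonneg [simp]: "0 \<le> hat n i y"
  by (simp add: hat_def)

lemma hat_le_1: "hat n i y \<le> 1"
  by (simp add: hat_def tent_le_1)

lemma hat_pos_iff: "0 < hat n i y \<longleftrightarrow> \<bar>y - grid n i\<bar> < 1 / 2 ^ n"
  by (simp add: hat_def tent_pos_iff)

lemma hat_lipschitz: "(2 ^ n)-lipschitz_on UNIV (hat n i)"
  using tent_lipschitz[of "1 / 2 ^ n" "grid n i"] by (simp add: hat_def)

section \<open>Hats as a nodal basis for interpolation on dyadic grids\<close>

lemma hat_grid: "hat n j (grid (n + k) i) = max 0 (1 - \<bar>of_int i / 2 ^ k - of_int j\<bar>)"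
  by (simp add: hat_eq grid_def power_add)

lemma hat_grid_pos_iff:
  "0 < hat n j (grid (n + k) i) \<longleftrightarrow> (j - 1) * 2 ^ k < i \<and> i < (j + 1) * 2 ^ k"
proof -
  have "0 < hat n j (grid (n + k) i) \<longleftrightarrow> \<bar>real_of_int i / 2 ^ k - of_int j\<bar> < 1"
    by (auto simp: hat_grid less_max_iff_disj)
  also have "\<dots> \<longleftrightarrow> of_int (j - 1) < real_of_int i / 2 ^ k \<and> real_of_int i / 2 ^ k < of_int (j + 1)"
    by auto
  also have "\<dots> \<longleftrightarrow> real_of_int ((j - 1) * 2 ^ k) < real_of_int i \<and> real_of_int i < real_of_int ((j + 1) * 2 ^ k)"
    by (simp add: field_simps)
  finally show ?thesis by (simp only: of_int_less_iff)
qed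

text \<open>At a given point only the hats at the two ends of its cell are nonzero, with values
  \<open>1 - t\<close> and \<open>t\<close>. The hypothesis on \<open>I\<close> says that no nonzero
  nodal value is lost by summing over a finite set.\<close>

lemma sum_hat_eq_interp:
  assumes "finite I" and "\<And>i. f (grid n i) \<noteq> 0 \<Longrightarrow> i \<in> I"
  shows "(\<Sum>i\<in>I. f (grid n i) * hat n i y) = interp n f y"
proof -
  define m where "m = \<lfloor>2 ^ n * y\<rfloor>"
  define t where "t = 2 ^ n * y - of_int m"
  have t: "0 \<le> t" "t < 1" unfolding t_def m_def by linarith+
  have ty: "2 ^ n * y = t + of_int m" by (simp add: t_def)
  have z: "hat n i y = 0" if "i \<notin> {m, m + 1}" for i
  proof -
    have "i \<le> m - 1 \<or> i \<ge> m + 2" using that by auto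
    hence "real_of_int i \<le> real_of_int (m - 1) \<or> real_of_int i \<ge> real_of_int (m + 2)"
      by (simp only: of_int_le_iff)
    thus ?thesis using t unfolding hat_eq ty by auto
  qed
  have "(\<Sum>i\<in>I. f (grid n i) * hat n i y) = (\<Sum>i\<in>I \<union> {m, m + 1}. f (grid n i) * hat n i y)"
    using assms by (intro sum.mono_neutral_left) auto
  also have "\<dots> = (\<Sum>i\<in>{m, m + 1}. f (grid n i) * hat n i y)"
    using assms z by (intro sum.mono_neutral_right) auto
  also have "\<dots> = f (grid n m) * hat n m y + f (grid n (m + 1)) * hat n (m + 1) y"
    by simp
  also have "hat n m y = 1 - t" using t unfolding hat_eq ty by auto
  also have "hat n (m + 1) y = t" using t unfolding hat_eq ty by auto
  finally show ?thesis
    unfolding interp_def Let_def m_def[symmetric] t_def[symmetric] by (simp add: algebra_simps)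
qed

text \<open>The three kinks \<open>c - \<rho>\<close>, \<open>c\<close>, \<open>c + \<rho>\<close>
  are grid points, so the tent is affine on every cell.\<close>

lemma interp_tent:
  assumes "0 < \<rho>" and "2 ^ n * c \<in> \<int>" and "2 ^ n * \<rho> \<in> \<int>"
  shows "interp n (tent c \<rho>) = tent c \<rho>"
proof
  fix y :: real
  obtain A where A: "2 ^ n * c = of_int A" using assms(2) by (rule Ints_cases)
  obtain P where P: "2 ^ n * \<rho> = of_int P" using assms(3) by (rule Ints_cases)
  have P0: "real_of_int P > 0" using P assms(1) by (metis mult_pos_pos zero_less_numeral zero_less_power)
  define m where "m = \<lfloor>2 ^ n * y\<rfloor>"
  define t where "t = 2 ^ n * y - of_int m"
  have t: "0 \<le> t" "t < 1" unfolding t_def m_def by linarith+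
  have ty: "2 ^ n * y = t + of_int m" by (simp add: t_def)
  have T: "tent c \<rho> x = max 0 (real_of_int P - \<bar>2 ^ n * x - real_of_int A\<bar>) / P" for x :: real
  proof -
    have "\<bar>x - c\<bar> / \<rho> = (2 ^ n * \<bar>x - c\<bar>) / (2 ^ n * \<rho>)" by simp
    also have "2 ^ n * \<bar>x - c\<bar> = \<bar>2 ^ n * (x - c)\<bar>" by (simp add: abs_mult)
    also have "2 ^ n * (x - c) = 2 ^ n * x - A" by (simp only: right_diff_distrib A)
    finally have "\<bar>x - c\<bar> / \<rho> = \<bar>2 ^ n * x - real_of_int A\<bar> / P" by (simp only: P)
    moreover have "max 0 (1 - a / p) = max 0 (p - a) / p" if "0 < p" for a p :: real
      using that by (auto simp: max_def field_simps)
    ultimately show ?thesis unfolding tent_def using P0 by simp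
  qed
  have g: "2 ^ n * grid n i = of_int i" for i by (simp add: grid_def)
  \<comment> \<open>In units of the mesh the kinks are the integers \<open>A - P\<close>,
    \<open>A\<close>, \<open>A + P\<close>. The cell from \<open>m\<close> to \<open>m + 1\<close>
    lies on one side of each, which gives the four cases.\<close>
  have key: "(1 - t) * max 0 (real_of_int P - \<bar>real_of_int m - A\<bar>) + t * max 0 (real_of_int P - \<bar>real_of_int (m + 1) - A\<bar>)
      = max 0 (real_of_int P - \<bar>t + real_of_int m - real_of_int A\<bar>)"
  proof (cases "m \<ge> A")
    case True
    hence a: "real_of_int m \<ge> A" by simp
    show ?thesis
    proof (cases "m - A \<ge> P")
      case True
      hence "real_of_int m - A \<ge> P" by linarith
      thus ?thesis using a t by simp
    next
      case False
      hence "real_of_int m - A \<le> P - 1" by linarith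
      hence "max 0 (real_of_int P - \<bar>real_of_int m - A\<bar>) = P - (real_of_int m - A)"
        "max 0 (real_of_int P - \<bar>real_of_int (m + 1) - A\<bar>) = P - (real_of_int m + 1 - A)"
        "max 0 (real_of_int P - \<bar>t + real_of_int m - real_of_int A\<bar>) = P - (t + m - A)" using a t by auto
      thus ?thesis by (simp only:) (simp add: algebra_simps)
    qed
  next
    case False
    hence a: "real_of_int m + 1 \<le> A" by linarith
    show ?thesis
    proof (cases "A - (m + 1) \<ge> P")
      case True
      hence "real_of_int A - m - 1 \<ge> P" by linarith
      thus ?thesis using a t by simp
    next
      case False
      hence "real_of_int A - m \<le> P" by linarith
      hence "max 0 (real_of_int P - \<bar>real_of_int m - A\<bar>) = P - (A - real_of_int m)"
        "max 0 (real_of_int P - \<bar>real_of_int (m + 1) - A\<bar>) = P - (A - real_of_int m - 1)"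
        "max 0 (real_of_int P - \<bar>t + real_of_int m - real_of_int A\<bar>) = P - (A - t - m)" using a t by auto
      thus ?thesis by (simp only:) (simp add: algebra_simps)
    qed
  qed
  have "interp n (tent c \<rho>) y = ((1 - t) * max 0 (real_of_int P - \<bar>real_of_int m - A\<bar>) + t * max 0 (real_of_int P - \<bar>real_of_int (m + 1) - A\<bar>)) / P"
    unfolding interp_def Let_def m_def[symmetric] t_def[symmetric] T g by (simp add: add_divide_distrib)
  also have "\<dots> = tent c \<rho> y" unfolding key T ty by simp
  finally show "interp n (tent c \<rho>) y = tent c \<rho> y" .
qed

lemma interp_hat: "interp (n + k) (hat n j) = hat n j"
  unfolding hat_def
proof (rule interp_tent)
  have "2 ^ (n + k) * grid n j = of_int (2 ^ k * j)" by (simp add: grid_def power_add)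
  thus "2 ^ (n + k) * grid n j \<in> \<int>" by (metis Ints_of_int)
  have "2 ^ (n + k) * (1 / 2 ^ n) = real_of_int (2 ^ k)" by (simp add: power_add)
  thus "2 ^ (n + k) * (1 / 2 ^ n) \<in> (\<int> :: real set)" by (metis Ints_of_int)
qed simp

lemma interp_sum: "interp n (\<lambda>y. \<Sum>i\<in>I. a i * f i y) = (\<lambda>y. \<Sum>i\<in>I. a i * interp n (f i) y)"
  unfolding interp_def Let_def
  by (auto simp: fun_eq_iff sum_distrib_left sum.distrib[symmetric] algebra_simps intro!: sum.cong)

lemma interp_Suc_interp:
  assumes "finite I" and "\<And>i. f (grid n i) \<noteq> 0 \<Longrightarrow> i \<in> I"
  shows "interp (Suc n) (interp n f) = interp n f"
proof -
  have "interp n f = (\<lambda>y. \<Sum>i\<in>I. f (grid n i) * hat n i y)"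
    using sum_hat_eq_interp[of I f n] assms by simp
  moreover have "interp (Suc n) (hat n i) = hat n i" for i using interp_hat[of n 1 i] by simp
  ultimately show ?thesis using interp_sum[of "Suc n" "\<lambda>i. f (grid n i)" "hat n" I] by simp
qed

lemma cell_dist:
  "\<bar>grid n \<lfloor>2 ^ n * y\<rfloor> - y\<bar> \<le> 1 / 2 ^ n" "\<bar>grid n (\<lfloor>2 ^ n * y\<rfloor> + 1) - y\<bar> \<le> 1 / 2 ^ n"
proof -
  define m where "m = \<lfloor>2 ^ n * y\<rfloor>"
  define t where "t = 2 ^ n * y - of_int m"
  have t: "0 \<le> t" "t < 1" unfolding t_def m_def by linarith+
  have "grid n m - y = - t / 2 ^ n" "grid n (m + 1) - y = (1 - t) / 2 ^ n"
    by (simp_all add: grid_def t_def field_simps)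
  thus "\<bar>grid n \<lfloor>2 ^ n * y\<rfloor> - y\<bar> \<le> 1 / 2 ^ n" "\<bar>grid n (\<lfloor>2 ^ n * y\<rfloor> + 1) - y\<bar> \<le> 1 / 2 ^ n"
    using t unfolding m_def by (simp_all add: divide_right_mono)
qed

lemma interp_lipschitz_error:
  assumes "L-lipschitz_on UNIV g"
  shows "\<bar>interp n g y - g y\<bar> \<le> L / 2 ^ n"
proof -
  define m where "m = \<lfloor>2 ^ n * y\<rfloor>"
  define t where "t = 2 ^ n * y - of_int m"
  have t: "0 \<le> t" "t < 1" unfolding t_def m_def by linarith+
  have L: "L \<ge> 0" using assms lipschitz_on_nonneg by blast
  have d: "\<bar>grid n m - y\<bar> \<le> 1 / 2 ^ n" "\<bar>grid n (m + 1) - y\<bar> \<le> 1 / 2 ^ n"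
    using cell_dist[of n y] by (simp_all add: m_def)
  have G: "\<bar>g z - g y\<bar> \<le> L / 2 ^ n" if "\<bar>z - y\<bar> \<le> 1 / 2 ^ n" for z
  proof -
    have "\<bar>g z - g y\<bar> \<le> L * \<bar>z - y\<bar>" using lipschitz_onD[OF assms, of z y] by (simp add: dist_real_def)
    also have "\<dots> \<le> L * (1 / 2 ^ n)" by (intro mult_left_mono that L)
    finally show ?thesis by simp
  qed
  have "interp n g y - g y = (1 - t) * (g (grid n m) - g y) + t * (g (grid n (m + 1)) - g y)"
    unfolding interp_def Let_def m_def[symmetric] t_def[symmetric] by (simp add: algebra_simps)
  also have "\<bar>\<dots>\<bar> \<le> \<bar>(1 - t) * (g (grid n m) - g y)\<bar> + \<bar>t * (g (grid n (m + 1)) - g y)\<bar>"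
    by (rule abs_triangle_ineq)
  also have "\<dots> = (1 - t) * \<bar>g (grid n m) - g y\<bar> + t * \<bar>g (grid n (m + 1)) - g y\<bar>"
    using t by (simp add: abs_mult)
  also have "\<dots> \<le> (1 - t) * (L / 2 ^ n) + t * (L / 2 ^ n)"
    using t by (intro add_mono mult_left_mono G d) auto
  also have "\<dots> = L / 2 ^ n" by (simp add: distrib_right[symmetric] del: times_divide_eq_right)
  finally show ?thesis .
qed

text \<open>Interpolation enlarges a support by at most one mesh width; this keeps the interpolants
  of a test function well inside a hat.\<close>

lemma interp_nonzeroD:
  assumes "interp n g y \<noteq> 0"
  shows "\<exists>z. \<bar>z - y\<bar> \<le> 1 / 2 ^ n \<and> g z \<noteq> 0"
proof -
  define m where "m = \<lfloor>2 ^ n * y\<rfloor>"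
  define t where "t = 2 ^ n * y - of_int m"
  have t: "0 \<le> t" "t < 1" unfolding t_def m_def by linarith+
  have d: "\<bar>grid n m - y\<bar> \<le> 1 / 2 ^ n" "\<bar>grid n (m + 1) - y\<bar> \<le> 1 / 2 ^ n"
    using cell_dist[of n y] by (simp_all add: m_def)
  have "g (grid n m) \<noteq> 0 \<or> g (grid n (m + 1)) \<noteq> 0"
    using assms unfolding interp_def Let_def m_def[symmetric] by auto
  thus ?thesis using d by blast
qed

lemma hat_refine:
  assumes "finite I" and "{(j - 1) * 2 ^ k<..<(j + 1) * 2 ^ k} \<subseteq> I"
  shows "hat n j y = (\<Sum>i\<in>I. hat n j (grid (n + k) i) * hat (n + k) i y)"
proof -
  have "i \<in> I" if "hat n j (grid (n + k) i) \<noteq> 0" for i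
  proof -
    have "0 < hat n j (grid (n + k) i)" using that hat_nonneg[of n j "grid (n + k) i"] by linarith
    thus ?thesis using assms(2) by (auto simp: hat_grid_pos_iff)
  qed
  thus ?thesis using sum_hat_eq_interp[of I "hat n j" "n + k" y] assms(1) interp_hat by metis
qed

section \<open>Radon measures and smooth alpha-numbers\<close>

lemma radon_sets: "radon_real M \<Longrightarrow> sets M = sets borel"
  by (simp add: radon_real_def)

lemma radon_space: "radon_real M \<Longrightarrow> space M = UNIV"
  using sets_eq_imp_space_eq[of M borel] by (simp add: radon_real_def)

lemma radon_measurable: "radon_real M \<Longrightarrow> f \<in> borel_measurable borel \<Longrightarrow> f \<in> borel_measurable M"
  by (subst measurable_cong_sets[OF radon_sets refl])

lemma radon_emeasure_finite:
  assumes "radon_real M" and "A \<subseteq> {a..b}"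
  shows "emeasure M A < \<infinity>"
proof -
  have "emeasure M A \<le> emeasure M {a..b}"
    using assms radon_sets[OF assms(1)] by (intro emeasure_mono) auto
  also have "\<dots> < \<infinity>" using assms(1) compact_Icc unfolding radon_real_def by blast
  finally show ?thesis .
qed

lemma radon_integrable_indicator:
  assumes "radon_real M" and "A \<subseteq> {a..b}" and "A \<in> sets borel"
  shows "integrable M (indicator A :: real \<Rightarrow> real)"
  using assms radon_sets[OF assms(1)] radon_emeasure_finite[OF assms(1,2)]
  by (intro integrable_real_indicator) auto

lemma radon_integrable:
  assumes M: "radon_real M" and f: "continuous_on UNIV f" and z: "\<And>y. y \<notin> {a..b} \<Longrightarrow> f y = 0"
  shows "integrable M (f :: real \<Rightarrow> real)"
proof -
  have "compact (f ` {a..b})"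
    using f by (intro compact_continuous_image continuous_on_subset[OF f]) auto
  then obtain B where B: "\<And>y. y \<in> {a..b} \<Longrightarrow> \<bar>f y\<bar> \<le> B"
    using compact_imp_bounded bounded_iff by (metis imageI real_norm_def)
  have "integrable M (\<lambda>y. B * indicator {a..b} y)"
    using radon_integrable_indicator[OF M, of "{a..b}" a b] by (intro integrable_mult_right) auto
  thus ?thesis
  proof (rule Bochner_Integration.integrable_bound)
    show "f \<in> borel_measurable M"
      using f by (intro radon_measurable[OF M] borel_measurable_continuous_onI)
    show "AE y in M. norm (f y) \<le> norm (B * indicator {a..b} y)"
    proof (intro AE_I2)
      fix y show "norm (f y) \<le> norm (B * indicator {a..b} y)"
        using B[of y] z[of y] by (cases "y \<in> {a..b}") auto
    qed
  qed
qed

lemma radon_integrable_tent: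
  assumes "radon_real M" "0 < \<rho>" shows "integrable M (tent c \<rho>)"
  using assms by (intro radon_integrable[where a="c - \<rho>" and b="c + \<rho>"] continuous_on_tent)
    (auto simp: tent_eq_0_iff)

lemma integral_tent_nonneg [simp]: "0 \<le> integral\<^sup>L M (tent c \<rho>)"
  by simp

definition mass :: "real measure \<Rightarrow> nat \<Rightarrow> int \<Rightarrow> real" where
  "mass M n i = integral\<^sup>L M (hat n i)"

lemma radon_integrable_hat: "radon_real M \<Longrightarrow> integrable M (hat n i)"
  by (simp add: hat_def radon_integrable_tent)

lemma mass_nonneg [simp]: "0 \<le> mass M n i"
  by (simp add: mass_def)

lemma mass_refine:
  assumes "radon_real M" and "finite I" and "{(j - 1) * 2 ^ k<..<(j + 1) * 2 ^ k} \<subseteq> I"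
  shows "mass M n j = (\<Sum>i\<in>I. hat n j (grid (n + k) i) * mass M (n + k) i)"
proof -
  have "mass M n j = integral\<^sup>L M (\<lambda>y. \<Sum>i\<in>I. hat n j (grid (n + k) i) * hat (n + k) i y)"
    unfolding mass_def using hat_refine[OF assms(2,3)] by metis
  also have "\<dots> = (\<Sum>i\<in>I. hat n j (grid (n + k) i) * mass M (n + k) i)"
    unfolding mass_def using radon_integrable_hat[OF assms(1)] by (subst Bochner_Integration.integral_sum) auto
  finally show ?thesis .
qed

section \<open>Doubling expressed through tents\<close>

lemma doubling_iterate:
  assumes "\<And>x r. 0 < r \<Longrightarrow> emeasure M (ball x (2 * r)) \<le> ennreal C * emeasure M (ball x r)" and "0 < r"
  shows "emeasure M (ball (x::real) (2 ^ k * r)) \<le> ennreal C ^ k * emeasure M (ball x r)"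
proof (induction k)
  case (Suc k)
  have "emeasure M (ball x (2 ^ Suc k * r)) \<le> ennreal C * emeasure M (ball x (2 ^ k * r))"
    using assms(1)[of "2 ^ k * r" x] assms(2) by (simp add: mult.assoc)
  also have "\<dots> \<le> ennreal C * (ennreal C ^ k * emeasure M (ball x r))"
    by (intro mult_left_mono Suc) simp
  finally show ?case by (simp add: mult.assoc)
qed simp

text \<open>A tent is at least 1/2 on the ball of half its radius and at most 1 on its own ball, so
  doubling of balls carries over to integrals of tents. Positivity holds because a null ball would,
  by repeated doubling, make the whole line null.\<close>

lemma tent_doubling_exists:
  assumes M: "radon_real M" and D: "doubling_real M" and nz: "emeasure M UNIV \<noteq> 0"
  obtains C where "0 < C"
    and "\<And>c \<rho>. 0 < \<rho> \<Longrightarrow> 0 < integral\<^sup>L M (tent c \<rho>)"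
    and "\<And>c \<rho> c' \<rho>'. 0 < \<rho> \<Longrightarrow> 0 < \<rho>' \<Longrightarrow> \<bar>c - c'\<bar> + \<rho>' \<le> 64 * \<rho> \<Longrightarrow>
      integral\<^sup>L M (tent c' \<rho>') \<le> C * integral\<^sup>L M (tent c \<rho>)"
proof -
  obtain C0 :: real where C0: "\<And>x r. 0 < r \<Longrightarrow> emeasure M (ball x (2 * r)) \<le> ennreal C0 * emeasure M (ball x r)"
    using D unfolding doubling_real_def by blast
  \<comment> \<open>\<open>C0\<close> may be below 1 or negative, and \<open>ennreal\<close> sends
    negative numbers to 0; the maximum keeps the bound and lets powers pass through
    \<open>ennreal\<close>.\<close>
  define C where "C = max 1 C0"
  have C1: "1 \<le> C" by (simp add: C_def)
  have C: "emeasure M (ball x (2 * r)) \<le> ennreal C * emeasure M (ball x r)" if "0 < r" for x r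
    using C0[OF that, of x] by (rule order_trans) (intro mult_right_mono, auto simp: C_def intro!: ennreal_leI)
  note it = doubling_iterate[OF C]
  have [measurable_cong]: "sets M = sets borel" using radon_sets[OF M] .
  have sp: "space M = UNIV" using radon_space[OF M] .
  have fin: "emeasure M (ball x r) < \<infinity>" for x r
    by (rule radon_emeasure_finite[OF M, of _ "x - r" "x + r"]) (auto simp: dist_real_def abs_le_iff)
  have int_ball: "integrable M (indicator (ball x r) :: real \<Rightarrow> real)" for x r
    by (rule radon_integrable_indicator[OF M, of _ "x - r" "x + r"]) (auto simp: dist_real_def abs_le_iff)
  have em: "emeasure M (ball x r) = ennreal (measure M (ball x r))" for x r
    using fin[of x r] by (intro emeasure_eq_ennreal_measure) auto
  have mdb: "measure M (ball x (2 ^ k * r)) \<le> C ^ k * measure M (ball x r)" if "0 < r" for x r k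
  proof -
    have "ennreal (measure M (ball x (2 ^ k * r))) \<le> ennreal C ^ k * ennreal (measure M (ball x r))"
      using it[OF _ that, of x k] by (simp add: em)
    also have "\<dots> = ennreal (C ^ k * measure M (ball x r))"
      using C1 by (simp add: ennreal_power ennreal_mult)
    finally show ?thesis using C1 by (simp add: ennreal_le_iff)
  qed
  have pos: "0 < measure M (ball x r)" if r: "0 < r" for x r
  proof (rule ccontr)
    assume "\<not> ?thesis"
    hence "measure M (ball x r) = 0" using measure_nonneg[of M "ball x r"] by linarith
    hence "measure M (ball x (2 ^ k * r)) \<le> 0" for k using mdb[OF r, of x k] by simp
    hence z: "ball x (2 ^ k * r) \<in> null_sets M" for k
      using em[of x "2 ^ k * r"] by (intro null_setsI) (auto simp: ennreal_neg)
    have "(\<Union>k. ball x (2 ^ k * r)) = UNIV"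
    proof (intro set_eqI iffI UNIV_I)
      fix y
      obtain k where "dist x y / r < 2 ^ k" using real_arch_pow[of 2 "dist x y / r"] by auto
      hence "y \<in> ball x (2 ^ k * r)" using r by (simp add: field_simps)
      thus "y \<in> (\<Union>k. ball x (2 ^ k * r))" by blast
    qed
    moreover have "(\<Union>k. ball x (2 ^ k * r)) \<in> null_sets M" using z by (intro null_sets_UN) auto
    ultimately show False using nz by auto
  qed
  have low: "measure M (ball c (\<rho> / 2)) \<le> 2 * integral\<^sup>L M (tent c \<rho>)" if "0 < \<rho>" for c \<rho>
  proof -
    have "measure M (ball c (\<rho> / 2)) = integral\<^sup>L M (indicator (ball c (\<rho> / 2)))"
      using sp by simp
    also have "\<dots> \<le> integral\<^sup>L M (\<lambda>y. 2 * tent c \<rho> y)"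
    proof (rule integral_mono)
      fix y show "indicator (ball c (\<rho> / 2)) y \<le> 2 * tent c \<rho> y"
      proof (cases "y \<in> ball c (\<rho> / 2)")
        case True
        hence "\<bar>y - c\<bar> / \<rho> \<le> 1 / 2" using that by (simp add: dist_real_def field_simps abs_minus_commute)
        thus ?thesis using tent_ge[of y c \<rho>] True by simp
      qed simp
    qed (use that int_ball radon_integrable_tent[OF M] in auto)
    finally show ?thesis by simp
  qed
  have up: "integral\<^sup>L M (tent c \<rho>) \<le> measure M (ball c \<rho>)" if "0 < \<rho>" for c \<rho>
  proof -
    have "integral\<^sup>L M (tent c \<rho>) \<le> integral\<^sup>L M (indicator (ball c \<rho>))"
    proof (rule integral_mono)
      fix y show "tent c \<rho> y \<le> indicator (ball c \<rho>) y"
        using that tent_le_1[of \<rho> c y] tent_eq_0_iff[of \<rho> c y]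
        by (cases "y \<in> ball c \<rho>") (auto simp: dist_real_def abs_minus_commute)
    qed (use that int_ball radon_integrable_tent[OF M] in auto)
    thus ?thesis using sp by simp
  qed
  \<comment> \<open>Seven doublings lead from radius \<open>\<rho> / 2\<close> to
    \<open>64 * \<rho>\<close>; the factor 2 undoes the value 1/2 of the tent on the small
    ball.\<close>
  show thesis
  proof (rule that[of "2 * C ^ 7"])
    show "0 < 2 * C ^ 7" using C1 by simp
  next
    fix c \<rho> :: real assume "0 < \<rho>"
    thus "0 < integral\<^sup>L M (tent c \<rho>)" using low[of \<rho> c] pos[of "\<rho> / 2" c] by simp
  next
    fix c \<rho> c' \<rho>' :: real assume a: "0 < \<rho>" "0 < \<rho>'" "\<bar>c - c'\<bar> + \<rho>' \<le> 64 * \<rho>"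
    have "integral\<^sup>L M (tent c' \<rho>') \<le> measure M (ball c' \<rho>')" by (rule up[OF a(2)])
    also have "\<dots> \<le> measure M (ball c (2 ^ 7 * (\<rho> / 2)))"
    proof (rule measure_mono_fmeasurable)
      show "ball c' \<rho>' \<subseteq> ball c (2 ^ 7 * (\<rho> / 2))" using a(3) by (auto simp: dist_real_def)
      show "ball c (2 ^ 7 * (\<rho> / 2)) \<in> fmeasurable M"
        using fin by (intro fmeasurableI) auto
    qed auto
    also have "\<dots> \<le> C ^ 7 * measure M (ball c (\<rho> / 2))" using a by (intro mdb) simp
    also have "\<dots> \<le> C ^ 7 * (2 * integral\<^sup>L M (tent c \<rho>))"
      using C1 a by (intro mult_left_mono low) auto
    finally show "integral\<^sup>L M (tent c' \<rho>') \<le> 2 * C ^ 7 * integral\<^sup>L M (tent c \<rho>)" by simp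
  qed
qed

section \<open>Smooth alpha-numbers in terms of Lipschitz functions on the line\<close>

lemma phi_eq: "phi t = max 0 (1 / 2 - \<bar>t - 1 / 2\<bar>)"
proof (cases "t \<in> {0<..<1}")
  case False
  hence "phi t = 0" unfolding phi_def by (intro infdist_zero) auto
  thus ?thesis using False by auto
next
  case True
  have "phi t \<le> dist t 0" "phi t \<le> dist t 1" unfolding phi_def by (intro infdist_le; simp)+
  moreover have "1 / 2 - \<bar>t - 1 / 2\<bar> \<le> phi t"
    unfolding phi_def infdist_def using True
    by (auto intro!: cINF_greatest simp: dist_real_def)
  ultimately show ?thesis using True by (auto simp: dist_real_def)
qed

text \<open>This makes tents the natural normalisers: the denominator in \<open>norm_meas\<close> is
  half the integral of a tent.\<close>

lemma phi_T_int: 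
  assumes "0 < r" shows "phi (T_int (x - r) (x + r) y) = tent x r y / 2"
proof -
  have "T_int (x - r) (x + r) y - 1 / 2 = (y - x) / (2 * r)"
    using assms by (simp add: T_int_def field_simps)
  hence T: "\<bar>T_int (x - r) (x + r) y - 1 / 2\<bar> = \<bar>y - x\<bar> / r / 2" using assms by (simp add: abs_divide)
  have "max 0 (1 / 2 - a / 2) = max 0 (1 - a) / 2" for a :: real
    by (auto simp: max_def)
  from this[of "\<bar>y - x\<bar> / r"] show ?thesis
    unfolding phi_eq tent_def T .
qed

lemma test_fun_bound:
  assumes "test_fun \<psi>" shows "\<bar>\<psi> t\<bar> \<le> phi t"
proof -
  have L: "\<bar>\<psi> u - \<psi> v\<bar> \<le> \<bar>u - v\<bar>" for u v
    using assms lipschitz_onD[of 1 UNIV \<psi> u v] by (simp add: test_fun_def dist_real_def)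
  have Z: "\<psi> u = 0" if "u < 0 \<or> 1 < u" for u using assms that by (auto simp: test_fun_def)
  \<comment> \<open>Vanishing is assumed only outside the closed unit interval, so its end points
    are approached from outside.\<close>
  have b: "\<bar>\<psi> t\<bar> \<le> \<bar>t\<bar>" 
  proof (rule field_le_epsilon)
    fix e :: real assume "0 < e"
    thus "\<bar>\<psi> t\<bar> \<le> \<bar>t\<bar> + e" using L[of t "- e"] Z[of "- e"] by simp
  qed
  have b': "\<bar>\<psi> t\<bar> \<le> \<bar>1 - t\<bar>" 
  proof (rule field_le_epsilon)
    fix e :: real assume "0 < e"
    thus "\<bar>\<psi> t\<bar> \<le> \<bar>1 - t\<bar> + e" using L[of t "1 + e"] Z[of "1 + e"] by simp
  qed
  show ?thesis using b b' Z[of t] unfolding phi_eq by (cases "t < 0 \<or> 1 < t") auto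
qed

lemma test_fun_continuous: "test_fun \<psi> \<Longrightarrow> continuous_on A \<psi>"
  unfolding test_fun_def using lipschitz_on_continuous_on continuous_on_subset by blast

lemma scale_measure_eq_density: "scale_measure k M = density M (\<lambda>_. k)"
  by (rule measure_eqI) (auto simp: emeasure_density nn_integral_cmult_indicator)

text \<open>The test function, pulled back, vanishes outside the open interval, so the restriction
  of the measure disappears. The factor 2 comes from \<open>phi_T_int\<close>. If the normaliser is
  0, the null measure on the left matches division by zero on the right, so no case distinction is
  left for later.\<close>

lemma integral_norm_meas:
  assumes M: "radon_real M" and r: "0 < r" and \<psi>: "test_fun \<psi>"
  shows "integral\<^sup>L (norm_meas M (x - r) (x + r)) \<psi> =
    2 * integral\<^sup>L M (\<lambda>y. \<psi> (T_int (x - r) (x + r) y)) / integral\<^sup>L M (tent x r)"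
proof -
  let ?T = "T_int (x - r) (x + r)"
  define c where "c = integral\<^sup>L M (\<lambda>y. phi (?T y))"
  have c: "c = integral\<^sup>L M (tent x r) / 2" unfolding c_def phi_T_int[OF r] by simp
  have [measurable_cong]: "sets M = sets borel" using radon_sets[OF M] .
  have [measurable]: "\<psi> \<in> borel_measurable borel"
    using test_fun_continuous[OF \<psi>] by (rule borel_measurable_continuous_onI)
  have [measurable]: "?T \<in> borel_measurable borel" unfolding T_int_def by measurable
  show ?thesis
  proof (cases "c = 0")
    case True
    thus ?thesis using c unfolding norm_meas_def c_def[symmetric] Let_def by simp
  next
    case False
    have c0: "c \<ge> 0" unfolding c by simp
    have z: "\<psi> (?T y) = 0" if "y \<notin> {x - r<..<x + r}" for y
    proof -
      have "tent x r y = 0" using that r by (auto simp: tent_eq_0_iff)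
      thus ?thesis using test_fun_bound[OF \<psi>, of "?T y"] phi_T_int[OF r, of x y] by simp
    qed
    have "integral\<^sup>L (norm_meas M (x - r) (x + r)) \<psi> = integral\<^sup>L (density (distr
        (density M (\<lambda>y. ennreal (indicator {x - r<..<x + r} y))) borel ?T) (\<lambda>_. ennreal (1 / c))) \<psi>"
      using False unfolding norm_meas_def c_def[symmetric] Let_def
      by (simp add: scale_measure_eq_density ennreal_indicator)
    also have "\<dots> = integral\<^sup>L M (\<lambda>y. indicator {x - r<..<x + r} y * ((1 / c) * \<psi> (?T y)))"
      using c0 by (simp add: integral_density integral_distr)
    also have "(\<lambda>y. indicator {x - r<..<x + r} y * ((1 / c) * \<psi> (?T y))) = (\<lambda>y. (1 / c) * \<psi> (?T y))"
      using z by (auto simp: fun_eq_iff indicator_def)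
    also have "integral\<^sup>L M (\<lambda>y. (1 / c) * \<psi> (?T y)) = (1 / c) * integral\<^sup>L M (\<lambda>y. \<psi> (?T y))" by simp
    finally show ?thesis using c by simp
  qed
qed

lemma lipschitz_bound_tent:
  assumes g: "L-lipschitz_on UNIV g" and r: "0 < r" and z: "\<And>y. r \<le> \<bar>y - x\<bar> \<Longrightarrow> g y = (0::real)"
  shows "\<bar>g y\<bar> \<le> L * r * tent x r y"
proof (cases "r \<le> \<bar>y - x\<bar>")
  case False
  have L: "0 \<le> L" using g by (rule lipschitz_on_nonneg)
  \<comment> \<open>The end point of the interval nearest to \<open>y\<close>, where
    \<open>g\<close> vanishes.\<close>
  define e where "e = (if y \<ge> x then x + r else x - r)"
  have ge: "g e = 0" using r z[of e] by (auto simp: e_def)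
  have d: "\<bar>y - e\<bar> = r - \<bar>y - x\<bar>" using False by (auto simp: e_def)
  have "\<bar>g y\<bar> \<le> L * \<bar>y - e\<bar>" using lipschitz_onD[OF g, of y e] ge by (simp add: dist_real_def)
  also have "\<dots> = L * r * (1 - \<bar>y - x\<bar> / r)" unfolding d using r by (simp add: field_simps)
  also have "\<dots> \<le> L * r * tent x r y" using L r by (intro mult_left_mono tent_ge) auto
  finally show ?thesis .
qed (use z r lipschitz_on_nonneg[OF g] in auto)

lemma radon_integrable_lipschitz:
  assumes M: "radon_real M" and g: "L-lipschitz_on UNIV g" and z: "\<And>y. r \<le> \<bar>y - x\<bar> \<Longrightarrow> g y = (0::real)"
  shows "integrable M g"
  by (rule radon_integrable[OF M lipschitz_on_continuous_on[OF g], of "x - r" "x + r"]) (auto intro: z)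

lemma abs_integral_le_tent:
  assumes M: "radon_real M" and g: "L-lipschitz_on UNIV g" and r: "0 < r"
    and z: "\<And>y. r \<le> \<bar>y - x\<bar> \<Longrightarrow> g y = (0::real)"
  shows "\<bar>integral\<^sup>L M g\<bar> \<le> L * r * integral\<^sup>L M (tent x r)"
proof -
  have "\<bar>integral\<^sup>L M g\<bar> \<le> integral\<^sup>L M (\<lambda>y. \<bar>g y\<bar>)" by (rule integral_abs_bound)
  also have "\<dots> \<le> integral\<^sup>L M (\<lambda>y. L * r * tent x r y)"
    using lipschitz_bound_tent[OF g r z] radon_integrable_lipschitz[OF M g z] radon_integrable_tent[OF M r]
    by (intro integral_mono) auto
  finally show ?thesis by simp
qed

lemma test_fun_T_int:
  assumes "test_fun \<psi>" and r: "0 < r"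
  shows "(1 / (2 * r))-lipschitz_on UNIV (\<lambda>y. \<psi> (T_int (x - r) (x + r) y))"
    and "r \<le> \<bar>y - x\<bar> \<Longrightarrow> \<psi> (T_int (x - r) (x + r) y) = 0"
proof -
  show "(1 / (2 * r))-lipschitz_on UNIV (\<lambda>y. \<psi> (T_int (x - r) (x + r) y))"
  proof (rule lipschitz_onI)
    fix u v :: real
    let ?T = "T_int (x - r) (x + r)"
    have "dist (\<psi> (?T u)) (\<psi> (?T v)) \<le> 1 * dist (?T u) (?T v)"
      using assms(1) unfolding test_fun_def by (intro lipschitz_onD) auto
    also have "?T u - ?T v = (u - v) / (2 * r)" by (simp add: T_int_def diff_divide_distrib)
    hence "1 * dist (?T u) (?T v) = 1 / (2 * r) * dist u v"
      using r by (simp add: dist_real_def abs_divide)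
    finally show "dist (\<psi> (?T u)) (\<psi> (?T v)) \<le> 1 / (2 * r) * dist u v" .
  qed (use r in simp)
  show "\<psi> (T_int (x - r) (x + r) y) = 0" if "r \<le> \<bar>y - x\<bar>"
    using that test_fun_bound[OF assms(1), of "T_int (x - r) (x + r) y"] r
    by (simp add: phi_T_int tent_eq_0_iff[symmetric])
qed

lemma test_fun_0: "test_fun (\<lambda>_. 0)"
  by (auto simp: test_fun_def intro!: lipschitz_onI)

text \<open>Pulling back by \<open>T_int\<close> turns test functions into
  \<open>1 / (2 * r)\<close>-Lipschitz functions that vanish off the interval; the factor 2 is that
  of \<open>integral_norm_meas\<close>.\<close>

lemma alpha_s_leI:
  assumes M: "radon_real M" and N: "radon_real N" and r: "0 < r"
    and K: "\<And>g. (1 / (2 * r))-lipschitz_on UNIV g \<Longrightarrow> (\<And>y. r \<le> \<bar>y - x\<bar> \<Longrightarrow> g y = 0) \<Longrightarrow>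
      \<bar>integral\<^sup>L M g / integral\<^sup>L M (tent x r) - integral\<^sup>L N g / integral\<^sup>L N (tent x r)\<bar> \<le> K"
  shows "alpha_s M N (x - r) (x + r) \<le> 2 * K"
  unfolding alpha_s_def W1_def
proof (rule cSUP_least)
  show "{\<psi>. test_fun \<psi>} \<noteq> {}" using test_fun_0 by blast
next
  fix \<psi> assume "\<psi> \<in> {\<psi>. test_fun \<psi>}"
  hence \<psi>: "test_fun \<psi>" by simp
  let ?g = "\<lambda>y. \<psi> (T_int (x - r) (x + r) y)"
  have "\<bar>integral\<^sup>L (norm_meas M (x - r) (x + r)) \<psi> - integral\<^sup>L (norm_meas N (x - r) (x + r)) \<psi>\<bar>
    = 2 * \<bar>integral\<^sup>L M ?g / integral\<^sup>L M (tent x r) - integral\<^sup>L N ?g / integral\<^sup>L N (tent x r)\<bar>"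
    unfolding integral_norm_meas[OF M r \<psi>] integral_norm_meas[OF N r \<psi>]
    by (simp only: times_divide_eq_right[symmetric] right_diff_distrib[symmetric] abs_mult abs_numeral)
  also have "\<dots> \<le> 2 * K" using K[OF test_fun_T_int(1)[OF \<psi> r] test_fun_T_int(2)[OF \<psi> r]] by simp
  finally show "\<bar>integral\<^sup>L (norm_meas M (x - r) (x + r)) \<psi> - integral\<^sup>L (norm_meas N (x - r) (x + r)) \<psi>\<bar> \<le> 2 * K" .
qed

lemma abs_ratio_le:
  assumes M: "radon_real M" and g: "L-lipschitz_on UNIV g" and r: "0 < r"
    and z: "\<And>y. r \<le> \<bar>y - x\<bar> \<Longrightarrow> g y = (0::real)"
  shows "\<bar>integral\<^sup>L M g / integral\<^sup>L M (tent x r)\<bar> \<le> L * r"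
proof (cases "integral\<^sup>L M (tent x r) = 0")
  case False
  hence "0 < integral\<^sup>L M (tent x r)" using integral_tent_nonneg[of M x r] by linarith
  thus ?thesis using abs_integral_le_tent[OF assms] by (simp add: abs_divide field_simps)
qed (use lipschitz_on_nonneg[OF g] r in simp)

lemma alpha_s_le_2:
  assumes "radon_real M" "radon_real N" "0 < r"
  shows "alpha_s M N (x - r) (x + r) \<le> 2"
proof -
  have "alpha_s M N (x - r) (x + r) \<le> 2 * 1"
  proof (rule alpha_s_leI[OF assms])
    fix g assume g: "(1 / (2 * r))-lipschitz_on UNIV g" "\<And>y. r \<le> \<bar>y - x\<bar> \<Longrightarrow> g y = (0::real)"
    show "\<bar>integral\<^sup>L M g / integral\<^sup>L M (tent x r) - integral\<^sup>L N g / integral\<^sup>L N (tent x r)\<bar> \<le> 1"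
    proof -
      have "\<bar>integral\<^sup>L M g / integral\<^sup>L M (tent x r)\<bar> \<le> 1 / (2 * r) * r"
        by (rule abs_ratio_le[OF assms(1) g(1) assms(3) g(2)])
      moreover have "\<bar>integral\<^sup>L N g / integral\<^sup>L N (tent x r)\<bar> \<le> 1 / (2 * r) * r"
        by (rule abs_ratio_le[OF assms(2) g(1) assms(3) g(2)])
      moreover have "1 / (2 * r) * r = 1 / 2" using assms(3) by simp
      ultimately show ?thesis by linarith
    qed
  qed
  thus ?thesis by simp
qed

text \<open>Rescaling \<open>g\<close> to the unit interval and dividing by \<open>2 * r * L\<close>
  gives an admissible test function. Here the supremum is bounded from below, in contrast to
  \<open>alpha_s_leI\<close>.\<close>

lemma ratio_diff_le_alpha_s:
  assumes M: "radon_real M" and N: "radon_real N" and r: "0 < r" and L: "0 < L"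
    and g: "L-lipschitz_on UNIV g" and z: "\<And>y. r \<le> \<bar>y - x\<bar> \<Longrightarrow> g y = (0::real)"
  shows "\<bar>integral\<^sup>L M g / integral\<^sup>L M (tent x r) - integral\<^sup>L N g / integral\<^sup>L N (tent x r)\<bar>
    \<le> L * r * alpha_s M N (x - r) (x + r)"
proof -
  define \<psi> where "\<psi> t = g (x - r + 2 * r * t) / (2 * r * L)" for t
  have \<psi>: "test_fun \<psi>"
    unfolding test_fun_def
  proof (intro conjI allI impI lipschitz_onI)
    fix u v :: real
    have "dist (\<psi> u) (\<psi> v) = dist (g (x - r + 2 * r * u)) (g (x - r + 2 * r * v)) / (2 * r * L)"
      using r L unfolding \<psi>_def dist_real_def by (simp add: diff_divide_distrib[symmetric] abs_divide abs_mult)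
    also have "\<dots> \<le> (L * dist (x - r + 2 * r * u) (x - r + 2 * r * v)) / (2 * r * L)"
      using r L by (intro divide_right_mono lipschitz_onD[OF g]) auto
    also have "dist (x - r + 2 * r * u) (x - r + 2 * r * v) = 2 * r * dist u v"
      using r by (simp add: dist_real_def abs_mult right_diff_distrib[symmetric])
    finally show "dist (\<psi> u) (\<psi> v) \<le> 1 * dist u v" using r L by simp
  next
    fix t :: real assume "t \<notin> {0..1}"
    hence "\<bar>t - 1 / 2\<bar> \<ge> 1 / 2" by auto
    hence "2 * r * \<bar>t - 1 / 2\<bar> \<ge> 2 * r * (1 / 2)" using r by (intro mult_left_mono) auto
    also have "2 * r * \<bar>t - 1 / 2\<bar> = \<bar>2 * r * (t - 1 / 2)\<bar>" using r by (simp add: abs_mult)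
    also have "2 * r * (t - 1 / 2) = x - r + 2 * r * t - x" by (simp add: algebra_simps)
    finally show "\<psi> t = 0" using z[of "x - r + 2 * r * t"] by (simp add: \<psi>_def)
  qed simp
  have T: "\<psi> (T_int (x - r) (x + r) y) = g y / (2 * r * L)" for y
    using r by (simp add: \<psi>_def T_int_def field_simps)
  let ?d = "\<lambda>\<psi>. \<bar>integral\<^sup>L (norm_meas M (x - r) (x + r)) \<psi> - integral\<^sup>L (norm_meas N (x - r) (x + r)) \<psi>\<bar>"
  \<comment> \<open>A real supremum dominates its members only if they are bounded above; each
    normalised integral is at most 1 in absolute value, hence the bound 2.\<close>
  have "bdd_above (?d ` {\<psi>. test_fun \<psi>})"
  proof (rule bdd_aboveI2)
    fix \<psi> assume "\<psi> \<in> {\<psi>. test_fun \<psi>}"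
    hence h: "test_fun \<psi>" by simp
    have "\<bar>integral\<^sup>L (norm_meas R (x - r) (x + r)) \<psi>\<bar> \<le> 1" if R: "radon_real R" for R
    proof -
      have "\<bar>integral\<^sup>L R (\<lambda>y. \<psi> (T_int (x - r) (x + r) y)) / integral\<^sup>L R (tent x r)\<bar> \<le> 1 / (2 * r) * r"
        by (rule abs_ratio_le[OF R test_fun_T_int(1)[OF h r] r test_fun_T_int(2)[OF h r]])
      thus ?thesis unfolding integral_norm_meas[OF R r h] using r by (simp add: abs_mult abs_divide mult.commute)
    qed
    from this[OF M] this[OF N] show "?d \<psi> \<le> 2" by linarith
  qed
  hence "?d \<psi> \<le> alpha_s M N (x - r) (x + r)"
    unfolding alpha_s_def W1_def using \<psi> by (intro cSUP_upper) auto
  moreover have "?d \<psi> = \<bar>integral\<^sup>L M g / integral\<^sup>L M (tent x r) - integral\<^sup>L N g / integral\<^sup>L N (tent x r)\<bar> / (L * r)"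
  proof -
    have e: "2 * (A / (2 * r * L)) / B = (A / B) / (L * r)" for A B
      using r L by simp
    show ?thesis
      unfolding integral_norm_meas[OF M r \<psi>] integral_norm_meas[OF N r \<psi>] T integral_divide_zero e
      using r L by (simp only: diff_divide_distrib[symmetric] abs_divide) (simp add: abs_mult)
  qed
  ultimately have "\<bar>integral\<^sup>L M g / integral\<^sup>L M (tent x r) - integral\<^sup>L N g / integral\<^sup>L N (tent x r)\<bar> / (L * r)
    \<le> alpha_s M N (x - r) (x + r)" by (simp only:)
  moreover have "0 < L * r" using r L by simp
  ultimately show ?thesis by (metis mult.commute pos_divide_le_eq)
qed

lemma alpha_s_nonneg:
  assumes "radon_real M" "radon_real N" "0 < r"
  shows "0 \<le> alpha_s M N (x - r) (x + r)"
proof -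
  have "(1::real)-lipschitz_on UNIV (\<lambda>_::real. 0::real)" by (auto intro!: lipschitz_onI)
  from ratio_diff_le_alpha_s[OF assms _ this, of x] show ?thesis using assms(3) by (simp add: zero_le_mult_iff)
qed

text \<open>Serves to change the normalisation. Only \<open>v\<close> appears in the resulting
  denominator: \<open>u\<close> comes from \<mu>, which is not doubling, and may be arbitrarily
  small or 0. In the latter case \<open>a = 0\<close> as well.\<close>

lemma ratio_perturb:
  fixes a b u v k :: real
  assumes "\<bar>a\<bar> \<le> k * u" "\<bar>b\<bar> \<le> k * v" "0 \<le> u" "0 < v" "0 \<le> k"
  shows "\<bar>a / u - b / v\<bar> \<le> (\<bar>a - b\<bar> + k * \<bar>u - v\<bar>) / v"
proof (cases "u = 0")
  case True
  thus ?thesis using assms by (simp add: abs_divide divide_right_mono)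
next
  case False
  hence u: "0 < u" using assms by simp
  have "a / u - b / v = ((a - b) + (a / u) * (v - u)) / v"
    using u assms(4) by (simp add: field_simps)
  hence "\<bar>a / u - b / v\<bar> = \<bar>(a - b) + (a / u) * (v - u)\<bar> / v" using assms(4) by (simp add: abs_divide)
  also have "\<dots> \<le> (\<bar>a - b\<bar> + \<bar>a / u\<bar> * \<bar>v - u\<bar>) / v"
    using assms(4) by (intro divide_right_mono) (simp_all only: abs_mult[symmetric] abs_triangle_ineq less_imp_le)
  also have "\<dots> \<le> (\<bar>a - b\<bar> + k * \<bar>u - v\<bar>) / v"
    using assms u by (intro divide_right_mono add_mono order_refl mult_mono)
      (auto simp: abs_divide field_simps abs_minus_commute)
  finally show ?thesis .
qed

section \<open>One refinement step\<close>

definition children :: "int \<Rightarrow> int set" where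
  "children j = {2 * j - 1..2 * j + 1}"

lemma finite_children [simp]: "finite (children j)"
  by (simp add: children_def)

lemma children_eq: "children j = {(j - 1) * 2 ^ 1<..<(j + 1) * 2 ^ 1}"
  by (auto simp: children_def)

lemma hat_grid_Suc_pos_iff: "0 < hat n j (grid (Suc n) i) \<longleftrightarrow> i \<in> children j"
  using hat_grid_pos_iff[of n j 1 i] by (simp add: children_eq)

lemma hat_grid_Suc_ge:
  assumes "i \<in> children j" shows "1 / 2 \<le> hat n j (grid (Suc n) i)"
proof -
  have "2 * real_of_int j - 1 \<le> of_int i" "real_of_int i \<le> 2 * of_int j + 1"
    using assms by (auto simp: children_def)
  hence "\<bar>real_of_int i / 2 - of_int j\<bar> \<le> 1 / 2" by linarith
  thus ?thesis using hat_grid[of n j 1 i] by simp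
qed

lemma grid_child_dist:
  assumes "i \<in> children j" shows "\<bar>grid (Suc n) i - grid n j\<bar> \<le> 1 / 2 / 2 ^ n"
proof -
  have "2 * real_of_int j - 1 \<le> of_int i" "real_of_int i \<le> 2 * of_int j + 1"
    using assms by (auto simp: children_def)
  hence "\<bar>real_of_int i / 2 - of_int j\<bar> \<le> 1 / 2" by linarith
  moreover have "grid (Suc n) i - grid n j = (real_of_int i / 2 - of_int j) / 2 ^ n"
    by (simp add: grid_def diff_divide_distrib)
  ultimately show ?thesis by (simp add: abs_divide divide_right_mono del: divide_divide_eq_left)
qed

text \<open>In the refinement of the parent the child has coefficient at least 1/2, and all other
  terms are nonnegative.\<close>

lemma hat_child_le:
  assumes "i \<in> children j" shows "hat (Suc n) i y \<le> 2 * hat n j y"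
proof -
  have "1 / 2 * hat (Suc n) i y \<le> hat n j (grid (Suc n) i) * hat (Suc n) i y"
    by (intro mult_right_mono hat_grid_Suc_ge assms) simp
  also have "\<dots> \<le> (\<Sum>i\<in>children j. hat n j (grid (Suc n) i) * hat (Suc n) i y)"
    by (rule member_le_sum[OF assms]) auto
  also have "\<dots> = hat n j y" using hat_refine[of "children j" j 1 n y] children_eq[of j] by simp
  finally show ?thesis by simp
qed

lemma mass_child_le:
  assumes "radon_real M" "i \<in> children j" shows "mass M (Suc n) i \<le> 2 * mass M n j"
proof -
  have "mass M (Suc n) i \<le> integral\<^sup>L M (\<lambda>y. 2 * hat n j y)"
    unfolding mass_def using assms
    by (intro integral_mono) (auto simp: hat_child_le radon_integrable_hat)
  thus ?thesis by (simp add: mass_def)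
qed

lemma mass_children:
  assumes "radon_real M"
  shows "mass M n j = (\<Sum>i\<in>children j. hat n j (grid (Suc n) i) * mass M (Suc n) i)"
  using mass_refine[OF assms, of "children j" j 1 n] children_eq[of j] by simp

text \<open>The linear terms are preserved by refinement, so they do not affect the growth of the entropy; they make
  \<open>Psi\<close> nonnegative, which allows dropping hats from a sum.\<close>

definition Psi :: "real \<Rightarrow> real \<Rightarrow> real" where
  "Psi m v = m * ln (m / v) - m + v"

text \<open>The Legendre dual bound for the entropy, from \<open>ln s \<le> s - 1\<close> at
  \<open>s = t * v / m\<close>. The case \<open>t = 1\<close> gives nonnegativity; large
  \<open>t\<close> detects \<mu>-mass sitting where \<nu> has little.\<close>

lemma Psi_ge:
  assumes "0 \<le> m" "0 < v" "0 < t"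
  shows "m * ln t - t * v \<le> Psi m v - v"
proof (cases "m = 0")
  case True
  thus ?thesis using assms by (simp add: Psi_def)
next
  case False
  hence m: "0 < m" using assms by simp
  have "ln (t * v / m) \<le> t * v / m - 1" using m assms by (intro ln_le_minus_one) simp
  moreover have "ln (t * v / m) = ln t - ln (m / v)" using m assms by (simp add: ln_mult ln_div)
  ultimately have "m * (ln t - ln (m / v)) \<le> m * (t * v / m - 1)"
    using m by (intro mult_left_mono) auto
  also have "\<dots> = t * v - m" using m by (simp add: field_simps)
  finally show ?thesis by (simp add: Psi_def algebra_simps)
qed

lemma Psi_nonneg: "0 \<le> m \<Longrightarrow> 0 < v \<Longrightarrow> 0 \<le> Psi m v"
  using Psi_ge[of m v 1] by simp

text \<open>The factor 64 covers every comparison of scales that is made below.\<close>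

locale doubling_pair =
  fixes \<mu> \<nu> :: "real measure" and C :: real
  assumes mu: "radon_real \<mu>" and nu: "radon_real \<nu>"
    and C_pos: "0 < C"
    and tent_pos: "\<And>c \<rho>. 0 < \<rho> \<Longrightarrow> 0 < integral\<^sup>L \<nu> (tent c \<rho>)"
    and tent_doubling: "\<And>c \<rho> c' \<rho>'. 0 < \<rho> \<Longrightarrow> 0 < \<rho>' \<Longrightarrow> \<bar>c - c'\<bar> + \<rho>' \<le> 64 * \<rho> \<Longrightarrow>
      integral\<^sup>L \<nu> (tent c' \<rho>') \<le> C * integral\<^sup>L \<nu> (tent c \<rho>)"
begin

definition beta2 :: "nat \<Rightarrow> int \<Rightarrow> real" where
  "beta2 n j = (\<Sum>i\<in>children j. (mass \<mu> (Suc n) i / mass \<mu> n j - mass \<nu> (Suc n) i / mass \<nu> n j)\<^sup>2)"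

lemma beta2_nonneg: "0 \<le> beta2 n j"
  by (simp add: beta2_def sum_nonneg)

lemma mass_nu_pos: "0 < mass \<nu> n j"
  by (simp add: mass_def hat_def tent_pos)

text \<open>Hat and child are compared with the tent of radius \<open>r\<close> at \<open>x\<close>:
  their supports lie in the interval because \<open>3 + 1 < 8\<close>, and their Lipschitz constants
  times \<open>r\<close> are at most 16 and 32. Passing from the tent to the hat as normaliser costs
  \<open>32 + 2 * 16 = 64\<close> by \<open>ratio_perturb\<close>, and a factor \<open>C\<close> by
  doubling of \<nu>. The factor 3 counts the children.\<close>

lemma beta2_le_alpha_s:
  assumes x: "\<bar>x - grid n j\<bar> \<le> 3 / 2 ^ n" and r: "8 / 2 ^ n \<le> r" "r \<le> 16 / 2 ^ n"
  shows "beta2 n j \<le> 3 * (64 * C)\<^sup>2 * (alpha_s \<mu> \<nu> (x - r) (x + r))\<^sup>2"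
proof -
  define \<alpha> where "\<alpha> = alpha_s \<mu> \<nu> (x - r) (x + r)"
  define h where "h = (1::real) / 2 ^ n"
  have h: "0 < h" by (simp add: h_def)
  have x': "\<bar>x - grid n j\<bar> \<le> 3 * h" and r': "8 * h \<le> r" "r \<le> 16 * h" using x r by (simp_all add: h_def)
  have r0: "0 < r" using r' h by linarith
  have \<alpha>0: "0 \<le> \<alpha>" unfolding \<alpha>_def by (rule alpha_s_nonneg[OF mu nu r0])
  define P where "P = integral\<^sup>L \<mu> (tent x r)"
  define Q where "Q = integral\<^sup>L \<nu> (tent x r)"
  have Q0: "0 < Q" unfolding Q_def by (rule tent_pos[OF r0])
  have P0: "0 \<le> P" unfolding P_def by simp
  have rp: "2 ^ n * r \<le> 16" using r(2) by (simp add: field_simps)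
  have QC: "Q \<le> C * mass \<nu> n j"
    unfolding Q_def mass_def hat_def
  proof (rule tent_doubling[OF _ r0])
    show "\<bar>grid n j - x\<bar> + r \<le> 64 * (1 / 2 ^ n)" unfolding h_def[symmetric] using x' r' h by linarith
  qed simp
  define v where "v = mass \<nu> n j / Q"
  have v0: "0 < v" using mass_nu_pos Q0 by (simp add: v_def)
  have vC: "1 \<le> C * v" using QC Q0 by (simp add: v_def field_simps)
  define u where "u = mass \<mu> n j / P"
  have u0: "0 \<le> u" using P0 by (simp add: u_def)
  have zj: "hat n j y = 0" if "r \<le> \<bar>y - x\<bar>" for y
  proof -
    have "\<bar>y - x\<bar> \<le> \<bar>y - grid n j\<bar> + \<bar>x - grid n j\<bar>" by linarith
    hence "h \<le> \<bar>y - grid n j\<bar>" using that x' r' h by linarith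
    thus ?thesis unfolding hat_def h_def by (simp add: tent_eq_0_iff)
  qed
  \<comment> \<open>Ensures that cancelling \<open>P\<close> in \<open>a / u\<close> is correct even
    when \<open>P = 0\<close>.\<close>
  have muz: "mass \<mu> n j = 0" if "P = 0"
  proof -
    have "\<bar>mass \<mu> n j\<bar> \<le> 2 ^ n * r * P"
      unfolding mass_def P_def by (rule abs_integral_le_tent[OF mu hat_lipschitz r0 zj])
    thus ?thesis using that mass_nonneg[of \<mu> n j] by simp
  qed
  have uv: "\<bar>u - v\<bar> \<le> 16 * \<alpha>"
  proof -
    have "\<bar>u - v\<bar> \<le> 2 ^ n * r * \<alpha>"
      unfolding u_def v_def mass_def P_def Q_def \<alpha>_def
      by (rule ratio_diff_le_alpha_s[OF mu nu r0 _ hat_lipschitz zj]) simp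
    also have "\<dots> \<le> 16 * \<alpha>" using \<alpha>0 rp by (intro mult_right_mono)
    finally show ?thesis .
  qed
  have main: "\<bar>mass \<mu> (Suc n) i / mass \<mu> n j - mass \<nu> (Suc n) i / mass \<nu> n j\<bar> \<le> 64 * C * \<alpha>"
    if i: "i \<in> children j" for i
  proof -
    define a where "a = mass \<mu> (Suc n) i / P"
    define b where "b = mass \<nu> (Suc n) i / Q"
    have zi: "hat (Suc n) i y = 0" if "r \<le> \<bar>y - x\<bar>" for y
      using hat_child_le[OF i, of n y] zj[OF that] hat_nonneg[of "Suc n" i y] by linarith
    have ab: "\<bar>a - b\<bar> \<le> 32 * \<alpha>"
    proof -
      have "\<bar>a - b\<bar> \<le> 2 ^ Suc n * r * \<alpha>"
        unfolding a_def b_def mass_def P_def Q_def \<alpha>_def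
        by (rule ratio_diff_le_alpha_s[OF mu nu r0 _ hat_lipschitz zi]) simp
      also have "\<dots> \<le> 32 * \<alpha>" using \<alpha>0 rp by (intro mult_right_mono) (auto simp: mult.commute)
      finally show ?thesis .
    qed
    have "\<bar>a / u - b / v\<bar> \<le> (\<bar>a - b\<bar> + 2 * \<bar>u - v\<bar>) / v"
    proof (rule ratio_perturb)
      show "\<bar>a\<bar> \<le> 2 * u" "\<bar>b\<bar> \<le> 2 * v"
        using mass_child_le[OF mu i] mass_child_le[OF nu i] P0 Q0
        by (auto simp: a_def u_def b_def v_def abs_divide intro: divide_right_mono)
    qed (use u0 v0 in auto)
    also have "\<dots> \<le> (64 * \<alpha>) / v" using ab uv v0 by (intro divide_right_mono) auto
    also have "\<dots> \<le> (64 * \<alpha>) * C"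
    proof -
      have "64 * \<alpha> * 1 \<le> 64 * \<alpha> * (C * v)" using \<alpha>0 vC by (intro mult_left_mono) auto
      thus ?thesis using v0 by (simp add: field_simps)
    qed
    also have "b / v = mass \<nu> (Suc n) i / mass \<nu> n j" using Q0 by (simp add: b_def v_def)
    also have "a / u = mass \<mu> (Suc n) i / mass \<mu> n j"
      using muz by (cases "P = 0") (simp_all add: a_def u_def)
    finally show ?thesis by (simp add: mult_ac)
  qed
  have "beta2 n j \<le> (\<Sum>i\<in>children j. (64 * C * \<alpha>)\<^sup>2)"
    unfolding beta2_def
  proof (rule sum_mono)
    fix i assume "i \<in> children j"
    from main[OF this] show "(mass \<mu> (Suc n) i / mass \<mu> n j - mass \<nu> (Suc n) i / mass \<nu> n j)\<^sup>2 \<le> (64 * C * \<alpha>)\<^sup>2"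
      by (metis abs_ge_zero power2_abs power_mono)
  qed
  also have "\<dots> = 3 * (64 * C)\<^sup>2 * \<alpha>\<^sup>2" by (simp add: children_def power_mult_distrib)
  finally show ?thesis unfolding \<alpha>_def .
qed

text \<open>With \<open>p\<close> and \<open>q\<close> the transition probabilities,
  \<open>ln (p / q) \<le> p / q - 1\<close> and \<open>p * (p / q - 1)\<close> equals
  \<open>(p - q)^2 / q\<close> plus \<open>p - q\<close>. Doubling of \<nu> gives
  \<open>1 / q \<le> C\<close>, so the quadratic part is the chi-squared error. All remaining terms
  are linear and add up exactly, because the refinement weights reproduce both masses.\<close>

lemma entropy_step:
  "(\<Sum>i\<in>children j. hat n j (grid (Suc n) i) * Psi (mass \<mu> (Suc n) i) (mass \<nu> (Suc n) i))
    \<le> Psi (mass \<mu> n j) (mass \<nu> n j) + C * mass \<mu> n j * beta2 n j"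
proof -
  define c where "c i = hat n j (grid (Suc n) i)" for i
  define m where "m i = mass \<mu> (Suc n) i" for i
  define v where "v i = mass \<nu> (Suc n) i" for i
  define M where "M = mass \<mu> n j"
  define V where "V = mass \<nu> n j"
  have c: "0 \<le> c i" "c i \<le> 1" for i by (simp_all add: c_def hat_le_1)
  have m: "0 \<le> m i" for i by (simp add: m_def)
  have v: "0 < v i" for i by (simp add: v_def mass_nu_pos)
  have V: "0 < V" by (simp add: V_def mass_nu_pos)
  have sm: "(\<Sum>i\<in>children j. c i * m i) = M"
    unfolding c_def m_def M_def by (rule mass_children[OF mu, symmetric])
  have sv: "(\<Sum>i\<in>children j. c i * v i) = V"
    unfolding c_def v_def V_def by (rule mass_children[OF nu, symmetric])
  have "(\<Sum>i\<in>children j. c i * Psi (m i) (v i)) \<le> Psi M V + C * M * beta2 n j"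
  proof (cases "M = 0")
    case True
    have "m i = 0" if "i \<in> children j" for i
      using mass_child_le[OF mu that, of n] True m[of i] unfolding m_def M_def by simp
    hence "(\<Sum>i\<in>children j. c i * Psi (m i) (v i)) = (\<Sum>i\<in>children j. c i * v i)"
      by (intro sum.cong) (auto simp: Psi_def)
    thus ?thesis using True sv by (simp add: Psi_def)
  next
    case False
    hence M: "0 < M" by (simp add: M_def order_less_le)
    define d where "d i = (m i / M - v i / V)\<^sup>2" for i
    \<comment> \<open>The first two terms are the tangent plane of \<open>Psi\<close> at
      \<open>(M, V)\<close>. As \<open>Psi\<close> is homogeneous of degree 1, their weighted sum is
      \<open>Psi M V\<close> itself.\<close>
    have step: "c i * Psi (m i) (v i) \<le> ln (M / V) * (c i * m i) + (1 - M / V) * (c i * v i) + C * M * d i"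
      if i: "i \<in> children j" for i
    proof -
      have Vv: "V \<le> C * v i"
        unfolding V_def v_def mass_def hat_def
      proof (rule tent_doubling)
        have "\<bar>grid (Suc n) i - grid n j\<bar> \<le> 1 / 2 / 2 ^ n" by (rule grid_child_dist[OF i])
        moreover have "1 / 2 / 2 ^ n + 1 / 2 ^ n \<le> 64 * (1 / 2 ^ Suc n :: real)" by (simp add: field_simps)
        ultimately show "\<bar>grid (Suc n) i - grid n j\<bar> + 1 / 2 ^ n \<le> 64 * (1 / 2 ^ Suc n)" by linarith
      qed simp_all
      define p where "p = m i / M"
      define q where "q = v i / V"
      have q: "0 < q" using v[of i] V by (simp add: q_def)
      have qC: "1 \<le> C * q" using V Vv by (simp add: q_def pos_le_divide_eq)
      have mi: "m i = M * p" using M by (simp add: p_def)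
      have p: "0 \<le> p" using m[of i] M by (simp add: p_def)
      have "m i * ln (m i / v i) \<le> m i * ln (M / V) + m i * (p / q - 1)"
      proof (cases "m i = 0")
        case False
        hence p0: "0 < p" using m[of i] M by (simp add: p_def order_less_le)
        have "m i / v i = (M / V) * (p / q)" using M V v[of i] by (simp add: p_def q_def)
        hence "ln (m i / v i) = ln (M / V) + ln (p / q)" using M V p0 q by (simp only: ln_mult_pos divide_pos_pos)
        also have "ln (p / q) \<le> p / q - 1" using p0 q by (intro ln_le_minus_one) simp
        finally have "m i * ln (m i / v i) \<le> m i * (ln (M / V) + (p / q - 1))"
          using m[of i] by (intro mult_left_mono) auto
        thus ?thesis by (simp add: algebra_simps)
      qed simp
      moreover have "m i * (p / q - 1) \<le> C * M * d i + (m i - M / V * v i)"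
      proof -
        have "p * (p / q - 1) = (p - q)\<^sup>2 / q + (p - q)"
          using q by (simp add: power2_eq_square field_simps)
        moreover have "(p - q)\<^sup>2 / q \<le> C * (p - q)\<^sup>2"
        proof -
          have "(p - q)\<^sup>2 * 1 \<le> (p - q)\<^sup>2 * (C * q)" by (intro mult_left_mono qC) simp
          thus ?thesis using q by (simp add: pos_divide_le_eq mult_ac)
        qed
        ultimately have "M * (p * (p / q - 1)) \<le> M * (C * (p - q)\<^sup>2 + (p - q))"
          using M by (intro mult_left_mono) auto
        moreover have "M * (p - q) = m i - M / V * v i" using M V by (simp add: p_def q_def right_diff_distrib)
        moreover have "(p - q)\<^sup>2 = d i" by (simp add: d_def p_def q_def)
        ultimately show ?thesis by (simp add: mi distrib_left mult_ac)
      qed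
      ultimately have "m i * ln (m i / v i) \<le> m i * ln (M / V) + (C * M * d i + (m i - M / V * v i))"
        by linarith
      hence *: "Psi (m i) (v i) \<le> ln (M / V) * m i + (1 - M / V) * v i + C * M * d i"
        by (simp add: Psi_def algebra_simps)
      have "c i * Psi (m i) (v i) \<le> c i * (ln (M / V) * m i + (1 - M / V) * v i + C * M * d i)"
        by (intro mult_left_mono * c)
      also have "\<dots> = ln (M / V) * (c i * m i) + (1 - M / V) * (c i * v i) + c i * (C * M * d i)"
        by (simp add: algebra_simps)
      finally have "c i * Psi (m i) (v i)
        \<le> ln (M / V) * (c i * m i) + (1 - M / V) * (c i * v i) + c i * (C * M * d i)" .
      moreover have "c i * (C * M * d i) \<le> 1 * (C * M * d i)"
        using C_pos M by (intro mult_right_mono c) (simp add: d_def)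
      ultimately show ?thesis by linarith
    qed
    have "(\<Sum>i\<in>children j. c i * Psi (m i) (v i))
      \<le> (\<Sum>i\<in>children j. ln (M / V) * (c i * m i) + (1 - M / V) * (c i * v i) + C * M * d i)"
      by (rule sum_mono[OF step])
    also have "\<dots> = ln (M / V) * M + (1 - M / V) * V + C * M * (\<Sum>i\<in>children j. d i)"
      by (simp add: sum.distrib sum_distrib_left[symmetric] sm sv)
    also have "(\<Sum>i\<in>children j. d i) = beta2 n j"
      by (simp add: beta2_def d_def m_def v_def M_def V_def)
    also have "ln (M / V) * M + (1 - M / V) * V = Psi M V"
      using V by (simp add: Psi_def algebra_simps)
    finally show ?thesis .
  qed
  thus ?thesis by (simp add: c_def m_def v_def M_def V_def)
qed

end

section \<open>Relative entropy along the refinement\<close>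

text \<open>The sum interpolates the indicator function of the chosen grid points.\<close>

lemma sum_hat_le_1:
  assumes "finite I" shows "(\<Sum>i\<in>I. hat n i y) \<le> 1"
proof -
  define f :: "real \<Rightarrow> real" where "f z = (if z \<in> grid n ` I then 1 else 0)" for z
  have inj: "grid n i = grid n i' \<longleftrightarrow> i = i'" for i i' by (simp add: grid_def)
  have g: "f (grid n i) = (if i \<in> I then 1 else 0)" for i by (auto simp: f_def inj)
  have "(\<Sum>i\<in>I. hat n i y) = (\<Sum>i\<in>I. f (grid n i) * hat n i y)" by (intro sum.cong) (auto simp: g)
  also have "\<dots> = interp n f y" using assms g by (intro sum_hat_eq_interp) (auto split: if_splits)
  also have "\<dots> \<le> 1"
  proof -
    define m where "m = \<lfloor>2 ^ n * y\<rfloor>"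
    define t where "t = 2 ^ n * y - of_int m"
    have t: "0 \<le> t" "t < 1" unfolding t_def m_def by linarith+
    have "f z \<le> 1" for z by (simp add: f_def)
    hence "(1 - t) * f (grid n m) + t * f (grid n (m + 1)) \<le> (1 - t) * 1 + t * 1"
      using t by (intro add_mono mult_left_mono) auto
    thus ?thesis unfolding interp_def Let_def m_def[symmetric] t_def[symmetric] by simp
  qed
  finally show ?thesis .
qed

text \<open>Exactly the grid points where the weight \<open>tent 0 R\<close> is positive. Since
  \<open>R\<close> is an integer, the hats centred there are supported in the closed interval from
  \<open>-R\<close> to \<open>R\<close>.\<close>

definition idx :: "nat \<Rightarrow> nat \<Rightarrow> int set" where
  "idx R n = {- (int R * 2 ^ n)<..<int R * 2 ^ n}"

lemma finite_idx [simp]: "finite (idx R n)"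
  by (simp add: idx_def)

lemma mem_idx_iff: "i \<in> idx R n \<longleftrightarrow> \<bar>grid n i\<bar> < real R"
proof -
  have "\<bar>grid n i\<bar> < real R \<longleftrightarrow> \<bar>real_of_int i\<bar> < real R * 2 ^ n"
    by (simp add: grid_def abs_divide pos_divide_less_eq)
  also have "\<dots> \<longleftrightarrow> real_of_int \<bar>i\<bar> < real_of_int (int R * 2 ^ n)" by simp
  also have "\<dots> \<longleftrightarrow> \<bar>i\<bar> < int R * 2 ^ n" by (simp only: of_int_less_iff)
  also have "\<dots> \<longleftrightarrow> i \<in> idx R n" by (auto simp: idx_def)
  finally show ?thesis by simp
qed

lemma grid_idx_bound:
  assumes "i \<in> idx R n" shows "\<bar>grid n i\<bar> + 1 / 2 ^ n \<le> real R"
proof -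
  have "\<bar>i\<bar> + 1 \<le> int R * 2 ^ n" using assms by (auto simp: idx_def)
  hence "real_of_int (\<bar>i\<bar> + 1) \<le> real_of_int (int R * 2 ^ n)" by (simp only: of_int_le_iff)
  hence "(\<bar>real_of_int i\<bar> + 1) / 2 ^ n \<le> real R" by (simp add: pos_divide_le_eq)
  thus ?thesis by (simp add: grid_def abs_divide add_divide_distrib)
qed

lemma hat_idx_eq_0:
  assumes "i \<in> idx R n" "y \<notin> {- real R..real R}" shows "hat n i y = 0"
proof -
  have "1 / 2 ^ n \<le> \<bar>y - grid n i\<bar>" using grid_idx_bound[OF assms(1)] assms(2) by auto
  thus ?thesis by (simp add: hat_def tent_eq_0_iff)
qed

text \<open>An integer radius puts the kinks on every grid. Evaluated at grid points of a later
  generation, this identity says that the shares which a hat receives from its ancestors add up to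
  its own weight.\<close>

lemma weight_refine:
  assumes "0 < R"
  shows "tent 0 (real R) y = (\<Sum>j\<in>idx R n. tent 0 (real R) (grid n j) * hat n j y)"
proof -
  have "interp n (tent 0 (real R)) = tent 0 (real R)"
    using assms by (intro interp_tent) auto
  moreover have "i \<in> idx R n" if "tent 0 (real R) (grid n i) \<noteq> 0" for i
    using that assms by (simp add: mem_idx_iff tent_eq_0_iff)
  ultimately show ?thesis using sum_hat_eq_interp[of "idx R n" "tent 0 (real R)" n y] by simp
qed

context doubling_pair
begin

definition good :: "real set \<Rightarrow> nat \<Rightarrow> nat \<Rightarrow> int set" where
  "good F R n = {j \<in> idx R n. \<exists>x\<in>F. \<bar>x - grid n j\<bar> \<le> 1 / 2 ^ n}"

definition entropy :: "real set \<Rightarrow> nat \<Rightarrow> nat \<Rightarrow> real" where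
  "entropy F R n = (\<Sum>j\<in>good F R n. tent 0 (real R) (grid n j) * Psi (mass \<mu> n j) (mass \<nu> n j))"

text \<open>The radius of 3 mesh widths leaves room for replacing a point of the support of a hat by
  a point of \<open>F\<close> at distance at most 2 mesh widths.\<close>

definition local_beta2 :: "nat \<Rightarrow> nat \<Rightarrow> real \<Rightarrow> real" where
  "local_beta2 R n x = (\<Sum>j\<in>idx R n. if \<bar>x - grid n j\<bar> \<le> 3 / 2 ^ n then beta2 n j else 0)"

lemma local_beta2_nonneg: "0 \<le> local_beta2 R n x"
  unfolding local_beta2_def by (intro sum_nonneg) (simp add: beta2_nonneg)

lemma finite_good [simp]: "finite (good F R n)"
  by (simp add: good_def)

lemma good_subset: "good F R n \<subseteq> idx R n"
  by (auto simp: good_def)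

text \<open>The support of a child lies in that of its parent. Thus a retained hat has all its
  parents retained and keeps its full weight when hats far from \<open>F\<close> are
  discarded.\<close>

lemma good_parent:
  assumes "i \<in> good F R (Suc n)" "j \<in> idx R n" "i \<in> children j" shows "j \<in> good F R n"
proof -
  obtain x where x: "x \<in> F" "\<bar>x - grid (Suc n) i\<bar> \<le> 1 / 2 ^ Suc n" using assms(1) by (auto simp: good_def)
  have "\<bar>x - grid n j\<bar> \<le> 1 / 2 ^ Suc n + 1 / 2 / 2 ^ n"
    using x(2) grid_child_dist[OF assms(3), of n] by linarith
  also have "\<dots> = 1 / 2 ^ n" by simp
  finally show ?thesis using x(1) assms(2) by (auto simp: good_def)
qed

text \<open>The weight of each good child is split among its parents and the sums are exchanged.
  Children that are not good are then added back, which is harmless because \<open>Psi\<close> is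
  nonnegative, and \<open>entropy_step\<close> applies to each parent. In the error term the weight
  is bounded by 1.\<close>

lemma entropy_Suc:
  assumes "0 < R"
  shows "entropy F R (Suc n) \<le> entropy F R n + C * (\<Sum>j\<in>good F R n. mass \<mu> n j * beta2 n j)"
proof -
  let ?w = "tent 0 (real R)"
  let ?P = "\<lambda>n i. Psi (mass \<mu> n i) (mass \<nu> n i)"
  have P: "0 \<le> ?P n i" for n i by (intro Psi_nonneg mass_nu_pos) simp
  have "?w (grid (Suc n) i) = (\<Sum>j\<in>good F R n. ?w (grid n j) * hat n j (grid (Suc n) i))"
    if "i \<in> good F R (Suc n)" for i
  proof -
    have "?w (grid (Suc n) i) = (\<Sum>j\<in>idx R n. ?w (grid n j) * hat n j (grid (Suc n) i))"
      by (rule weight_refine[OF assms])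
    also have "\<dots> = (\<Sum>j\<in>good F R n. ?w (grid n j) * hat n j (grid (Suc n) i))"
    proof (rule sum.mono_neutral_right)
      show "\<forall>j\<in>idx R n - good F R n. ?w (grid n j) * hat n j (grid (Suc n) i) = 0"
      proof
        fix j assume "j \<in> idx R n - good F R n"
        hence "i \<notin> children j" using good_parent[OF that] by blast
        hence "hat n j (grid (Suc n) i) = 0"
          using hat_grid_Suc_pos_iff[of n j i] hat_nonneg[of n j "grid (Suc n) i"] by linarith
        thus "?w (grid n j) * hat n j (grid (Suc n) i) = 0" by simp
      qed
    qed (auto simp: good_def)
    finally show ?thesis .
  qed
  hence "entropy F R (Suc n) = (\<Sum>i\<in>good F R (Suc n). \<Sum>j\<in>good F R n.
      ?w (grid n j) * (hat n j (grid (Suc n) i) * ?P (Suc n) i))"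
    unfolding entropy_def by (intro sum.cong refl) (simp add: sum_distrib_right mult.assoc)
  also have "\<dots> = (\<Sum>j\<in>good F R n. ?w (grid n j) *
      (\<Sum>i\<in>good F R (Suc n). hat n j (grid (Suc n) i) * ?P (Suc n) i))"
    by (subst sum.swap) (simp add: sum_distrib_left)
  also have "\<dots> \<le> (\<Sum>j\<in>good F R n. ?w (grid n j) * ?P n j + C * (mass \<mu> n j * beta2 n j))"
  proof (rule sum_mono)
    fix j
    have "(\<Sum>i\<in>good F R (Suc n). hat n j (grid (Suc n) i) * ?P (Suc n) i)
      = (\<Sum>i\<in>good F R (Suc n) \<inter> children j. hat n j (grid (Suc n) i) * ?P (Suc n) i)"
    proof (rule sum.mono_neutral_right)
      show "\<forall>i\<in>good F R (Suc n) - good F R (Suc n) \<inter> children j. hat n j (grid (Suc n) i) * ?P (Suc n) i = 0"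
      proof
        fix i assume "i \<in> good F R (Suc n) - good F R (Suc n) \<inter> children j"
        hence "i \<notin> children j" by blast
        hence "hat n j (grid (Suc n) i) = 0"
          using hat_grid_Suc_pos_iff[of n j i] hat_nonneg[of n j "grid (Suc n) i"] by linarith
        thus "hat n j (grid (Suc n) i) * ?P (Suc n) i = 0" by simp
      qed
    qed auto
    also have "\<dots> \<le> (\<Sum>i\<in>children j. hat n j (grid (Suc n) i) * ?P (Suc n) i)"
      using P by (intro sum_mono2) auto
    also have "\<dots> \<le> ?P n j + C * mass \<mu> n j * beta2 n j" by (rule entropy_step)
    finally have "?w (grid n j) * (\<Sum>i\<in>good F R (Suc n). hat n j (grid (Suc n) i) * ?P (Suc n) i)
      \<le> ?w (grid n j) * (?P n j + C * mass \<mu> n j * beta2 n j)"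
      by (intro mult_left_mono) auto
    also have "\<dots> = ?w (grid n j) * ?P n j + ?w (grid n j) * (C * mass \<mu> n j * beta2 n j)"
      by (rule distrib_left)
    also have "?w (grid n j) * (C * mass \<mu> n j * beta2 n j) \<le> 1 * (C * mass \<mu> n j * beta2 n j)"
      using C_pos beta2_nonneg assms by (intro mult_right_mono tent_le_1) auto
    finally show "?w (grid n j) * (\<Sum>i\<in>good F R (Suc n). hat n j (grid (Suc n) i) * ?P (Suc n) i)
      \<le> ?w (grid n j) * ?P n j + C * (mass \<mu> n j * beta2 n j)" by (simp add: mult.assoc)
  qed
  also have "\<dots> = entropy F R n + C * (\<Sum>j\<in>good F R n. mass \<mu> n j * beta2 n j)"
    by (simp add: entropy_def sum.distrib sum_distrib_left)
  finally show ?thesis .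
qed

lemma entropy_bound:
  assumes "0 < R" "4 \<le> N"
  shows "entropy F R N \<le> entropy F R 4 + C * (\<Sum>n\<in>{4..<N}. \<Sum>j\<in>good F R n. mass \<mu> n j * beta2 n j)"
  using assms(2)
proof (induction N rule: dec_induct)
  case (step n)
  show ?case using entropy_Suc[OF assms(1), of F n] step
    by (simp add: sum.atLeastLessThan_Suc distrib_left)
qed simp

text \<open>The growth of the entropy is an integral against \<mu> over a neighbourhood of
  \<open>F\<close>, so the bound known on \<open>F\<close> has to be transferred to points
  \<open>y\<close> off \<open>F\<close>.\<close>

lemma good_sum_pointwise:
  assumes F: "\<And>x N. x \<in> F \<Longrightarrow> (\<Sum>n\<in>{4..<N}. local_beta2 R n x) \<le> \<Lambda>" and "0 \<le> \<Lambda>"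
  shows "(\<Sum>n\<in>{4..<N}. \<Sum>j\<in>good F R n. hat n j y * beta2 n j) \<le> \<Lambda> * indicator {- real R..real R} y"
proof (cases "y \<in> {- real R..real R}")
  case False
  hence z0: "hat n j y * beta2 n j = 0" if "j \<in> good F R n" for n j
    using hat_idx_eq_0[of j R n y] that good_subset by auto
  have "(\<Sum>n\<in>{4..<N}. \<Sum>j\<in>good F R n. hat n j y * beta2 n j) = 0"
  proof (rule sum.neutral, rule ballI)
    fix n show "(\<Sum>j\<in>good F R n. hat n j y * beta2 n j) = 0"
      by (rule sum.neutral, rule ballI) (rule z0)
  qed
  thus ?thesis using False by simp
next
  case True
  \<comment> \<open>All good hats around \<open>y\<close> up to the last generation having one lie close to a single point of \<open>F\<close>.\<close>
  define S where "S = {n \<in> {4..<N}. \<exists>j\<in>good F R n. 0 < hat n j y}"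
  have z: "(\<Sum>j\<in>good F R n. hat n j y * beta2 n j) = 0" if "n \<in> {4..<N}" "n \<notin> S" for n
  proof (rule sum.neutral, rule ballI)
    fix j assume "j \<in> good F R n"
    hence "\<not> 0 < hat n j y" using that by (auto simp: S_def)
    hence "hat n j y = 0" using hat_nonneg[of n j y] by linarith
    thus "hat n j y * beta2 n j = 0" by simp
  qed
  have "(\<Sum>n\<in>{4..<N}. \<Sum>j\<in>good F R n. hat n j y * beta2 n j) \<le> \<Lambda>"
  proof (cases "S = {}")
    case True
    thus ?thesis using z assms(2) by simp
  next
    case False
    define n0 where "n0 = Max S"
    have fin: "finite S" by (simp add: S_def)
    have "n0 \<in> S" using False fin by (simp add: n0_def)
    then obtain j0 where j0: "j0 \<in> good F R n0" "0 < hat n0 j0 y" by (auto simp: S_def)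
    then obtain x where x: "x \<in> F" "\<bar>x - grid n0 j0\<bar> \<le> 1 / 2 ^ n0" by (auto simp: good_def)
    have xy: "\<bar>x - y\<bar> \<le> 2 * (1 / 2 ^ n0)" using x(2) j0(2) unfolding hat_pos_iff by linarith
    have "(\<Sum>n\<in>{4..<N}. \<Sum>j\<in>good F R n. hat n j y * beta2 n j) \<le> (\<Sum>n\<in>{4..<N}. local_beta2 R n x)"
    proof (rule sum_mono)
      fix n assume n: "n \<in> {4..<N}"
      show "(\<Sum>j\<in>good F R n. hat n j y * beta2 n j) \<le> local_beta2 R n x"
      proof (cases "n \<in> S")
        case False
        thus ?thesis using z[OF n] local_beta2_nonneg by simp
      next
        case True
        hence "n \<le> n0" using fin by (simp add: n0_def)
        hence "(1::real) / 2 ^ n0 \<le> 1 / 2 ^ n" by (intro divide_left_mono power_increasing) auto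
        hence xy': "\<bar>x - y\<bar> \<le> 2 * (1 / 2 ^ n)" using xy by linarith
        have "(\<Sum>j\<in>good F R n. hat n j y * beta2 n j)
          \<le> (\<Sum>j\<in>good F R n. if \<bar>x - grid n j\<bar> \<le> 3 / 2 ^ n then beta2 n j else 0)"
        proof (rule sum_mono)
          fix j
          show "hat n j y * beta2 n j \<le> (if \<bar>x - grid n j\<bar> \<le> 3 / 2 ^ n then beta2 n j else 0)"
          proof (cases "0 < hat n j y")
            case True
            hence "\<bar>x - grid n j\<bar> \<le> 3 * (1 / 2 ^ n)" using xy' unfolding hat_pos_iff by linarith
            moreover have "hat n j y * beta2 n j \<le> 1 * beta2 n j"
              by (intro mult_right_mono hat_le_1 beta2_nonneg)
            ultimately show ?thesis by simp
          next
            case False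
            hence "hat n j y = 0" using hat_nonneg[of n j y] by linarith
            thus ?thesis using beta2_nonneg by simp
          qed
        qed
        also have "\<dots> \<le> local_beta2 R n x"
          unfolding local_beta2_def using good_subset beta2_nonneg by (intro sum_mono2) auto
        finally show ?thesis .
      qed
    qed
    also have "\<dots> \<le> \<Lambda>" by (rule F[OF x(1)])
    finally show ?thesis .
  qed
  thus ?thesis using True by simp
qed

lemma entropy_le:
  assumes R: "0 < R" and F: "\<And>x N. x \<in> F \<Longrightarrow> (\<Sum>n\<in>{4..<N}. local_beta2 R n x) \<le> \<Lambda>"
    and \<Lambda>: "0 \<le> \<Lambda>" and N: "4 \<le> N"
  shows "entropy F R N \<le> entropy F R 4 + C * (\<Lambda> * measure \<mu> {- real R..real R})"
proof -
  have sp: "space \<mu> = UNIV" by (rule radon_space[OF mu])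
  have "(\<Sum>n\<in>{4..<N}. \<Sum>j\<in>good F R n. mass \<mu> n j * beta2 n j)
    = integral\<^sup>L \<mu> (\<lambda>y. \<Sum>n\<in>{4..<N}. \<Sum>j\<in>good F R n. hat n j y * beta2 n j)"
    unfolding mass_def
    by (simp add: Bochner_Integration.integral_sum Bochner_Integration.integrable_sum radon_integrable_hat[OF mu])
  also have "\<dots> \<le> integral\<^sup>L \<mu> (\<lambda>y. \<Lambda> * indicator {- real R..real R} y)"
  proof (rule integral_mono)
    show "integrable \<mu> (\<lambda>y. \<Lambda> * indicator {- real R..real R} y)"
      by (intro integrable_mult_right radon_integrable_indicator[OF mu]) auto
    show "integrable \<mu> (\<lambda>y. \<Sum>n\<in>{4..<N}. \<Sum>j\<in>good F R n. hat n j y * beta2 n j)"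
      by (intro Bochner_Integration.integrable_sum integrable_mult_left radon_integrable_hat[OF mu])
  qed (rule good_sum_pointwise[OF F \<Lambda>])
  also have "\<dots> = \<Lambda> * measure \<mu> {- real R..real R}" using sp by simp
  finally have "C * (\<Sum>n\<in>{4..<N}. \<Sum>j\<in>good F R n. mass \<mu> n j * beta2 n j)
    \<le> C * (\<Lambda> * measure \<mu> {- real R..real R})" using C_pos by (intro mult_left_mono) auto
  thus ?thesis using entropy_bound[OF R N, of F] by linarith
qed

text \<open>\<open>Psi_ge\<close> is applied to each good hat with the same \<open>t\<close>. On
  \<open>F\<close> the weight is at least 1/2, because \<open>F\<close> stays in the inner half of
  the region, and the good hats account for all of it there. The \<nu>-term is controlled by
  \<open>sum_hat_le_1\<close>: good hats live within two mesh widths of \<open>F\<close>.\<close>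

lemma entropy_lower:
  assumes R: "0 < R" and F: "compact F" "F \<subseteq> {- real R / 2..real R / 2}" "F \<noteq> {}" and t: "1 \<le> t"
  shows "ln t * (measure \<mu> F / 2) - t * measure \<nu> {y. infdist y F \<le> 2 / 2 ^ N} \<le> entropy F R N"
proof -
  let ?w = "tent 0 (real R)"
  let ?A = "{y. infdist y F \<le> 2 / 2 ^ N}"
  have Fm: "F \<in> sets borel" using F(1) compact_imp_closed borel_closed by blast
  have A_bdd: "?A \<subseteq> {- real R - 2..real R + 2}"
  proof
    fix y assume "y \<in> ?A"
    moreover obtain x where "x \<in> F" "infdist y F = dist y x"
      using infdist_attains_inf[OF compact_imp_closed[OF F(1)] F(3)] by blast
    moreover have "(2::real) / 2 ^ N \<le> 2" by (simp add: pos_divide_le_eq)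
    ultimately show "y \<in> {- real R - 2..real R + 2}" using F(2) by (fastforce simp: dist_real_def)
  qed
  have Am: "?A \<in> sets borel"
    by (intro borel_closed closed_Collect_le continuous_intros)
  have sp: "space \<mu> = UNIV" "space \<nu> = UNIV" using radon_space mu nu by auto
  have w: "0 \<le> ?w z" "?w z \<le> 1" for z using R by (auto intro: tent_le_1)
  have low: "measure \<mu> F / 2 \<le> (\<Sum>j\<in>good F R N. ?w (grid N j) * mass \<mu> N j)"
  proof -
    have "measure \<mu> F / 2 = integral\<^sup>L \<mu> (\<lambda>y. indicator F y * (1 / 2))" using sp by simp
    also have "\<dots> \<le> integral\<^sup>L \<mu> (\<lambda>y. \<Sum>j\<in>good F R N. ?w (grid N j) * hat N j y)"
    proof (rule integral_mono)
      show "integrable \<mu> (\<lambda>y. indicator F y * (1 / 2) :: real)"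
        using Fm F(2) by (intro integrable_mult_left radon_integrable_indicator[OF mu])
      show "integrable \<mu> (\<lambda>y. \<Sum>j\<in>good F R N. ?w (grid N j) * hat N j y)"
        by (intro Bochner_Integration.integrable_sum integrable_mult_right radon_integrable_hat[OF mu])
      fix y
      show "indicator F y * (1 / 2) \<le> (\<Sum>j\<in>good F R N. ?w (grid N j) * hat N j y)"
      proof (cases "y \<in> F")
        case True
        have "1 / 2 \<le> 1 - \<bar>y - 0\<bar> / real R"
          using True F(2) R by (auto simp: field_simps abs_if)
        also have "\<dots> \<le> ?w y" by (rule tent_ge)
        also have "\<dots> = (\<Sum>j\<in>idx R N. ?w (grid N j) * hat N j y)" by (rule weight_refine[OF R])
        also have "\<dots> = (\<Sum>j\<in>good F R N. ?w (grid N j) * hat N j y)"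
        proof (rule sum.mono_neutral_right)
          show "\<forall>j\<in>idx R N - good F R N. ?w (grid N j) * hat N j y = 0"
          proof
            fix j assume "j \<in> idx R N - good F R N"
            hence "\<not> 0 < hat N j y" using True unfolding hat_pos_iff good_def by auto
            hence "hat N j y = 0" using hat_nonneg[of N j y] by linarith
            thus "?w (grid N j) * hat N j y = 0" by simp
          qed
        qed (auto simp: good_def)
        finally show ?thesis using True by simp
      qed (auto intro: sum_nonneg)
    qed
    also have "\<dots> = (\<Sum>j\<in>good F R N. ?w (grid N j) * mass \<mu> N j)"
      unfolding mass_def by (simp add: Bochner_Integration.integral_sum radon_integrable_hat[OF mu])
    finally show ?thesis .
  qed
  have up: "(\<Sum>j\<in>good F R N. mass \<nu> N j) \<le> measure \<nu> ?A"
  proof -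
    have "(\<Sum>j\<in>good F R N. mass \<nu> N j) = integral\<^sup>L \<nu> (\<lambda>y. \<Sum>j\<in>good F R N. hat N j y)"
      unfolding mass_def by (simp add: Bochner_Integration.integral_sum radon_integrable_hat[OF nu])
    also have "\<dots> \<le> integral\<^sup>L \<nu> (indicator ?A)"
    proof (rule integral_mono)
      show "integrable \<nu> (indicator ?A :: real \<Rightarrow> real)"
        by (rule radon_integrable_indicator[OF nu A_bdd Am])
      show "integrable \<nu> (\<lambda>y. \<Sum>j\<in>good F R N. hat N j y)"
        by (intro Bochner_Integration.integrable_sum radon_integrable_hat[OF nu])
      fix y
      show "(\<Sum>j\<in>good F R N. hat N j y) \<le> indicator ?A y"
      proof (cases "y \<in> ?A")
        case True
        thus ?thesis using sum_hat_le_1[of "good F R N" N y] by simp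
      next
        case False
        have "hat N j y = 0" if j: "j \<in> good F R N" for j
        proof (rule ccontr)
          assume "hat N j y \<noteq> 0"
          hence "0 < hat N j y" using hat_nonneg[of N j y] by linarith
          moreover obtain x where "x \<in> F" "\<bar>x - grid N j\<bar> \<le> 1 / 2 ^ N" using j by (auto simp: good_def)
          ultimately have "\<bar>y - x\<bar> \<le> 2 * (1 / 2 ^ N)" unfolding hat_pos_iff by linarith
          hence "infdist y F \<le> 2 / 2 ^ N" using infdist_le[OF \<open>x \<in> F\<close>, of y] by (simp add: dist_real_def)
          thus False using False by simp
        qed
        thus ?thesis using False by simp
      qed
    qed
    finally show ?thesis using sp by simp
  qed
  have "ln t * (measure \<mu> F / 2) - t * measure \<nu> ?A
    \<le> ln t * (\<Sum>j\<in>good F R N. ?w (grid N j) * mass \<mu> N j) - t * (\<Sum>j\<in>good F R N. mass \<nu> N j)"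
    using t low up by (intro diff_mono mult_left_mono) auto
  also have "\<dots> = (\<Sum>j\<in>good F R N. ?w (grid N j) * (mass \<mu> N j * ln t) - t * mass \<nu> N j)"
    by (simp add: sum_subtractf sum_distrib_left mult_ac)
  also have "\<dots> \<le> entropy F R N"
    unfolding entropy_def
  proof (rule sum_mono)
    fix j
    let ?m = "mass \<mu> N j" and ?v = "mass \<nu> N j"
    have v: "0 < ?v" by (rule mass_nu_pos)
    have "?m * ln t - t * ?v \<le> Psi ?m ?v - ?v" using t v by (intro Psi_ge) auto
    hence "?m * ln t - t * ?v \<le> Psi ?m ?v" using v by linarith
    hence "?w (grid N j) * (?m * ln t - t * ?v) \<le> ?w (grid N j) * Psi ?m ?v" using w by (intro mult_left_mono)
    moreover have "?w (grid N j) * (t * ?v) \<le> 1 * (t * ?v)" using w t v by (intro mult_right_mono) auto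
    ultimately show "?w (grid N j) * (?m * ln t) - t * ?v \<le> ?w (grid N j) * Psi ?m ?v"
      by (simp add: right_diff_distrib)
  qed
  finally show ?thesis .
qed

text \<open>For fixed \<open>t\<close> let \<open>N\<close> tend to infinity: the neighbourhoods
  decrease to the closed set \<open>F\<close>, so their \<nu>-measure tends to 0 and
  \<open>ln t * (measure \<mu> F / 2) \<le> B\<close> remains. As \<open>B\<close> does not depend
  on \<open>t\<close>, the measure of \<open>F\<close> must vanish.\<close>

lemma compact_null:
  assumes R: "0 < R" and F: "compact F" "F \<subseteq> {- real R / 2..real R / 2}"
    and bd: "\<And>x N. x \<in> F \<Longrightarrow> (\<Sum>n\<in>{4..<N}. local_beta2 R n x) \<le> \<Lambda>"
    and \<Lambda>: "0 \<le> \<Lambda>" and null: "emeasure \<nu> F = 0"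
  shows "emeasure \<mu> F = 0"
proof (cases "F = {}")
  case False
  define A where "A N = {y. infdist y F \<le> 2 / 2 ^ N}" for N :: nat
  define B where "B = entropy F R 4 + C * (\<Lambda> * measure \<mu> {- real R..real R})"
  have Fm: "F \<in> sets borel" using F(1) compact_imp_closed borel_closed by blast
  have Am: "A N \<in> sets borel" for N
    unfolding A_def by (intro borel_closed closed_Collect_le continuous_intros)
  have A_bdd: "A N \<subseteq> {- real R - 2..real R + 2}" for N
  proof
    fix y assume "y \<in> A N"
    moreover obtain x where "x \<in> F" "infdist y F = dist y x"
      using infdist_attains_inf[OF compact_imp_closed[OF F(1)] False] by blast
    moreover have "(2::real) / 2 ^ N \<le> 2" by (simp add: pos_divide_le_eq)
    ultimately show "y \<in> {- real R - 2..real R + 2}" using F(2) by (fastforce simp: dist_real_def A_def)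
  qed
  have lim: "(\<lambda>N. (2::real) / 2 ^ N) \<longlonglongrightarrow> 0"
    by (intro LIMSEQ_divide_realpow_zero) simp
  have INT: "(\<Inter>N. A N) = F"
  proof
    show "(\<Inter>N. A N) \<subseteq> F"
    proof
      fix y assume "y \<in> (\<Inter>N. A N)"
      hence "infdist y F \<le> 2 / 2 ^ N" for N by (auto simp: A_def)
      hence "infdist y F \<le> 0" by (intro LIMSEQ_le_const[OF lim]) auto
      hence "infdist y F = 0" using infdist_nonneg[of y F] by linarith
      thus "y \<in> F" using in_closed_iff_infdist_zero[OF compact_imp_closed[OF F(1)] False] by blast
    qed
    show "F \<subseteq> (\<Inter>N. A N)" by (auto simp: A_def)
  qed
  have "(\<lambda>N. measure \<nu> (A N)) \<longlonglongrightarrow> measure \<nu> (\<Inter>N. A N)"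
  proof (rule Lim_measure_decseq)
    show "range A \<subseteq> sets \<nu>" using Am radon_sets[OF nu] by auto
    show "decseq A"
    proof (rule decseq_SucI)
      fix n show "A (Suc n) \<subseteq> A n"
      proof
        fix y assume "y \<in> A (Suc n)"
        moreover have "(2::real) / 2 ^ Suc n \<le> 2 / 2 ^ n" by (intro divide_left_mono power_increasing) auto
        ultimately show "y \<in> A n" unfolding A_def by simp
      qed
    qed
    show "emeasure \<nu> (A i) \<noteq> \<infinity>" for i using radon_emeasure_finite[OF nu A_bdd[of i]] by simp
  qed
  hence nuA: "(\<lambda>N. measure \<nu> (A N)) \<longlonglongrightarrow> 0" unfolding INT using null by (simp add: measure_def)
  have bnd: "ln t * (measure \<mu> F / 2) \<le> B" if "1 \<le> t" for t
  proof -
    have "ln t * (measure \<mu> F / 2) - t * measure \<nu> (A N) \<le> B" if "4 \<le> N" for N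
      using entropy_lower[OF R F False \<open>1 \<le> t\<close>, of N] entropy_le[OF R bd \<Lambda> that]
      unfolding A_def B_def by (rule order_trans)
    hence "\<exists>N0. \<forall>N\<ge>N0. ln t * (measure \<mu> F / 2) - t * measure \<nu> (A N) \<le> B" by blast
    moreover have "(\<lambda>N. ln t * (measure \<mu> F / 2) - t * measure \<nu> (A N)) \<longlonglongrightarrow> ln t * (measure \<mu> F / 2) - t * 0"
      by (intro tendsto_diff tendsto_mult tendsto_const nuA)
    ultimately have "ln t * (measure \<mu> F / 2) - t * 0 \<le> B" by (rule LIMSEQ_le_const2[rotated])
    thus ?thesis by simp
  qed
  have B0: "0 \<le> B" using bnd[of 1] by simp
  have "measure \<mu> F = 0"
  proof (rule ccontr)
    assume "measure \<mu> F \<noteq> 0"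
    hence m: "0 < measure \<mu> F" by (simp add: order_less_le)
    \<comment> \<open>Chosen so that the left side of \<open>bnd\<close> equals
      \<open>B + 1\<close>.\<close>
    define t where "t = exp (2 * (B + 1) / measure \<mu> F)"
    have "1 \<le> t" using B0 m by (simp add: t_def)
    hence "ln t * (measure \<mu> F / 2) \<le> B" by (rule bnd)
    moreover have "ln t * (measure \<mu> F / 2) = B + 1" using m by (simp only: t_def ln_exp) simp
    ultimately show False by simp

  qed
  moreover have "emeasure \<mu> F \<noteq> top" using radon_emeasure_finite[OF mu F(2)] by simp
  hence "emeasure \<mu> F = ennreal (measure \<mu> F)" by (rule emeasure_eq_ennreal_measure)
  ultimately show ?thesis by simp
qed simp

end

section \<open>The singular part\<close>

text \<open>Generation \<open>n\<close> is compared with radii between \<open>8 / 2 ^ n\<close> and \<open>16 / 2 ^ n\<close>; these are below 1 from \<open>n = 4\<close> on.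
  The integrand of \<open>S2\<close> is not known to be measurable, so it is only compared with measurable step functions.\<close>

lemma S2_ge:
  assumes c: "\<And>n r. 4 \<le> n \<Longrightarrow> 8 / 2 ^ n < r \<Longrightarrow> r < 16 / 2 ^ n \<Longrightarrow> c n \<le> (alpha_s M N (x - r) (x + r))\<^sup>2"
    and c0: "\<And>n. 0 \<le> c n"
  shows "(\<Sum>n\<in>{4..<m}. ennreal (c n / 2)) \<le> S2 N M x"
proof -
  define I where "I n = {8 / 2 ^ n<..<16 / 2 ^ n :: real}" for n :: nat
  have dis: "n = n'" if "r \<in> I n" "r \<in> I n'" for r and n n' :: nat
  proof -
    have *: "\<not> n < n'" if "r \<in> I n" "r \<in> I n'" for n n' :: nat
    proof
      assume "n < n'"
      hence "(2::real) ^ Suc n \<le> 2 ^ n'" by (intro power_increasing) auto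
      hence "(16::real) / 2 ^ n' \<le> 16 / 2 ^ Suc n" by (intro divide_left_mono) auto
      thus False using that by (auto simp: I_def)
    qed
    show ?thesis using *[OF that] *[OF that(2,1)] by simp
  qed
  \<comment> \<open>On \<open>I n\<close> one has \<open>1 / r > 2 ^ n / 16\<close>, and
    \<open>I n\<close> has length \<open>8 / 2 ^ n\<close>; the product 1/2 is the factor in the
    claim.\<close>
  have "(\<Sum>n\<in>{4..<m}. ennreal (c n / 2)) = (\<Sum>n\<in>{4..<m}. \<integral>\<^sup>+ r. ennreal (c n * 2 ^ n / 16) * indicator (I n) r \<partial>lborel)"
  proof (rule sum.cong[OF refl])
    fix n
    have "(\<integral>\<^sup>+ r. ennreal (c n * 2 ^ n / 16) * indicator (I n) r \<partial>lborel) = ennreal (c n * 2 ^ n / 16) * emeasure lborel (I n)"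
      by (rule nn_integral_cmult_indicator) (simp add: I_def)
    also have "emeasure lborel (I n) = ennreal (8 / 2 ^ n)"
      unfolding I_def by (subst emeasure_lborel_Ioo) (auto simp: divide_right_mono diff_divide_distrib[symmetric])
    also have "ennreal (c n * 2 ^ n / 16) * ennreal (8 / 2 ^ n) = ennreal (c n * 2 ^ n / 16 * (8 / 2 ^ n))"
      using c0 by (intro ennreal_mult[symmetric]) auto
    finally show "ennreal (c n / 2) = (\<integral>\<^sup>+ r. ennreal (c n * 2 ^ n / 16) * indicator (I n) r \<partial>lborel)" by simp
  qed
  also have "\<dots> = (\<integral>\<^sup>+ r. (\<Sum>n\<in>{4..<m}. ennreal (c n * 2 ^ n / 16) * indicator (I n) r) \<partial>lborel)"
    by (rule nn_integral_sum[symmetric]) (simp add: I_def)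
  also have "\<dots> \<le> S2 N M x"
    unfolding S2_def
  proof (rule nn_integral_mono)
    fix r :: real
    show "(\<Sum>n\<in>{4..<m}. ennreal (c n * 2 ^ n / 16) * indicator (I n) r)
      \<le> indicator {0<..<1} r * ennreal ((alpha_s M N (x - r) (x + r))\<^sup>2 / r)"
    proof (cases "\<exists>n\<in>{4..<m}. r \<in> I n")
      case False
      hence "(\<Sum>n\<in>{4..<m}. ennreal (c n * 2 ^ n / 16) * indicator (I n) r) = 0" by (intro sum.neutral) auto
      thus ?thesis by simp
    next
      case True
      then obtain n where n: "n \<in> {4..<m}" "r \<in> I n" by blast
      have z: "ennreal (c k * 2 ^ k / 16) * indicator (I k) r = 0" if "k \<in> {4..<m} - {n}" for k
        using dis[OF n(2), of k] that by (auto simp: indicator_def)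
      have "(\<Sum>k\<in>{4..<m}. ennreal (c k * 2 ^ k / 16) * indicator (I k) r)
        = ennreal (c n * 2 ^ n / 16) * indicator (I n) r"
      proof -
        have "(\<Sum>k\<in>{4..<m} - {n}. ennreal (c k * 2 ^ k / 16) * indicator (I k) r) = 0"
          by (rule sum.neutral, rule ballI) (rule z)
        thus ?thesis using sum.remove[OF _ n(1), of "\<lambda>k. ennreal (c k * 2 ^ k / 16) * indicator (I k) r"] by simp
      qed
      also have "\<dots> = ennreal (c n * 2 ^ n / 16)" using n(2) by simp
      also have "\<dots> \<le> ennreal ((alpha_s M N (x - r) (x + r))\<^sup>2 / r)"
      proof (rule ennreal_leI)
        have r: "8 / 2 ^ n < r" "r < 16 / 2 ^ n" using n(2) by (auto simp: I_def)
        have "0 < r" using r(1) by (rule less_trans[rotated]) simp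
        have "c n * (2 ^ n / 16) \<le> (alpha_s M N (x - r) (x + r))\<^sup>2 * (1 / r)"
        proof (rule mult_mono)
          show "c n \<le> (alpha_s M N (x - r) (x + r))\<^sup>2" using n(1) r by (intro c) auto
          have "2 ^ n * r < 16" using r(2) by (simp add: pos_less_divide_eq mult.commute)
          thus "2 ^ n / 16 \<le> 1 / r" using \<open>0 < r\<close> by (simp add: field_simps)
        qed simp_all
        thus "c n * 2 ^ n / 16 \<le> (alpha_s M N (x - r) (x + r))\<^sup>2 / r" by simp
      qed
      also have "\<dots> = indicator {0<..<1} r * ennreal ((alpha_s M N (x - r) (x + r))\<^sup>2 / r)"
      proof -
        have "(2::real) ^ 4 \<le> 2 ^ n" using n(1) by (intro power_increasing) auto
        hence "16 / 2 ^ n \<le> (1::real)" by simp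
        moreover have "0 < (8::real) / 2 ^ n" by simp
        ultimately have "r \<in> {0<..<1}" using n(2) unfolding I_def greaterThanLessThan_iff by linarith
        thus ?thesis by simp
      qed
      finally show ?thesis .
    qed
  qed
  finally show ?thesis .
qed

text \<open>For the zero measure every normalised measure of \<open>N\<close> is null. Testing with
  the tent itself gives \<open>alpha_s \<ge> 1\<close> at every scale around a point of the support
  of \<open>M\<close>, and the sum over scales diverges. \<open>Z\<close> is the complement of that
  support, written with rational end points to have a countable union of null sets.\<close>

lemma S2_infinite_of_null:
  assumes M: "radon_real M" and N: "radon_real N" and nul: "emeasure N UNIV = 0"
  shows "\<exists>Z\<in>sets borel. emeasure M Z = 0 \<and> (\<forall>x. x \<notin> Z \<longrightarrow> S2 N M x = \<infinity>)"
proof -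
  define Z where "Z = (\<Union>p\<in>{p::rat \<times> rat. emeasure M {of_rat (fst p)<..<of_rat (snd p)} = 0}.
    {of_rat (fst p)<..<of_rat (snd p) :: real})"
  have ev: "countable {p::rat \<times> rat. emeasure M {of_rat (fst p)<..<of_rat (snd p)} = 0}" by (rule countableI_type)
  have Zn: "Z \<in> null_sets M"
    unfolding Z_def using radon_sets[OF M] by (intro null_sets_UN' ev) auto
  have iN: "integral\<^sup>L N f = 0" for f :: "real \<Rightarrow> real"
  proof -
    have "AE x in N. f x = 0"
      using nul radon_space[OF N] radon_sets[OF N] by (intro AE_I[of _ _ UNIV]) auto
    thus ?thesis by (rule integral_eq_zero_AE)
  qed
  have "S2 N M x = \<infinity>" if x: "x \<notin> Z" for x
  proof -
    have a1: "1 \<le> alpha_s M N (x - r) (x + r)" if r: "0 < r" for r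
    proof -
      have "integral\<^sup>L M (tent x r) \<noteq> 0"
      proof
        assume "integral\<^sup>L M (tent x r) = 0"
        hence "AE y in M. tent x r y = 0"
          using integral_nonneg_eq_0_iff_AE[OF radon_integrable_tent[OF M r, of x]] by simp
        hence ae: "AE y in M. y \<notin> {x - r<..<x + r}" by eventually_elim (use r in \<open>auto simp: tent_eq_0_iff\<close>)
        obtain q1 q2 where q: "x - r < of_rat q1" "of_rat q1 < x" "x < of_rat q2" "of_rat q2 < x + r"
          using of_rat_dense[of "x - r" x] of_rat_dense[of x "x + r"] r by auto
        have "AE y in M. y \<notin> {of_rat q1<..<of_rat q2}" using ae by eventually_elim (use q in auto)
        hence "emeasure M {of_rat q1<..<of_rat q2} = 0"
          using radon_sets[OF M] radon_space[OF M] by (subst (asm) AE_iff_measurable[OF _ refl]) (auto simp: greaterThanLessThan_def greaterThan_def lessThan_def Int_def)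
        hence "x \<in> Z" using q unfolding Z_def by (intro UN_I[of "(q1, q2)"]) auto
        thus False using x by simp
      qed
      moreover have "\<bar>integral\<^sup>L M (tent x r) / integral\<^sup>L M (tent x r) - integral\<^sup>L N (tent x r) / integral\<^sup>L N (tent x r)\<bar>
        \<le> 1 / r * r * alpha_s M N (x - r) (x + r)"
        by (rule ratio_diff_le_alpha_s[OF M N r _ tent_lipschitz[OF r]]) (use r in \<open>auto simp: tent_eq_0_iff\<close>)
      ultimately show ?thesis using iN r by simp
    qed
    have k: "ennreal (real (m - 4) / 2) \<le> S2 N M x" for m :: nat
    proof -
      have "(\<Sum>n\<in>{4..<m}. ennreal (1 / 2)) \<le> S2 N M x"
      proof (rule S2_ge)
        fix n :: nat and r :: real assume "8 / 2 ^ n < r"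
        moreover have "0 < (8::real) / 2 ^ n" by simp
        ultimately have "0 < r" by (rule less_trans[rotated])
        from a1[OF this] show "1 \<le> (alpha_s M N (x - r) (x + r))\<^sup>2" by (simp add: one_le_power)
      qed simp
      also have "(\<Sum>n\<in>{4..<m}. ennreal (1 / 2)) = ennreal (\<Sum>n\<in>{4..<m}. 1 / 2)" by (rule sum_ennreal) simp
      finally show ?thesis by simp
    qed
    show ?thesis
    proof (rule ccontr)
      assume "S2 N M x \<noteq> \<infinity>"
      then obtain s where s: "0 \<le> s" "S2 N M x = ennreal s" by (cases "S2 N M x") auto
      obtain m :: nat where m: "2 * s < real m" using reals_Archimedean2 by blast
      have "real m / 2 \<le> s" using k[of "m + 4"] s by (simp add: ennreal_le_iff)
      thus False using m by simp
    qed
  qed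
  thus ?thesis using Zn radon_sets[OF M] by (intro bexI[of _ Z]) auto
qed

section \<open>Infinite square function on null sets of the doubling measure\<close>

context doubling_pair
begin

lemma local_beta2_le_alpha_s:
  assumes r: "8 / 2 ^ n \<le> r" "r \<le> 16 / 2 ^ n"
  shows "local_beta2 R n x \<le> 8 * (3 * (64 * C)\<^sup>2) * (alpha_s \<mu> \<nu> (x - r) (x + r))\<^sup>2"
proof -
  define K where "K = 3 * (64 * C)\<^sup>2 * (alpha_s \<mu> \<nu> (x - r) (x + r))\<^sup>2"
  have K0: "0 \<le> K" by (simp add: K_def)
  let ?J = "{j \<in> idx R n. \<bar>x - grid n j\<bar> \<le> 3 / 2 ^ n}"
  have "?J \<subseteq> {\<lfloor>2 ^ n * x\<rfloor> - 3..\<lfloor>2 ^ n * x\<rfloor> + 4}"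
  proof
    fix j assume "j \<in> ?J"
    hence "\<bar>x - grid n j\<bar> \<le> 3 / 2 ^ n" by simp
    hence "2 ^ n * \<bar>x - grid n j\<bar> \<le> 2 ^ n * (3 / 2 ^ n)" by (intro mult_left_mono) auto
    also have "2 ^ n * \<bar>x - grid n j\<bar> = \<bar>2 ^ n * (x - grid n j)\<bar>" by (simp add: abs_mult)
    also have "2 ^ n * (x - grid n j) = 2 ^ n * x - of_int j" by (simp add: grid_def right_diff_distrib)
    finally have "\<bar>2 ^ n * x - of_int j\<bar> \<le> 3" by simp
    thus "j \<in> {\<lfloor>2 ^ n * x\<rfloor> - 3..\<lfloor>2 ^ n * x\<rfloor> + 4}" by simp linarith
  qed
  hence "card ?J \<le> card {\<lfloor>2 ^ n * x\<rfloor> - 3..\<lfloor>2 ^ n * x\<rfloor> + 4}" by (intro card_mono) auto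
  hence card: "card ?J \<le> 8" by simp
  have "local_beta2 R n x = (\<Sum>j\<in>?J. beta2 n j)"
    unfolding local_beta2_def by (rule sum.inter_filter[symmetric]) simp
  also have "\<dots> \<le> of_nat (card ?J) * K"
    by (rule sum_bounded_above) (use beta2_le_alpha_s[OF _ r] in \<open>simp add: K_def\<close>)
  also have "\<dots> \<le> 8 * K" using card K0 by (intro mult_right_mono) auto
  finally show ?thesis by (simp add: K_def)
qed

lemma local_beta2_bounded:
  assumes "S2 \<nu> \<mu> x \<noteq> \<infinity>"
  shows "\<exists>\<Lambda>. \<forall>m. (\<Sum>n\<in>{4..<m}. local_beta2 R n x) \<le> \<Lambda>"
proof -
  obtain s where s: "0 \<le> s" "S2 \<nu> \<mu> x = ennreal s" using assms by (cases "S2 \<nu> \<mu> x") auto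
  define K where "K = 8 * (3 * (64 * C)\<^sup>2)"
  have K: "0 < K" using C_pos by (simp add: K_def)
  have "(\<Sum>n\<in>{4..<m}. local_beta2 R n x) \<le> 2 * K * s" for m
  proof -
    have "(\<Sum>n\<in>{4..<m}. ennreal (local_beta2 R n x / K / 2)) \<le> S2 \<nu> \<mu> x"
    proof (rule S2_ge)
      fix n :: nat and r :: real assume "8 / 2 ^ n < r" "r < 16 / 2 ^ n"
      hence "local_beta2 R n x \<le> K * (alpha_s \<mu> \<nu> (x - r) (x + r))\<^sup>2"
        unfolding K_def by (intro local_beta2_le_alpha_s) auto
      thus "local_beta2 R n x / K \<le> (alpha_s \<mu> \<nu> (x - r) (x + r))\<^sup>2"
        using K by (simp add: pos_divide_le_eq mult.commute)
    qed (use local_beta2_nonneg K in auto)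
    also have "(\<Sum>n\<in>{4..<m}. ennreal (local_beta2 R n x / K / 2)) = ennreal (\<Sum>n\<in>{4..<m}. local_beta2 R n x / K / 2)"
      using local_beta2_nonneg K by (intro sum_ennreal) auto
    finally have "(\<Sum>n\<in>{4..<m}. local_beta2 R n x / K / 2) \<le> s" using s by (simp add: ennreal_le_iff)
    hence "(\<Sum>n\<in>{4..<m}. local_beta2 R n x) / K / 2 \<le> s" by (simp only: sum_divide_distrib)
    thus ?thesis using K by (simp add: field_simps)
  qed
  thus ?thesis by blast
qed

lemma local_beta2_measurable [measurable]: "local_beta2 R n \<in> borel_measurable borel"
  unfolding local_beta2_def by measurable

text \<open>The points of \<open>N\<close> with finite \<open>S2\<close> are covered by the sets
  \<open>E R k\<close>, which are Borel since they are defined through \<open>local_beta2\<close>.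
  Inner regularity reduces each of them to compact subsets, where \<open>compact_null\<close>
  applies.\<close>

lemma S2_infinite_on_null:
  assumes N: "N \<in> sets borel" "emeasure \<nu> N = 0"
  shows "\<exists>Z\<in>sets borel. emeasure \<mu> Z = 0 \<and> (\<forall>x\<in>N. x \<notin> Z \<longrightarrow> S2 \<nu> \<mu> x = \<infinity>)"
proof -
  define E where "E R k = N \<inter> {- real R / 2..real R / 2} \<inter> {x. \<forall>m. (\<Sum>n\<in>{4..<m}. local_beta2 R n x) \<le> real k}" for R k :: nat
  have "{x \<in> space borel. \<forall>m. (\<Sum>n\<in>{4..<m}. local_beta2 R n x) \<le> real k} \<in> sets borel" for R k :: nat
    by measurable
  hence Em: "E R k \<in> sets borel" for R k using N(1) by (auto simp: E_def)
  have sm: "sets \<mu> = sets borel" by (rule radon_sets[OF mu])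
  have E0: "E R k \<in> null_sets \<mu>" if R: "0 < R" for R k
  proof -
    let ?I = "{- real R / 2..real R / 2}"
    \<comment> \<open>Inner regularity is available for finite measures, hence the restriction of
      \<mu> to a bounded interval.\<close>
    define M where "M = density \<mu> (indicator ?I)"
    have emM: "emeasure M A = emeasure \<mu> (?I \<inter> A)" if "A \<in> sets borel" for A
      unfolding M_def using that sm by (subst emeasure_density)
        (auto simp: indicator_inter_arith[symmetric] intro!: nn_integral_indicator)
    have "emeasure M (E R k) = (SUP K\<in>{K. K \<subseteq> E R k \<and> compact K}. emeasure M K)"
    proof (rule inner_regular)
      show "sets M = sets borel" using sm by (simp add: M_def)
      have "space M = UNIV" using radon_space[OF mu] by (simp add: M_def)
      thus "emeasure M (space M) \<noteq> \<infinity>"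
        using emM[of UNIV] radon_emeasure_finite[OF mu order_refl, of "- real R / 2" "real R / 2"] by simp
    qed (rule Em)
    also have "\<dots> \<le> 0"
    proof (rule SUP_least)
      fix K assume "K \<in> {K. K \<subseteq> E R k \<and> compact K}"
      hence K: "K \<subseteq> E R k" "compact K" by auto
      have Km: "K \<in> sets borel" using K(2) compact_imp_closed borel_closed by blast
      have KN: "emeasure \<nu> K = 0"
      proof -
        have "emeasure \<nu> K \<le> emeasure \<nu> N"
          using K(1) N(1) radon_sets[OF nu] by (intro emeasure_mono) (auto simp: E_def)
        thus ?thesis using N(2) by simp
      qed
      have "emeasure \<mu> K = 0"
        by (rule compact_null[OF R K(2) _ _ _ KN, of "real k"]) (use K(1) in \<open>auto simp: E_def\<close>)
      moreover have "?I \<inter> K = K" using K(1) by (auto simp: E_def)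
      ultimately show "emeasure M K \<le> 0" using emM[OF Km] by simp
    qed
    finally have "emeasure \<mu> (?I \<inter> E R k) = 0" using emM[OF Em] by simp
    moreover have "?I \<inter> E R k = E R k" by (auto simp: E_def)
    ultimately show ?thesis using Em sm by auto
  qed
  define Z where "Z = (\<Union>R. \<Union>k. E (Suc R) k)"
  have "Z \<in> null_sets \<mu>" unfolding Z_def by (intro null_sets_UN E0) auto
  moreover have "S2 \<nu> \<mu> x = \<infinity>" if x: "x \<in> N" "x \<notin> Z" for x
  proof (rule ccontr)
    assume fin: "S2 \<nu> \<mu> x \<noteq> \<infinity>"
    obtain R :: nat where R: "2 * \<bar>x\<bar> < real R" using reals_Archimedean2 by blast
    obtain \<Lambda> where \<Lambda>: "\<And>m. (\<Sum>n\<in>{4..<m}. local_beta2 (Suc R) n x) \<le> \<Lambda>"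
      using local_beta2_bounded[OF fin, of "Suc R"] by blast
    obtain k :: nat where k: "\<Lambda> < real k" using reals_Archimedean2 by blast
    have "(\<Sum>n\<in>{4..<m}. local_beta2 (Suc R) n x) \<le> real k" for m using \<Lambda>[of m] k by linarith
    hence "x \<in> E (Suc R) k" using x(1) R by (auto simp: E_def)
    thus False using x(2) by (auto simp: Z_def)
  qed
  ultimately show ?thesis using sm by (intro bexI[of _ Z]) auto
qed

end

section \<open>Hellinger affinity bounds the alpha-numbers\<close>

text \<open>Write \<open>\<bar>p - q\<bar>\<close> as
  \<open>\<bar>sqrt p - sqrt q\<bar> * (sqrt p + sqrt q)\<close> and apply Cauchy-Schwarz. With
  \<open>A\<close> the affinity, the two sums of squares are \<open>2 - 2 * A\<close> and
  \<open>2 + 2 * A\<close>, the latter at most 4.\<close>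

lemma hellinger_total_variation:
  fixes c p q :: "'a \<Rightarrow> real"
  assumes c: "\<And>i. i \<in> I \<Longrightarrow> 0 \<le> c i" and p: "\<And>i. i \<in> I \<Longrightarrow> 0 \<le> p i" and q: "\<And>i. i \<in> I \<Longrightarrow> 0 \<le> q i"
    and sp: "(\<Sum>i\<in>I. c i * p i) = 1" and sq: "(\<Sum>i\<in>I. c i * q i) = 1"
  shows "(\<Sum>i\<in>I. c i * \<bar>p i - q i\<bar>)\<^sup>2 \<le> 8 * (1 - (\<Sum>i\<in>I. c i * sqrt (p i * q i)))"
proof -
  define A where "A = (\<Sum>i\<in>I. c i * sqrt (p i * q i))"
  define a where "a i = sqrt (c i) * \<bar>sqrt (p i) - sqrt (q i)\<bar>" for i
  define b where "b i = sqrt (c i) * (sqrt (p i) + sqrt (q i))" for i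
  have ab: "a i * b i = c i * \<bar>p i - q i\<bar>" if "i \<in> I" for i
  proof -
    have "p i - q i = (sqrt (p i) - sqrt (q i)) * (sqrt (p i) + sqrt (q i))"
      using p[OF that] q[OF that] by (simp add: algebra_simps flip: power2_eq_square)
    hence "\<bar>p i - q i\<bar> = \<bar>sqrt (p i) - sqrt (q i)\<bar> * (sqrt (p i) + sqrt (q i))"
      using p[OF that] q[OF that] by (simp add: abs_mult)
    moreover have "a i * b i = (sqrt (c i) * sqrt (c i)) * (\<bar>sqrt (p i) - sqrt (q i)\<bar> * (sqrt (p i) + sqrt (q i)))"
      by (simp add: a_def b_def mult_ac)
    ultimately show ?thesis using c[OF that] by simp
  qed
  have a2: "(a i)\<^sup>2 = c i * p i + c i * q i - 2 * (c i * sqrt (p i * q i))" if "i \<in> I" for i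
    using c[OF that] p[OF that] q[OF that]
    by (simp add: a_def power_mult_distrib power2_diff real_sqrt_mult algebra_simps)
  have b2: "(b i)\<^sup>2 = c i * p i + c i * q i + 2 * (c i * sqrt (p i * q i))" if "i \<in> I" for i
    using c[OF that] p[OF that] q[OF that]
    by (simp add: b_def power_mult_distrib power2_sum real_sqrt_mult algebra_simps)
  have sa: "(\<Sum>i\<in>I. (a i)\<^sup>2) = 2 - 2 * A"
    by (simp add: a2 sum.distrib sum_subtractf sp sq A_def sum_distrib_left)
  have sb: "(\<Sum>i\<in>I. (b i)\<^sup>2) = 2 + 2 * A"
    by (simp add: b2 sum.distrib sp sq A_def sum_distrib_left)
  have A1: "A \<le> 1" using sum_nonneg[of I "\<lambda>i. (a i)\<^sup>2"] sa by simp
  have "(\<Sum>i\<in>I. c i * \<bar>p i - q i\<bar>)\<^sup>2 = (\<Sum>i\<in>I. a i * b i)\<^sup>2" by (simp add: ab)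
  also have "\<dots> \<le> (2 - 2 * A) * (2 + 2 * A)" using Cauchy_Schwarz_ineq_sum[of a b I] sa sb by simp
  also have "\<dots> \<le> (2 - 2 * A) * 4" using A1 by (intro mult_left_mono) auto
  finally show ?thesis by (simp add: A_def)
qed

section \<open>Affinity and total variation of the cascades over several generations\<close>

definition desc :: "nat \<Rightarrow> int \<Rightarrow> int set" where
  "desc k j = {(j - 1) * 2 ^ k<..<(j + 1) * 2 ^ k}"

lemma finite_desc [simp]: "finite (desc k j)"
  by (simp add: desc_def)

lemma mem_desc_iff: "i \<in> desc k j \<longleftrightarrow> 0 < hat n j (grid (n + k) i)"
  by (simp add: hat_grid_pos_iff desc_def)

lemma mass_desc:
  assumes "radon_real M"
  shows "mass M n j = (\<Sum>i\<in>desc k j. hat n j (grid (n + k) i) * mass M (n + k) i)"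
  by (rule mass_refine[OF assms]) (simp_all add: desc_def)

context doubling_pair
begin

definition aff :: "nat \<Rightarrow> int \<Rightarrow> real" where
  "aff n j = sqrt (mass \<mu> n j * mass \<nu> n j)"

definition aff_desc :: "nat \<Rightarrow> nat \<Rightarrow> int \<Rightarrow> real" where
  "aff_desc n k j = (\<Sum>i\<in>desc k j. hat n j (grid (n + k) i) * aff (n + k) i)"

text \<open>If \<open>mass \<mu> n j = 0\<close>, division by zero makes the defect 1, as it should be.\<close>

definition defect :: "nat \<Rightarrow> nat \<Rightarrow> int \<Rightarrow> real" where
  "defect n k j = 1 - aff_desc n k j / aff n j"

text \<open>The weights \<open>1 / 2 ^ k\<close> reflect the size of the interpolation increments of
  a Lipschitz function \<open>k\<close> generations below a hat.\<close>

definition total_defect :: "nat \<Rightarrow> int \<Rightarrow> real" where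
  "total_defect n j = (\<Sum>k. defect n k j / 2 ^ k)"

definition tv :: "nat \<Rightarrow> nat \<Rightarrow> int \<Rightarrow> real" where
  "tv n k j = (\<Sum>i\<in>desc k j. hat n j (grid (n + k) i) *
    \<bar>mass \<mu> (n + k) i / mass \<mu> n j - mass \<nu> (n + k) i / mass \<nu> n j\<bar>)"

lemma aff_nonneg [simp]: "0 \<le> aff n j"
  by (simp add: aff_def)

lemma aff_desc_nonneg [simp]: "0 \<le> aff_desc n k j"
  by (simp add: aff_desc_def sum_nonneg)

text \<open>Cauchy-Schwarz with the refinement weights, which add up the masses of \<mu> and \<nu>
  exactly.\<close>

lemma aff_desc_le: "aff_desc n k j \<le> aff n j"
proof -
  let ?c = "\<lambda>i. hat n j (grid (n + k) i)"
  let ?a = "\<lambda>i. sqrt (?c i * mass \<mu> (n + k) i)"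
  let ?b = "\<lambda>i. sqrt (?c i * mass \<nu> (n + k) i)"
  have "aff_desc n k j = (\<Sum>i\<in>desc k j. ?a i * ?b i)"
    unfolding aff_desc_def aff_def
  proof (intro sum.cong refl)
    fix i
    have "?a i * ?b i = sqrt (?c i * ?c i) * sqrt (mass \<mu> (n + k) i * mass \<nu> (n + k) i)"
      by (simp only: real_sqrt_mult[symmetric]) (simp add: mult_ac)
    thus "?c i * sqrt (mass \<mu> (n + k) i * mass \<nu> (n + k) i) = ?a i * ?b i"
      by (simp flip: power2_eq_square)
  qed
  hence "(aff_desc n k j)\<^sup>2 \<le> (\<Sum>i\<in>desc k j. (?a i)\<^sup>2) * (\<Sum>i\<in>desc k j. (?b i)\<^sup>2)"
    using Cauchy_Schwarz_ineq_sum by metis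
  also have "\<dots> = mass \<mu> n j * mass \<nu> n j"
    using mass_desc[OF mu, of n j k] mass_desc[OF nu, of n j k] by (simp add: real_sqrt_pow2)
  finally show ?thesis unfolding aff_def by (rule real_le_rsqrt)
qed

lemma defect_bounds: "0 \<le> defect n k j" "defect n k j \<le> 1"
proof -
  show "0 \<le> defect n k j"
    using aff_desc_le[of n k j] aff_nonneg[of n j] unfolding defect_def
    by (cases "aff n j = 0") (simp_all add: divide_le_eq_1 order_less_le)
  show "defect n k j \<le> 1" by (simp add: defect_def)
qed

lemma summable_geometric_half: "summable (\<lambda>k. (1::real) / 2 ^ k)" "(\<Sum>k. (1::real) / 2 ^ k) = 2"
  using summable_geometric[of "1 / 2 :: real"] suminf_geometric[of "1 / 2 :: real"]
  by (simp_all add: power_one_over[symmetric])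

lemma summable_defect: "summable (\<lambda>k. defect n k j / 2 ^ k)"
  by (rule summable_comparison_test'[OF summable_geometric_half(1), of 0])
    (simp add: defect_bounds divide_right_mono)

lemma total_defect_nonneg: "0 \<le> total_defect n j"
  unfolding total_defect_def by (intro suminf_nonneg summable_defect) (simp add: defect_bounds)

lemma tv_le_defect:
  assumes "0 < mass \<mu> n j" shows "(tv n k j)\<^sup>2 \<le> 8 * defect n k j"
proof -
  let ?c = "\<lambda>i. hat n j (grid (n + k) i)"
  let ?p = "\<lambda>i. mass \<mu> (n + k) i / mass \<mu> n j"
  let ?q = "\<lambda>i. mass \<nu> (n + k) i / mass \<nu> n j"
  have one: "(\<Sum>i\<in>desc k j. ?c i * (mass M (n + k) i / mass M n j)) = 1"
    if "radon_real M" "0 < mass M n j" for M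
  proof -
    have "(\<Sum>i\<in>desc k j. ?c i * (mass M (n + k) i / mass M n j)) = (\<Sum>i\<in>desc k j. ?c i * mass M (n + k) i) / mass M n j"
      by (simp add: sum_divide_distrib)
    also have "\<dots> = mass M n j / mass M n j" by (simp only: mass_desc[OF that(1), of n j k, symmetric])
    finally show ?thesis using that(2) by simp
  qed
  have "(tv n k j)\<^sup>2 \<le> 8 * (1 - (\<Sum>i\<in>desc k j. ?c i * sqrt (?p i * ?q i)))"
    unfolding tv_def
    by (rule hellinger_total_variation) (use one[OF mu assms] one[OF nu mass_nu_pos] in auto)
  also have "(\<Sum>i\<in>desc k j. ?c i * sqrt (?p i * ?q i)) = aff_desc n k j / aff n j"
    by (simp add: aff_desc_def aff_def sum_divide_distrib real_sqrt_divide real_sqrt_mult)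
  finally show ?thesis by (simp add: defect_def)
qed

section \<open>Discrepancy of a test function and its multiscale expansion\<close>

definition disc :: "nat \<Rightarrow> int \<Rightarrow> (real \<Rightarrow> real) \<Rightarrow> real" where
  "disc n j f = integral\<^sup>L \<mu> f / mass \<mu> n j - integral\<^sup>L \<nu> f / mass \<nu> n j"

lemma disc_sum_hat_le:
  assumes "\<And>i. i \<in> desc k j \<Longrightarrow> \<bar>a i\<bar> \<le> K * hat n j (grid (n + k) i)"
  shows "\<bar>disc n j (\<lambda>y. \<Sum>i\<in>desc k j. a i * hat (n + k) i y)\<bar> \<le> K * tv n k j"
proof -
  have "integral\<^sup>L M (\<lambda>y. \<Sum>i\<in>desc k j. a i * hat (n + k) i y) = (\<Sum>i\<in>desc k j. a i * mass M (n + k) i)"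
    if "radon_real M" for M
    unfolding mass_def by (simp add: Bochner_Integration.integral_sum radon_integrable_hat[OF that])
  hence "disc n j (\<lambda>y. \<Sum>i\<in>desc k j. a i * hat (n + k) i y)
    = (\<Sum>i\<in>desc k j. a i * (mass \<mu> (n + k) i / mass \<mu> n j - mass \<nu> (n + k) i / mass \<nu> n j))"
    by (simp add: disc_def mu nu right_diff_distrib sum_subtractf sum_divide_distrib)
  also have "\<bar>\<dots>\<bar> \<le> (\<Sum>i\<in>desc k j. \<bar>a i * (mass \<mu> (n + k) i / mass \<mu> n j - mass \<nu> (n + k) i / mass \<nu> n j)\<bar>)"
    by (rule sum_abs)
  also have "\<dots> \<le> (\<Sum>i\<in>desc k j. K * (hat n j (grid (n + k) i) * \<bar>mass \<mu> (n + k) i / mass \<mu> n j - mass \<nu> (n + k) i / mass \<nu> n j\<bar>))"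
  proof (rule sum_mono)
    fix i assume "i \<in> desc k j"
    from assms[OF this] show "\<bar>a i * (mass \<mu> (n + k) i / mass \<mu> n j - mass \<nu> (n + k) i / mass \<nu> n j)\<bar>
      \<le> K * (hat n j (grid (n + k) i) * \<bar>mass \<mu> (n + k) i / mass \<mu> n j - mass \<nu> (n + k) i / mass \<nu> n j\<bar>)"
      unfolding abs_mult mult.assoc[symmetric] by (intro mult_right_mono) auto
  qed
  also have "\<dots> = K * tv n k j" by (simp add: tv_def sum_distrib_left)
  finally show ?thesis .
qed

lemma disc_diff:
  assumes "integrable \<mu> f" "integrable \<nu> f" "integrable \<mu> g" "integrable \<nu> g"
  shows "disc n j (\<lambda>y. f y - g y) = disc n j f - disc n j g"
  using assms by (simp add: disc_def diff_divide_distrib)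

text \<open>\<open>g\<close> is the limit of its interpolants \<open>G k\<close>, and
  \<open>disc\<close> telescopes along them. Each increment is a combination of hats of the next
  generation whose coefficients are at most a constant over \<open>2 ^ k\<close> times the
  refinement weight, so it is controlled by \<open>tv\<close>. This needs a lower bound for the
  weight on the supports, which is why \<open>x\<close> and \<open>r\<close> keep \<open>g\<close>
  away from the edge of the hat.\<close>

lemma disc_le_total_defect:
  assumes m: "0 < mass \<mu> n j" and x: "\<bar>x - grid n j\<bar> \<le> 1 / 2 / 2 ^ n"
    and r: "1 / 8 / 2 ^ n \<le> r" "r \<le> 1 / 4 / 2 ^ n"
    and g: "(1 / (2 * r))-lipschitz_on UNIV g" and z: "\<And>y. r \<le> \<bar>y - x\<bar> \<Longrightarrow> g y = 0"
  shows "\<bar>disc n j g\<bar> \<le> 256 * sqrt (total_defect n j)"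
proof -
  define h where "h = (1::real) / 2 ^ n"
  have h: "0 < h" by (simp add: h_def)
  have x': "\<bar>x - grid n j\<bar> \<le> h / 2" and r': "h / 8 \<le> r" "r \<le> h / 4"
    using x r by (simp_all add: h_def)
  have r0: "0 < r" using r' h by linarith
  define G where "G k = interp (n + k) g" for k
  \<comment> \<open>Offset 1/2, radius at most 1/4 and a margin of 1/8 add up to 7/8 of the
    half-width. The margin absorbs the spreading of supports by interpolation from
    \<open>k = 3\<close> on.\<close>
  have hat_ge: "1 / 8 \<le> hat n j y" if "\<bar>y - x\<bar> \<le> r + h / 8" for y
  proof -
    have "\<bar>y - grid n j\<bar> \<le> 7 / 8 * h" using that x' r' by linarith
    hence "\<bar>y - grid n j\<bar> / h \<le> 7 / 8" using h by (simp add: pos_divide_le_eq)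
    thus ?thesis using tent_ge[of y "grid n j" h] unfolding hat_def h_def by linarith
  qed
  have g_supp: "1 / 8 \<le> hat n j y" if "g y \<noteq> 0" for y
  proof (rule hat_ge)
    have "\<bar>y - x\<bar> < r" using z[of y] that by force
    thus "\<bar>y - x\<bar> \<le> r + h / 8" using h by linarith
  qed
  have G_supp: "1 / 8 \<le> hat n j y" if "G k y \<noteq> 0" "3 \<le> k" for k y
  proof (rule hat_ge)
    obtain t where t: "\<bar>t - y\<bar> \<le> 1 / 2 ^ (n + k)" "g t \<noteq> 0"
      using interp_nonzeroD[of "n + k" g y] \<open>G k y \<noteq> 0\<close> by (auto simp: G_def)
    have "(2::real) ^ 3 \<le> 2 ^ k" using that(2) by (intro power_increasing) auto
    hence "1 / 2 ^ k \<le> (1::real) / 8" by (intro divide_left_mono) auto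
    hence "h * (1 / 2 ^ k) \<le> h * (1 / 8)" using h by (intro mult_left_mono) auto
    hence "1 / 2 ^ (n + k) \<le> h / 8" by (simp add: h_def power_add)
    moreover have "\<bar>t - x\<bar> < r" using z[of t] t(2) by force
    ultimately show "\<bar>y - x\<bar> \<le> r + h / 8" using t(1) by linarith
  qed
  \<comment> \<open>The Lipschitz constant times the mesh gives \<open>4 / 2 ^ k\<close>, since
    \<open>r\<close> is at least an eighth of the half-width; a further factor 8 pays for the lower
    bound 1/8 of the hat.\<close>
  have err: "\<bar>G k y - g y\<bar> \<le> 32 / 2 ^ k * hat n j y" if k: "3 \<le> k" for k y
  proof (cases "G k y = 0 \<and> g y = 0")
    case False
    hence hat: "1 / 8 \<le> hat n j y" using g_supp G_supp k by blast
    have "\<bar>G k y - g y\<bar> \<le> 1 / (2 * r) / 2 ^ (n + k)" unfolding G_def by (rule interp_lipschitz_error[OF g])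
    also have "\<dots> = h / (2 * r) / 2 ^ k" by (simp add: h_def power_add)
    also have "\<dots> \<le> 4 / 2 ^ k" using r' r0 by (intro divide_right_mono) (auto simp: pos_divide_le_eq)
    also have "\<dots> = 32 / 2 ^ k * (1 / 8)" by simp
    also have "\<dots> \<le> 32 / 2 ^ k * hat n j y" by (intro mult_left_mono hat) simp
    finally show ?thesis .
  qed simp
  have g_desc: "i \<in> desc k j" if "g (grid (n + k) i) \<noteq> 0" for i k
    unfolding mem_desc_iff[where n=n] using g_supp[OF that] by linarith
  have G_eq: "G k = (\<lambda>y. \<Sum>i\<in>desc k j. g (grid (n + k) i) * hat (n + k) i y)" for k
    unfolding G_def using sum_hat_eq_interp[of "desc k j" g "n + k"] g_desc by (simp add: fun_eq_iff)
  \<comment> \<open>\<open>G k\<close> is also piecewise linear on the next grid, so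
    \<open>G (Suc k)\<close> and \<open>G k\<close> can be subtracted node by node there.\<close>
  have G_eq': "G k = (\<lambda>y. \<Sum>i\<in>desc (Suc k) j. G k (grid (n + Suc k) i) * hat (n + Suc k) i y)" if k: "3 \<le> k" for k
  proof -
    have "interp (n + Suc k) (G k) = G k"
      using interp_Suc_interp[of "desc k j" g "n + k"] g_desc by (simp add: G_def)
    moreover have "i \<in> desc (Suc k) j" if "G k (grid (n + Suc k) i) \<noteq> 0" for i
      unfolding mem_desc_iff[where n=n] using G_supp[OF that k] by linarith
    ultimately show ?thesis using sum_hat_eq_interp[of "desc (Suc k) j" "G k" "n + Suc k"] by (simp add: fun_eq_iff)
  qed
  have G_int: "integrable M (G k)" if "radon_real M" for M k
    unfolding G_eq by (intro Bochner_Integration.integrable_sum integrable_mult_right radon_integrable_hat[OF that])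
  have g_int: "integrable M g" if "radon_real M" for M by (rule radon_integrable_lipschitz[OF that g z])
  have disc_G3: "\<bar>disc n j (G 3)\<bar> \<le> 64 * (tv n 3 j / 2 ^ 3)"
  proof -
    have "\<bar>disc n j (G 3)\<bar> \<le> 8 * tv n 3 j"
      unfolding G_eq
    proof (rule disc_sum_hat_le)
      fix i
      let ?y = "grid (n + 3) i"
      show "\<bar>g ?y\<bar> \<le> 8 * hat n j ?y"
      proof (cases "g ?y = 0")
        case False
        have "\<bar>g ?y\<bar> \<le> 1 / (2 * r) * r * tent x r ?y" by (rule lipschitz_bound_tent[OF g r0 z])
        also have "\<dots> \<le> 1 / (2 * r) * r * 1" using r0 by (intro mult_left_mono tent_le_1) auto
        also have "\<dots> \<le> 1" using r0 by simp
        finally show ?thesis using g_supp[OF False] by linarith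
      qed simp
    qed
    thus ?thesis by simp
  qed
  have disc_step: "\<bar>disc n j (G (Suc k)) - disc n j (G k)\<bar> \<le> 64 * (tv n (Suc k) j / 2 ^ Suc k)" if k: "3 \<le> k" for k
  proof -
    have "disc n j (G (Suc k)) - disc n j (G k) = disc n j (\<lambda>y. G (Suc k) y - G k y)"
      by (rule disc_diff[symmetric]) (simp_all add: G_int mu nu)
    also have "(\<lambda>y. G (Suc k) y - G k y) = (\<lambda>y. \<Sum>i\<in>desc (Suc k) j.
        (g (grid (n + Suc k) i) - G k (grid (n + Suc k) i)) * hat (n + Suc k) i y)"
      by (subst G_eq, subst G_eq'[OF k]) (simp only: left_diff_distrib sum_subtractf)
    finally have "\<bar>disc n j (G (Suc k)) - disc n j (G k)\<bar> \<le> 32 / 2 ^ k * tv n (Suc k) j"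
      by (simp only:) (intro disc_sum_hat_le, subst abs_minus_commute, rule err[OF k])
    thus ?thesis by simp
  qed
  have disc_G: "\<bar>disc n j (G N)\<bar> \<le> 64 * (\<Sum>k\<in>{3..N}. tv n k j / 2 ^ k)" if "3 \<le> N" for N
    using that
  proof (induction N rule: dec_induct)
    case base
    show ?case using disc_G3 by simp
  next
    case (step N)
    have "(\<Sum>k\<in>{3..Suc N}. tv n k j / 2 ^ k) = (\<Sum>k\<in>{3..N}. tv n k j / 2 ^ k) + tv n (Suc N) j / 2 ^ Suc N"
      using step.hyps by simp
    thus ?case using disc_step[OF step.hyps(1)] step.IH by linarith
  qed
  have disc_err: "\<bar>disc n j (G N) - disc n j g\<bar> \<le> 64 / 2 ^ N" if N: "3 \<le> N" for N
  proof -
    have E: "\<bar>integral\<^sup>L M (\<lambda>y. G N y - g y) / mass M n j\<bar> \<le> 32 / 2 ^ N"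
      if M: "radon_real M" and pos: "0 < mass M n j" for M
    proof -
      have "\<bar>integral\<^sup>L M (\<lambda>y. G N y - g y)\<bar> \<le> integral\<^sup>L M (\<lambda>y. \<bar>G N y - g y\<bar>)" by (rule integral_abs_bound)
      also have "\<dots> \<le> integral\<^sup>L M (\<lambda>y. 32 / 2 ^ N * hat n j y)"
        using err[OF N] by (intro integral_mono integrable_abs Bochner_Integration.integrable_diff G_int g_int integrable_mult_right radon_integrable_hat M) auto
      also have "\<dots> = 32 / 2 ^ N * mass M n j" by (simp add: mass_def)
      finally show ?thesis using pos by (simp add: abs_divide pos_divide_le_eq)
    qed
    have "disc n j (G N) - disc n j g = disc n j (\<lambda>y. G N y - g y)"
      by (rule disc_diff[symmetric]) (simp_all add: G_int g_int mu nu)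
    also have "\<bar>\<dots>\<bar> \<le> 32 / 2 ^ N + 32 / 2 ^ N"
      unfolding disc_def using E[OF mu m] E[OF nu mass_nu_pos] by linarith
    finally show ?thesis by simp
  qed
  \<comment> \<open>The weight \<open>1 / 2 ^ k\<close> is split into two square roots: one factor
    of Cauchy-Schwarz is at most 2, the other at most \<open>8 * total_defect n j\<close> by
    \<open>tv_le_defect\<close>.\<close>
  have CS: "(\<Sum>k\<in>{3..N}. tv n k j / 2 ^ k) \<le> 4 * sqrt (total_defect n j)" for N
  proof -
    let ?s = "\<lambda>k. sqrt (1 / 2 ^ k) :: real"
    have "(\<Sum>k\<in>{3..N}. tv n k j / 2 ^ k)\<^sup>2 = (\<Sum>k\<in>{3..N}. ?s k * (?s k * tv n k j))\<^sup>2"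
      by (simp add: mult.assoc[symmetric] real_sqrt_mult_self)
    also have "\<dots> \<le> (\<Sum>k\<in>{3..N}. (?s k)\<^sup>2) * (\<Sum>k\<in>{3..N}. (?s k * tv n k j)\<^sup>2)"
      by (rule Cauchy_Schwarz_ineq_sum)
    also have "\<dots> = (\<Sum>k\<in>{3..N}. 1 / 2 ^ k) * (\<Sum>k\<in>{3..N}. (tv n k j)\<^sup>2 / 2 ^ k)"
      by (simp add: power_mult_distrib)
    also have "\<dots> \<le> 2 * (8 * total_defect n j)"
    proof (rule mult_mono)
      show "(\<Sum>k\<in>{3..N}. 1 / 2 ^ k) \<le> (2::real)"
        using sum_le_suminf[OF summable_geometric_half(1), of "{3..N}"] summable_geometric_half(2) by simp
      have "(\<Sum>k\<in>{3..N}. (tv n k j)\<^sup>2 / 2 ^ k) \<le> (\<Sum>k\<in>{3..N}. 8 * (defect n k j / 2 ^ k))"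
        using tv_le_defect[OF m] by (intro sum_mono) (simp add: divide_right_mono)
      also have "\<dots> = 8 * (\<Sum>k\<in>{3..N}. defect n k j / 2 ^ k)" by (simp add: sum_distrib_left)
      also have "(\<Sum>k\<in>{3..N}. defect n k j / 2 ^ k) \<le> total_defect n j"
        unfolding total_defect_def by (intro sum_le_suminf summable_defect) (auto simp: defect_bounds)
      finally show "(\<Sum>k\<in>{3..N}. (tv n k j)\<^sup>2 / 2 ^ k) \<le> 8 * total_defect n j" by simp
    qed (auto intro: sum_nonneg)
    finally have "(\<Sum>k\<in>{3..N}. tv n k j / 2 ^ k)\<^sup>2 \<le> 16 * total_defect n j" by simp
    hence "(\<Sum>k\<in>{3..N}. tv n k j / 2 ^ k) \<le> sqrt (16 * total_defect n j)" by (rule real_le_rsqrt)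
    thus ?thesis by (simp add: real_sqrt_mult)
  qed
  have "\<bar>disc n j g\<bar> \<le> 256 * sqrt (total_defect n j) + 64 / 2 ^ N" if "3 \<le> N" for N
    using disc_G[OF that] disc_err[OF that] CS[of N] by linarith
  hence "\<exists>N0. \<forall>N\<ge>N0. \<bar>disc n j g\<bar> \<le> 256 * sqrt (total_defect n j) + 64 / 2 ^ N" by blast
  moreover have "(\<lambda>N. 256 * sqrt (total_defect n j) + 64 / 2 ^ N) \<longlonglongrightarrow> 256 * sqrt (total_defect n j) + 0"
    by (intro tendsto_add tendsto_const LIMSEQ_divide_realpow_zero) simp
  ultimately have "\<bar>disc n j g\<bar> \<le> 256 * sqrt (total_defect n j) + 0" by (rule LIMSEQ_le_const[rotated])
  thus ?thesis by simp
qed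

text \<open>Half of the tent at \<open>x\<close> is itself an admissible function, so
  \<open>disc_le_total_defect\<close> controls numerators and normalisers alike.
  \<open>ratio_perturb\<close> combines them with \<open>256 + 512 = 768\<close>, and doubling of
  \<nu> bounds \<open>1 / v\<close> by \<open>C\<close>. If the hat has no \<mu>-mass, the total
  defect is 2 and the trivial bound \<open>alpha_s \<le> 2\<close> suffices; the summand 4 in the
  constant covers this case.\<close>

lemma alpha_s_le_total_defect:
  assumes x: "\<bar>x - grid n j\<bar> \<le> 1 / 2 / 2 ^ n" and r: "1 / 8 / 2 ^ n \<le> r" "r \<le> 1 / 4 / 2 ^ n"
  shows "(alpha_s \<mu> \<nu> (x - r) (x + r))\<^sup>2 \<le> ((1536 * C)\<^sup>2 + 4) * total_defect n j"
proof -
  let ?\<alpha> = "alpha_s \<mu> \<nu> (x - r) (x + r)"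
  let ?z = "total_defect n j"
  have r0: "0 < r" using r(1) by (rule less_le_trans[rotated]) simp
  have \<alpha>: "0 \<le> ?\<alpha>" "?\<alpha> \<le> 2" using alpha_s_nonneg alpha_s_le_2 mu nu r0 by auto
  show ?thesis
  proof (cases "mass \<mu> n j = 0")
    case True
    hence "defect n k j = 1" for k by (simp add: defect_def aff_def)
    hence z: "?z = 2" by (simp add: total_defect_def summable_geometric_half)
    have "?\<alpha>\<^sup>2 \<le> 2\<^sup>2" using \<alpha> by (intro power_mono)
    also have "\<dots> \<le> ((1536 * C)\<^sup>2 + 4) * ?z" unfolding z by simp
    finally show ?thesis .
  next
    case False
    hence m: "0 < mass \<mu> n j" using mass_nonneg[of \<mu> n j] by linarith
    define u where "u = integral\<^sup>L \<mu> (tent x r) / mass \<mu> n j"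
    define v where "v = integral\<^sup>L \<nu> (tent x r) / mass \<nu> n j"
    have mn: "0 < mass \<nu> n j" by (rule mass_nu_pos)
    have v0: "0 < v" using tent_pos[OF r0] mn by (simp add: v_def)
    have "mass \<nu> n j \<le> C * integral\<^sup>L \<nu> (tent x r)"
      unfolding mass_def hat_def
    proof (rule tent_doubling[OF r0])
      have "1 / 2 / 2 ^ n + 1 / 2 ^ n \<le> 64 * (1 / 8 / 2 ^ n :: real)" by (simp add: field_simps)
      thus "\<bar>x - grid n j\<bar> + 1 / 2 ^ n \<le> 64 * r" using x r(1) by linarith
    qed simp
    hence vC: "1 \<le> C * v" using mn by (simp add: v_def pos_le_divide_eq)
    have half: "(1 / (2 * r))-lipschitz_on UNIV (\<lambda>y. tent x r y / 2)"
    proof (rule lipschitz_onI)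
      fix y y' :: real
      show "dist (tent x r y / 2) (tent x r y' / 2) \<le> 1 / (2 * r) * dist y y'"
        using lipschitz_onD[OF tent_lipschitz[OF r0, of x], of y y']
        by (simp add: dist_real_def diff_divide_distrib[symmetric] abs_divide)
    qed (use r0 in simp)
    have "\<bar>disc n j (\<lambda>y. tent x r y / 2)\<bar> \<le> 256 * sqrt ?z"
      by (rule disc_le_total_defect[OF m x r half]) (use r0 in \<open>simp add: tent_eq_0_iff\<close>)
    moreover have "disc n j (\<lambda>y. tent x r y / 2) = (u - v) / 2"
      by (simp add: disc_def u_def v_def diff_divide_distrib)
    ultimately have uv: "\<bar>u - v\<bar> \<le> 512 * sqrt ?z" by simp
    have "?\<alpha> \<le> 2 * (768 * C * sqrt ?z)"
    proof (rule alpha_s_leI[OF mu nu r0])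
      fix g :: "real \<Rightarrow> real" assume g: "(1 / (2 * r))-lipschitz_on UNIV g" and z: "\<And>y. r \<le> \<bar>y - x\<bar> \<Longrightarrow> g y = 0"
      define a where "a = integral\<^sup>L \<mu> g / mass \<mu> n j"
      define b where "b = integral\<^sup>L \<nu> g / mass \<nu> n j"
      have bound: "\<bar>integral\<^sup>L M g / mass M n j\<bar> \<le> 1 * (integral\<^sup>L M (tent x r) / mass M n j)"
        if "radon_real M" "0 < mass M n j" for M
      proof -
        have "\<bar>integral\<^sup>L M g\<bar> \<le> 1 / (2 * r) * r * integral\<^sup>L M (tent x r)"
          by (rule abs_integral_le_tent[OF that(1) g r0 z])
        also have "\<dots> \<le> 1 * integral\<^sup>L M (tent x r)" using r0 by (intro mult_right_mono) auto
        finally show ?thesis using that(2) by (simp add: abs_divide divide_right_mono)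
      qed
      have "\<bar>a / u - b / v\<bar> \<le> (\<bar>a - b\<bar> + 1 * \<bar>u - v\<bar>) / v"
      proof (rule ratio_perturb)
        show "\<bar>a\<bar> \<le> 1 * u" unfolding a_def u_def by (rule bound[OF mu m])
        show "\<bar>b\<bar> \<le> 1 * v" unfolding b_def v_def by (rule bound[OF nu mn])
        show "0 \<le> u" using m by (simp add: u_def)
      qed (use v0 in auto)
      also have "\<dots> \<le> (256 * sqrt ?z + 1 * (512 * sqrt ?z)) / v"
        using disc_le_total_defect[OF m x r g z] uv v0
        by (intro divide_right_mono add_mono) (auto simp: disc_def a_def b_def)
      also have "\<dots> = 768 * sqrt ?z * (1 / v)" by simp
      also have "\<dots> \<le> 768 * sqrt ?z * C"
        using vC v0 total_defect_nonneg by (intro mult_left_mono) (auto simp: pos_divide_le_eq)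
      finally show "\<bar>integral\<^sup>L \<mu> g / integral\<^sup>L \<mu> (tent x r) - integral\<^sup>L \<nu> g / integral\<^sup>L \<nu> (tent x r)\<bar> \<le> 768 * C * sqrt ?z"
        using m mn by (simp add: a_def b_def u_def v_def mult_ac)
    qed
    hence "?\<alpha>\<^sup>2 \<le> (2 * (768 * C * sqrt ?z))\<^sup>2" using \<alpha>(1) by (intro power_mono)
    also have "\<dots> = (1536 * C)\<^sup>2 * ?z" using total_defect_nonneg by (simp add: power_mult_distrib)
    also have "\<dots> \<le> ((1536 * C)\<^sup>2 + 4) * ?z" using total_defect_nonneg by (intro mult_right_mono) auto
    finally show ?thesis .
  qed
qed

end

section \<open>The absolutely continuous part\<close>

lemma exists_scale:
  fixes r :: real assumes "0 < r" "r \<le> 1 / 4"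
  shows "\<exists>n. 1 / 8 / 2 ^ n \<le> r \<and> r \<le> 1 / 4 / 2 ^ n"
proof -
  obtain N where "1 / 8 / r < 2 ^ N" using real_arch_pow[of 2 "1 / 8 / r"] by auto
  hence ex: "1 / 8 / 2 ^ N \<le> r" using assms(1) by (simp add: field_simps)
  define n where "n = (LEAST n. 1 / 8 / 2 ^ n \<le> r)"
  have 1: "1 / 8 / 2 ^ n \<le> r" unfolding n_def using ex by (rule LeastI)
  have "r \<le> 1 / 4 / 2 ^ n"
  proof (cases n)
    case 0
    thus ?thesis using assms(2) by simp
  next
    case (Suc m)
    hence "\<not> 1 / 8 / 2 ^ m \<le> r" using not_less_Least[of m "\<lambda>n. 1 / 8 / 2 ^ n \<le> r"] by (simp add: n_def)
    thus ?thesis using Suc by simp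
  qed
  with 1 show ?thesis by blast
qed

context doubling_pair
begin

section \<open>Telescoping of the affinity losses\<close>

definition total_aff :: "nat \<Rightarrow> nat \<Rightarrow> real" where
  "total_aff R n = (\<Sum>j\<in>idx R n. tent 0 (real R) (grid n j) * aff n j)"

lemma total_aff_nonneg [simp]: "0 \<le> total_aff R n"
  by (simp add: total_aff_def sum_nonneg)

lemma desc_subset_idx:
  assumes "j \<in> idx R n" shows "desc k j \<subseteq> idx R (n + k)"
proof
  fix i assume "i \<in> desc k j"
  hence "0 < hat n j (grid (n + k) i)" by (simp add: mem_desc_iff[where n=n])
  hence "\<bar>grid (n + k) i - grid n j\<bar> < 1 / 2 ^ n" by (simp add: hat_pos_iff)
  hence "\<bar>grid (n + k) i\<bar> < real R" using grid_idx_bound[OF assms] by linarith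
  thus "i \<in> idx R (n + k)" by (simp add: mem_idx_iff)
qed

text \<open>After exchanging the sums, each descendant collects by \<open>weight_refine\<close>
  exactly its own weight.\<close>

lemma sum_aff_desc:
  assumes R: "0 < R"
  shows "(\<Sum>j\<in>idx R n. tent 0 (real R) (grid n j) * aff_desc n k j) = total_aff R (n + k)"
proof -
  let ?w = "tent 0 (real R)"
  have "aff_desc n k j = (\<Sum>i\<in>idx R (n + k). hat n j (grid (n + k) i) * aff (n + k) i)" if "j \<in> idx R n" for j
    unfolding aff_desc_def
  proof (rule sum.mono_neutral_left)
    show "\<forall>i\<in>idx R (n + k) - desc k j. hat n j (grid (n + k) i) * aff (n + k) i = 0"
    proof
      fix i assume "i \<in> idx R (n + k) - desc k j"
      hence "\<not> 0 < hat n j (grid (n + k) i)" by (simp add: mem_desc_iff[where n=n])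
      hence "hat n j (grid (n + k) i) = 0" using hat_nonneg[of n j "grid (n + k) i"] by linarith
      thus "hat n j (grid (n + k) i) * aff (n + k) i = 0" by simp
    qed
  qed (use desc_subset_idx[OF that] in auto)
  hence "(\<Sum>j\<in>idx R n. ?w (grid n j) * aff_desc n k j)
    = (\<Sum>j\<in>idx R n. \<Sum>i\<in>idx R (n + k). ?w (grid n j) * hat n j (grid (n + k) i) * aff (n + k) i)"
    by (intro sum.cong refl) (simp add: sum_distrib_left mult.assoc)
  also have "\<dots> = (\<Sum>i\<in>idx R (n + k). (\<Sum>j\<in>idx R n. ?w (grid n j) * hat n j (grid (n + k) i)) * aff (n + k) i)"
    by (subst sum.swap) (simp add: sum_distrib_right)
  also have "\<dots> = total_aff R (n + k)"
    unfolding total_aff_def using weight_refine[OF R] by simp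
  finally show ?thesis .
qed

lemma total_aff_antimono: "0 < R \<Longrightarrow> total_aff R (n + k) \<le> total_aff R n"
  unfolding sum_aff_desc[symmetric] total_aff_def[of R n]
  by (intro sum_mono mult_left_mono aff_desc_le) auto

lemma aff_mult_defect: "aff n j * defect n k j = aff n j - aff_desc n k j"
proof (cases "aff n j = 0")
  case True
  hence "aff_desc n k j = 0" using aff_desc_le[of n k j] aff_desc_nonneg[of n k j] by linarith
  thus ?thesis using True by simp
next
  case False
  thus ?thesis by (simp add: defect_def right_diff_distrib)
qed

lemma sum_total_defect:
  assumes R: "0 < R"
  shows "(\<Sum>j\<in>idx R n. tent 0 (real R) (grid n j) * aff n j * total_defect n j)
    = (\<Sum>k. (total_aff R n - total_aff R (n + k)) / 2 ^ k)"
proof -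
  let ?w = "\<lambda>j. tent 0 (real R) (grid n j)"
  have "(\<Sum>j\<in>idx R n. ?w j * aff n j * total_defect n j)
    = (\<Sum>j\<in>idx R n. \<Sum>k. ?w j * aff n j * (defect n k j / 2 ^ k))"
    unfolding total_defect_def by (intro sum.cong refl suminf_mult[symmetric] summable_defect)
  also have "\<dots> = (\<Sum>k. \<Sum>j\<in>idx R n. ?w j * aff n j * (defect n k j / 2 ^ k))"
    by (intro suminf_sum[symmetric] summable_mult summable_defect)
  also have "\<dots> = (\<Sum>k. (total_aff R n - total_aff R (n + k)) / 2 ^ k)"
  proof (rule suminf_cong)
    fix k
    have "(\<Sum>j\<in>idx R n. ?w j * aff n j * (defect n k j / 2 ^ k))
      = (\<Sum>j\<in>idx R n. ?w j * (aff n j * defect n k j)) / 2 ^ k"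
      by (simp add: sum_divide_distrib mult.assoc)
    also have "\<dots> = (total_aff R n - total_aff R (n + k)) / 2 ^ k"
      unfolding aff_mult_defect sum_aff_desc[OF R, symmetric] total_aff_def[of R n]
      by (simp add: right_diff_distrib sum_subtractf)
    finally show "(\<Sum>j\<in>idx R n. ?w j * aff n j * (defect n k j / 2 ^ k)) = (total_aff R n - total_aff R (n + k)) / 2 ^ k" .
  qed
  finally show ?thesis .
qed

text \<open>For a fixed depth \<open>k\<close> the losses over all generations telescope into
  \<open>k\<close> chains, each losing at most \<open>total_aff R 0\<close>. The factor
  \<open>k\<close> is harmless against \<open>1 / 2 ^ k\<close>.\<close>

lemma total_defect_sum_le:
  assumes R: "0 < R"
  shows "(\<Sum>n<m. \<Sum>j\<in>idx R n. tent 0 (real R) (grid n j) * aff n j * total_defect n j) \<le> 4 * total_aff R 0"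
proof -
  let ?W = "total_aff R"
  have W0: "?W n \<le> ?W 0" for n using total_aff_antimono[OF R, of 0 n] by simp
  have S: "summable (\<lambda>k. (?W n - ?W (n + k)) / 2 ^ k)" for n
  proof (rule summable_comparison_test'[OF summable_mult[OF summable_geometric_half(1), of "?W 0"], of 0])
    fix k
    have "\<bar>?W n - ?W (n + k)\<bar> \<le> ?W 0"
      using total_aff_antimono[OF R, of n k] W0[of n] total_aff_nonneg[of R "n + k"] by linarith
    thus "norm ((?W n - ?W (n + k)) / 2 ^ k) \<le> ?W 0 * (1 / 2 ^ k)"
      by (simp add: abs_divide divide_right_mono)
  qed
  have tel: "(\<Sum>n<m. ?W n - ?W (n + k)) \<le> real k * ?W 0" for k
  proof (induction k)
    case (Suc k)
    have "(\<Sum>n<m. ?W n - ?W (n + Suc k)) = (\<Sum>n<m. ?W n - ?W (n + k)) + (\<Sum>n<m. ?W (n + k) - ?W (Suc n + k))"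
      by (simp flip: sum.distrib)
    also have "(\<Sum>n<m. ?W (n + k) - ?W (Suc n + k)) = ?W (0 + k) - ?W (m + k)"
      by (rule sum_lessThan_telescope')
    also have "\<dots> \<le> ?W 0" using W0[of k] total_aff_nonneg[of R "m + k"] by (simp only: add_0)
    finally show ?case using Suc by (simp add: algebra_simps)
  qed simp
  \<comment> \<open>The derivative of the geometric series at 1/2; it has \<open>Suc k\<close> where
    \<open>k\<close> would do, which gives the constant 4.\<close>
  have geo: "(\<lambda>k. real (Suc k) * (1 / 2) ^ k) sums 4"
    using geometric_deriv_sums[of "1 / 2 :: real"] by (simp add: power2_eq_square)
  have "(\<Sum>n<m. \<Sum>j\<in>idx R n. tent 0 (real R) (grid n j) * aff n j * total_defect n j)
    = (\<Sum>k. \<Sum>n<m. (?W n - ?W (n + k)) / 2 ^ k)"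
    unfolding sum_total_defect[OF R] by (intro suminf_sum[symmetric] S)
  also have "\<dots> \<le> (\<Sum>k. ?W 0 * (real (Suc k) * (1 / 2) ^ k))"
  proof (rule suminf_le)
    fix k
    have "(\<Sum>n<m. (?W n - ?W (n + k)) / 2 ^ k) = (\<Sum>n<m. ?W n - ?W (n + k)) / 2 ^ k"
      by (simp add: sum_divide_distrib)
    also have "\<dots> \<le> real (Suc k) * ?W 0 / 2 ^ k"
    proof (intro divide_right_mono)
      have "real k * ?W 0 \<le> real (Suc k) * ?W 0" by (intro mult_right_mono) auto
      thus "(\<Sum>n<m. ?W n - ?W (n + k)) \<le> real (Suc k) * ?W 0" using tel[of k] by linarith
    qed simp
    finally show "(\<Sum>n<m. (?W n - ?W (n + k)) / 2 ^ k) \<le> ?W 0 * (real (Suc k) * (1 / 2) ^ k)"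
      by (simp add: power_one_over mult_ac)
  next
    show "summable (\<lambda>k. \<Sum>n<m. (?W n - ?W (n + k)) / 2 ^ k)" by (intro summable_sum S)
    show "summable (\<lambda>k. ?W 0 * (real (Suc k) * (1 / 2) ^ k))" using geo by (intro summable_mult sums_summable)
  qed
  also have "\<dots> = 4 * ?W 0" using geo by (simp add: suminf_mult sums_summable sums_unique[symmetric])
  finally show ?thesis .
qed

section \<open>From summable defects to a finite square function\<close>

definition local_defect :: "nat \<Rightarrow> nat \<Rightarrow> real \<Rightarrow> real" where
  "local_defect R n x = (\<Sum>j\<in>idx R n. tent 0 (real R) (grid n j) * hat n j x * total_defect n j)"

lemma local_defect_nonneg: "0 \<le> local_defect R n x"
  unfolding local_defect_def by (intro sum_nonneg mult_nonneg_nonneg total_defect_nonneg) auto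

lemma hat_measurable [measurable]: "hat n j \<in> borel_measurable borel"
  by (intro borel_measurable_continuous_onI) (simp add: hat_def continuous_on_tent)

lemma local_defect_measurable [measurable]: "local_defect R n \<in> borel_measurable borel"
  unfolding local_defect_def by measurable

text \<open>For the grid point nearest to \<open>x\<close> the hat is at least 1/2 at
  \<open>x\<close>. The weight there is at least 1/4, because \<open>x\<close> stays in the inner
  half of the region and \<open>R \<ge> 4\<close> absorbs the rounding. The product 1/8 gives the
  factor 8.\<close>

lemma alpha_s_le_local_defect:
  assumes R: "4 \<le> R" and x: "\<bar>x\<bar> \<le> real R / 2" and r: "1 / 8 / 2 ^ n \<le> r" "r \<le> 1 / 4 / 2 ^ n"
  shows "(alpha_s \<mu> \<nu> (x - r) (x + r))\<^sup>2 \<le> 8 * ((1536 * C)\<^sup>2 + 4) * local_defect R n x"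
proof -
  define j where "j = \<lfloor>2 ^ n * x + 1 / 2\<rfloor>"
  let ?w = "tent 0 (real R) (grid n j)"
  have j: "\<bar>2 ^ n * x - of_int j\<bar> \<le> 1 / 2" unfolding j_def by linarith
  have "x - grid n j = (2 ^ n * x - of_int j) / 2 ^ n" by (simp add: grid_def field_simps)
  hence xg: "\<bar>x - grid n j\<bar> \<le> 1 / 2 / 2 ^ n"
    using j by (simp add: abs_divide divide_right_mono del: divide_divide_eq_left)
  have "(1::real) / 2 / 2 ^ n \<le> 1 / 2" by (simp add: pos_divide_le_eq)
  hence gb: "\<bar>grid n j\<bar> \<le> real R / 2 + 1 / 2" using xg x by linarith
  have R': "4 \<le> real R" using R by simp
  have jI: "j \<in> idx R n" unfolding mem_idx_iff using gb R' by linarith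
  have h: "1 / 2 \<le> hat n j x" using j by (simp add: hat_eq)
  have "\<bar>grid n j - 0\<bar> / real R \<le> 3 / 4" using gb R' by (simp add: pos_divide_le_eq)
  hence w: "1 / 4 \<le> ?w" using tent_ge[of "grid n j" 0 "real R"] by linarith
  have "1 / 8 * total_defect n j \<le> (?w * hat n j x) * total_defect n j"
    using mult_mono[OF w h] by (intro mult_right_mono total_defect_nonneg) auto
  also have "\<dots> \<le> local_defect R n x"
    unfolding local_defect_def by (rule member_le_sum[OF jI]) (auto simp: total_defect_nonneg)
  finally have "total_defect n j \<le> 8 * local_defect R n x" by simp
  hence "((1536 * C)\<^sup>2 + 4) * total_defect n j \<le> ((1536 * C)\<^sup>2 + 4) * (8 * local_defect R n x)"
    by (intro mult_left_mono) auto
  also have "\<dots> = 8 * ((1536 * C)\<^sup>2 + 4) * local_defect R n x" by (simp only: mult_ac)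
  finally show ?thesis by (rule order_trans[OF alpha_s_le_total_defect[OF xg r]])
qed

lemma S2_finite_if_local_defect:
  assumes R: "4 \<le> R" and x: "\<bar>x\<bar> \<le> real R / 2" and fin: "(\<Sum>n. ennreal (local_defect R n x)) \<noteq> \<infinity>"
  shows "S2 \<nu> \<mu> x < \<infinity>"
proof -
  define K where "K = 8 * ((1536 * C)\<^sup>2 + 4)"
  have K: "0 \<le> K" by (simp add: K_def)
  define d where "d n = local_defect R n x" for n
  have d: "0 \<le> d n" for n by (simp add: d_def local_defect_nonneg)
  define I where "I n = {1 / 8 / 2 ^ n..1 / 4 / 2 ^ n :: real}" for n :: nat
  \<comment> \<open>A measurable majorant of the integrand. Radii above 1/4 contribute at most
    \<open>2^2 / r \<le> 16\<close>; smaller ones fall into some \<open>I n\<close>, whose length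
    \<open>1 / 8 / 2 ^ n\<close> cancels the bound \<open>8 * 2 ^ n\<close> for
    \<open>1 / r\<close>.\<close>
  have "S2 \<nu> \<mu> x \<le> (\<integral>\<^sup>+ r. (\<Sum>n. ennreal (K * d n * (8 * 2 ^ n)) * indicator (I n) r) + 16 * indicator {0<..<1} r \<partial>lborel)"
    unfolding S2_def
  proof (rule nn_integral_mono)
    fix r :: real
    let ?a = "(alpha_s \<mu> \<nu> (x - r) (x + r))\<^sup>2"
    show "indicator {0<..<1} r * ennreal (?a / r)
      \<le> (\<Sum>n. ennreal (K * d n * (8 * 2 ^ n)) * indicator (I n) r) + 16 * indicator {0<..<1} r"
    proof (cases "r \<in> {0<..<1}")
      case True
      hence r0: "0 < r" by simp
      show ?thesis
      proof (cases "r \<le> 1 / 4")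
        case True
        then obtain n where n: "1 / 8 / 2 ^ n \<le> r" "r \<le> 1 / 4 / 2 ^ n" using exists_scale[OF r0] by blast
        have "?a / r = ?a * (1 / r)" by simp
        also have "\<dots> \<le> (K * d n) * (8 * 2 ^ n)"
        proof (rule mult_mono)
          show "?a \<le> K * d n" unfolding K_def d_def by (rule alpha_s_le_local_defect[OF R x n])
          have "1 \<le> 8 * 2 ^ n * r" using n(1) by (simp add: field_simps)
          thus "1 / r \<le> 8 * 2 ^ n" using r0 by (simp add: pos_divide_le_eq)
        qed (use K d r0 in auto)
        finally have "ennreal (?a / r) \<le> ennreal (K * d n * (8 * 2 ^ n)) * indicator (I n) r"
          using n by (simp add: I_def ennreal_leI)
        also have "\<dots> \<le> (\<Sum>n. ennreal (K * d n * (8 * 2 ^ n)) * indicator (I n) r)"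
        proof -
          have "sum (\<lambda>n. ennreal (K * d n * (8 * 2 ^ n)) * indicator (I n) r) {n}
            \<le> (\<Sum>n. ennreal (K * d n * (8 * 2 ^ n)) * indicator (I n) r)"
            by (rule sum_le_suminf) auto
          moreover have "sum h {n} = h n" for h :: "nat \<Rightarrow> ennreal" by simp
          ultimately show ?thesis by metis
        qed
        finally show ?thesis using \<open>r \<in> {0<..<1}\<close> by (simp add: add_increasing2)
      next
        case False
        have "?a \<le> 2\<^sup>2"
          using alpha_s_nonneg[OF mu nu r0] alpha_s_le_2[OF mu nu r0] by (intro power_mono)
        hence "?a \<le> 16 * r" using False by simp
        hence "?a / r \<le> 16" using r0 by (simp add: pos_divide_le_eq)
        hence "ennreal (?a / r) \<le> ennreal 16" by (rule ennreal_leI)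
        thus ?thesis using \<open>r \<in> {0<..<1}\<close> by (simp add: add_increasing)
      qed
    qed simp
  qed
  also have "\<dots> = (\<integral>\<^sup>+ r. (\<Sum>n. ennreal (K * d n * (8 * 2 ^ n)) * indicator (I n) r) \<partial>lborel)
      + (\<integral>\<^sup>+ r. 16 * indicator {0<..<1} (r::real) \<partial>lborel)"
    by (rule nn_integral_add) (auto simp: I_def)
  also have "(\<integral>\<^sup>+ r. (\<Sum>n. ennreal (K * d n * (8 * 2 ^ n)) * indicator (I n) r) \<partial>lborel)
    = (\<Sum>n. \<integral>\<^sup>+ r. ennreal (K * d n * (8 * 2 ^ n)) * indicator (I n) r \<partial>lborel)"
    by (rule nn_integral_suminf) (simp add: I_def)
  also have "\<dots> = (\<Sum>n. ennreal K * ennreal (d n))"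
  proof (rule suminf_cong)
    fix n
    have "(\<integral>\<^sup>+ r. ennreal (K * d n * (8 * 2 ^ n)) * indicator (I n) r \<partial>lborel)
      = ennreal (K * d n * (8 * 2 ^ n)) * emeasure lborel (I n)"
      by (rule nn_integral_cmult_indicator) (simp add: I_def)
    also have "emeasure lborel (I n) = ennreal (1 / 8 / 2 ^ n)"
      unfolding I_def by (subst emeasure_lborel_Icc)
        (auto simp: divide_right_mono diff_divide_distrib[symmetric] simp del: divide_divide_eq_left)
    also have "ennreal (K * d n * (8 * 2 ^ n)) * ennreal (1 / 8 / 2 ^ n) = ennreal (K * d n * (8 * 2 ^ n) * (1 / 8 / 2 ^ n))"
      using K d by (intro ennreal_mult[symmetric]) auto
    finally show "(\<integral>\<^sup>+ r. ennreal (K * d n * (8 * 2 ^ n)) * indicator (I n) r \<partial>lborel) = ennreal K * ennreal (d n)"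
      using K d by (simp add: ennreal_mult)
  qed
  also have "\<dots> = ennreal K * (\<Sum>n. ennreal (d n))" by (rule ennreal_suminf_cmult)
  also have "(\<integral>\<^sup>+ r. 16 * indicator {0<..<1} (r::real) \<partial>lborel) = 16"
    by (subst nn_integral_cmult_indicator) auto
  also have "ennreal K * (\<Sum>n. ennreal (d n)) + 16 < \<infinity>"
    using fin by (simp add: d_def ennreal_mult_less_top less_top)
  finally show ?thesis .
qed

text \<open>The hypothesis on \<open>\<sigma>\<close> is what \<open>total_defect_sum_le\<close> can
  use: the integral of \<open>local_defect\<close> is then at most the affinity-weighted sum of
  total defects, whose sum over all generations is finite.\<close>

lemma AE_S2_finite:
  assumes [measurable_cong]: "sets \<sigma> = sets borel"
    and \<sigma>: "\<And>n j. (\<integral>\<^sup>+ x. ennreal (hat n j x) \<partial>\<sigma>) \<le> ennreal (aff n j)"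
  shows "AE x in \<sigma>. S2 \<nu> \<mu> x < \<infinity>"
proof -
  have "AE x in \<sigma>. (\<Sum>n. ennreal (local_defect R n x)) \<noteq> \<infinity>" if R: "0 < R" for R
  proof (rule nn_integral_noteq_infinite)
    let ?w = "\<lambda>n j. tent 0 (real R) (grid n j)"
    have "(\<integral>\<^sup>+ x. (\<Sum>n. ennreal (local_defect R n x)) \<partial>\<sigma>) = (\<Sum>n. \<integral>\<^sup>+ x. ennreal (local_defect R n x) \<partial>\<sigma>)"
      by (rule nn_integral_suminf) measurable
    also have "\<dots> \<le> (\<Sum>n. ennreal (\<Sum>j\<in>idx R n. ?w n j * aff n j * total_defect n j))"
    proof (rule suminf_le)
      fix n
      have "(\<integral>\<^sup>+ x. ennreal (local_defect R n x) \<partial>\<sigma>)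
        = (\<integral>\<^sup>+ x. (\<Sum>j\<in>idx R n. ennreal (?w n j * total_defect n j) * ennreal (hat n j x)) \<partial>\<sigma>)"
        unfolding local_defect_def
        by (intro nn_integral_cong, subst sum_ennreal[symmetric])
          (auto simp: total_defect_nonneg ennreal_mult[symmetric] mult_ac intro!: sum.cong)
      also have "\<dots> = (\<Sum>j\<in>idx R n. \<integral>\<^sup>+ x. ennreal (?w n j * total_defect n j) * ennreal (hat n j x) \<partial>\<sigma>)"
        by (rule nn_integral_sum) measurable
      also have "\<dots> = (\<Sum>j\<in>idx R n. ennreal (?w n j * total_defect n j) * (\<integral>\<^sup>+ x. ennreal (hat n j x) \<partial>\<sigma>))"
        by (intro sum.cong refl nn_integral_cmult) measurable
      also have "\<dots> \<le> (\<Sum>j\<in>idx R n. ennreal (?w n j * total_defect n j) * ennreal (aff n j))"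
        by (intro sum_mono mult_left_mono \<sigma>) simp
      also have "\<dots> = ennreal (\<Sum>j\<in>idx R n. ?w n j * aff n j * total_defect n j)"
        by (subst sum_ennreal[symmetric])
          (auto simp: total_defect_nonneg ennreal_mult[symmetric] mult_ac intro!: sum.cong)
      finally show "(\<integral>\<^sup>+ x. ennreal (local_defect R n x) \<partial>\<sigma>) \<le> ennreal (\<Sum>j\<in>idx R n. ?w n j * aff n j * total_defect n j)" .
    qed simp_all
    also have "\<dots> \<le> ennreal (4 * total_aff R 0)"
      unfolding suminf_eq_SUP
    proof (rule SUP_least)
      fix m
      have "(\<Sum>n<m. ennreal (\<Sum>j\<in>idx R n. ?w n j * aff n j * total_defect n j))
        = ennreal (\<Sum>n<m. \<Sum>j\<in>idx R n. ?w n j * aff n j * total_defect n j)"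
        by (intro sum_ennreal sum_nonneg mult_nonneg_nonneg total_defect_nonneg) auto
      also have "\<dots> \<le> ennreal (4 * total_aff R 0)" by (intro ennreal_leI total_defect_sum_le R)
      finally show "(\<Sum>n<m. ennreal (\<Sum>j\<in>idx R n. ?w n j * aff n j * total_defect n j)) \<le> ennreal (4 * total_aff R 0)" .
    qed
    finally show "(\<integral>\<^sup>+ x. (\<Sum>n. ennreal (local_defect R n x)) \<partial>\<sigma>) \<noteq> \<infinity>" by (auto simp: top_unique)
  qed measurable
  hence "AE x in \<sigma>. \<forall>R. (\<Sum>n. ennreal (local_defect (Suc R) n x)) \<noteq> \<infinity>"
    by (subst AE_all_countable) auto
  thus ?thesis
  proof (rule AE_mp, intro AE_I2 impI)
    fix x assume *: "\<forall>R. (\<Sum>n. ennreal (local_defect (Suc R) n x)) \<noteq> \<infinity>"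
    obtain R :: nat where R: "2 * \<bar>x\<bar> < real R" using reals_Archimedean2 by blast
    show "S2 \<nu> \<mu> x < \<infinity>"
    proof (rule S2_finite_if_local_defect)
      \<comment> \<open>\<open>Suc (R + 3)\<close> is at least 4 and exceeds
        \<open>2 * \<bar>x\<bar>\<close>, as both size conditions demand.\<close>
      show "(\<Sum>n. ennreal (local_defect (Suc (R + 3)) n x)) \<noteq> \<infinity>" using * by blast
    qed (use R in auto)
  qed
qed

text \<open>\<open>\<mu>a\<close> cannot be inserted into \<open>AE_S2_finite\<close> directly,
  since its mass on a hat is bounded by that of \<mu> but not by the affinity.\<close>

lemma AE_S2_finite_abs_cont:
  assumes sets_a: "sets \<mu>a = sets borel" and le: "\<And>A. A \<in> sets borel \<Longrightarrow> emeasure \<mu>a A \<le> emeasure \<mu> A"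
    and ac: "absolutely_continuous \<nu> \<mu>a"
  shows "AE x in \<mu>a. S2 \<nu> \<mu> x < \<infinity>"
proof -
  have sn [measurable_cong]: "sets \<nu> = sets borel" and sm: "sets \<mu> = sets borel"
    using radon_sets mu nu by auto
  have "sigma_finite_measure \<nu>"
  proof
    show "\<exists>A. countable A \<and> A \<subseteq> sets \<nu> \<and> \<Union> A = space \<nu> \<and> (\<forall>a\<in>A. emeasure \<nu> a \<noteq> \<infinity>)"
    proof (intro exI[of _ "range (\<lambda>n::nat. {- real n..real n})"] conjI ballI)
      have "x \<in> (\<Union>n::nat. {- real n..real n})" for x :: real
      proof -
        obtain n :: nat where "\<bar>x\<bar> \<le> real n" using real_arch_simple by blast
        thus ?thesis by (intro UN_I[of n]) auto
      qed
      thus "\<Union> (range (\<lambda>n::nat. {- real n..real n})) = space \<nu>" unfolding radon_space[OF nu] by blast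
      fix a assume "a \<in> range (\<lambda>n::nat. {- real n..real n})"
      then obtain n :: nat where "a = {- real n..real n}" by blast
      thus "emeasure \<nu> a \<noteq> \<infinity>" using radon_emeasure_finite[OF nu order_refl, of "- real n" "real n"] by simp
    qed (simp_all add: sn image_subset_iff)
  qed
  then interpret sigma_finite_measure \<nu> .
  obtain f where f [measurable]: "f \<in> borel_measurable borel" and fd: "density \<nu> f = \<mu>a"
  proof -
    have "sets \<mu>a = sets \<nu>" using sets_a sn by simp
    from Radon_Nikodym[OF ac this] obtain f where f: "f \<in> borel_measurable \<nu>" "density \<nu> f = \<mu>a" by blast
    have "f \<in> borel_measurable borel" using f(1) measurable_cong_sets[OF sn refl] by blast
    thus thesis using f(2) by (rule that)
  qed
  \<comment> \<open>A square root of \<open>f\<close> with the same support; the value where \<open>f = \<infinity>\<close> only has to be positive.\<close>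
  define s :: "real \<Rightarrow> ennreal" where "s x = (if f x = \<infinity> then 1 else ennreal (sqrt (enn2real (f x))))" for x
  have [measurable]: "s \<in> borel_measurable borel" unfolding s_def by measurable
  have s2: "(s x)\<^sup>2 \<le> f x" for x
    by (cases "f x") (auto simp: s_def ennreal_power)
  have s0: "0 < s x" if "0 < f x" for x
    using that by (cases "f x") (auto simp: s_def)
  have "(\<integral>\<^sup>+ x. ennreal (hat n j x) \<partial>density \<nu> s) \<le> ennreal (aff n j)" for n j
  proof -
    \<comment> \<open>The hat is split evenly between the two factors of Cauchy-Schwarz, so that
      both masses are taken on the same hat.\<close>
    let ?h = "\<lambda>x. ennreal (sqrt (hat n j x))"
    have h2: "(?h x)\<^sup>2 = ennreal (hat n j x)" for x by (simp add: ennreal_power)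
    let ?X = "\<integral>\<^sup>+ x. ennreal (hat n j x) \<partial>density \<nu> s"
    have mass: "(\<integral>\<^sup>+ x. ennreal (hat n j x) \<partial>M) = ennreal (mass M n j)" if "radon_real M" for M
      unfolding mass_def by (rule nn_integral_eq_integral[OF radon_integrable_hat[OF that]]) simp
    have "?X = (\<integral>\<^sup>+ x. s x * ennreal (hat n j x) \<partial>\<nu>)" by (rule nn_integral_density) measurable
    also have "\<dots> = (\<integral>\<^sup>+ x. (s x * ?h x) * ?h x \<partial>\<nu>)"
    proof (rule nn_integral_cong)
      fix x show "s x * ennreal (hat n j x) = (s x * ?h x) * ?h x"
        unfolding h2[symmetric] power2_eq_square by (rule mult.assoc[symmetric])
    qed
    finally have "?X\<^sup>2 \<le> (\<integral>\<^sup>+ x. (s x * ?h x)\<^sup>2 \<partial>\<nu>) * (\<integral>\<^sup>+ x. (?h x)\<^sup>2 \<partial>\<nu>)"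
      by (simp only:) (rule Cauchy_Schwarz_nn_integral; measurable)
    also have "(\<integral>\<^sup>+ x. (s x * ?h x)\<^sup>2 \<partial>\<nu>) \<le> (\<integral>\<^sup>+ x. f x * ennreal (hat n j x) \<partial>\<nu>)"
      unfolding power_mult_distrib h2 by (intro nn_integral_mono mult_right_mono s2) simp
    also have "\<dots> = (\<integral>\<^sup>+ x. ennreal (hat n j x) \<partial>\<mu>a)"
      unfolding fd[symmetric] by (rule nn_integral_density[symmetric]) measurable
    also have "\<dots> \<le> (\<integral>\<^sup>+ x. ennreal (hat n j x) \<partial>\<mu>)"
    proof (rule nn_integral_mono_measure)
      show "sets \<mu>a = sets \<mu>" using sets_a sm by simp
      have "emeasure \<mu>a A \<le> emeasure \<mu> A" for A
        using le[of A] emeasure_notin_sets[of A \<mu>a] sets_a by (cases "A \<in> sets borel") simp_all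
      thus "\<mu>a \<le> \<mu>"
        using sets_eq_imp_space_eq[OF \<open>sets \<mu>a = sets \<mu>\<close>] \<open>sets \<mu>a = sets \<mu>\<close>
        by (simp add: le_measure_iff le_fun_def)
    qed
    finally have "?X\<^sup>2 \<le> ennreal (mass \<mu> n j) * ennreal (mass \<nu> n j)"
      by (simp add: mult_right_mono h2 mass mu nu)
    hence X2: "?X\<^sup>2 \<le> ennreal (mass \<mu> n j * mass \<nu> n j)" by (simp add: ennreal_mult)
    show ?thesis
    proof (cases ?X)
      case (real y)
      hence "y\<^sup>2 \<le> mass \<mu> n j * mass \<nu> n j" using X2 by (simp add: ennreal_power ennreal_le_iff)
      hence "y \<le> aff n j" unfolding aff_def by (rule real_le_rsqrt)
      thus ?thesis using real by (simp add: ennreal_leI)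
    next
      case top
      thus ?thesis using X2 by (simp add: power2_eq_square ennreal_top_mult top_unique)
    qed
  qed
  hence "AE x in density \<nu> s. S2 \<nu> \<mu> x < \<infinity>" by (intro AE_S2_finite) (auto simp: sn)
  hence "AE x in \<nu>. 0 < s x \<longrightarrow> S2 \<nu> \<mu> x < \<infinity>" by (subst (asm) AE_density) auto
  hence "AE x in \<nu>. 0 < f x \<longrightarrow> S2 \<nu> \<mu> x < \<infinity>" by eventually_elim (use s0 in auto)
  thus ?thesis unfolding fd[symmetric] by (subst AE_density) auto
qed

end

section \<open>Conclusion for a general Lebesgue decomposition\<close>

theorem mainTheorem2:
  fixes \<mu> \<nu> \<mu>a \<mu>s :: "real measure"
  assumes "radon_real \<mu>" and "radon_real \<nu>" and "doubling_real \<nu>"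
    and "sets \<mu>a = sets borel" and "sets \<mu>s = sets borel"
    and "\<forall>A \<in> sets borel. emeasure \<mu> A = emeasure \<mu>a A + emeasure \<mu>s A"
    and "absolutely_continuous \<nu> \<mu>a"
    and "\<exists>N \<in> sets borel. emeasure \<nu> N = 0 \<and> emeasure \<mu>s (UNIV - N) = 0"
  shows "(AE x in \<mu>a. S2 \<nu> \<mu> x < \<infinity>) \<and> (AE x in \<mu>s. S2 \<nu> \<mu> x = \<infinity>)"
proof -
  have space_a: "space \<mu>a = UNIV" and space_s: "space \<mu>s = UNIV"
    using sets_eq_imp_space_eq[of \<mu>a borel] sets_eq_imp_space_eq[of \<mu>s borel] assms(4,5) by auto
  have le_a: "emeasure \<mu>a A \<le> emeasure \<mu> A" and le_s: "emeasure \<mu>s A \<le> emeasure \<mu> A" if "A \<in> sets borel" for A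
    using assms(6) that by auto
  obtain N where N: "N \<in> sets borel" "emeasure \<nu> N = 0" "emeasure \<mu>s (UNIV - N) = 0" using assms(8) by blast
  \<comment> \<open>The bad set is only enclosed in a null set of \<open>\<mu>s\<close>:
    \<open>Z\<close> inherits nullity from \<mu>, and the complement of \<open>N\<close> is null by
    singularity.\<close>
  have AE_sI: "AE x in \<mu>s. S2 \<nu> \<mu> x = \<infinity>"
    if "Z \<in> sets borel" "emeasure \<mu> Z = 0" "\<And>x. x \<in> N \<Longrightarrow> x \<notin> Z \<Longrightarrow> S2 \<nu> \<mu> x = \<infinity>" for Z
  proof (rule AE_I')
    have "Z \<in> null_sets \<mu>s" using le_s[OF that(1)] that assms(5) by auto
    moreover have "UNIV - N \<in> null_sets \<mu>s" using N assms(5) by auto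
    ultimately show "Z \<union> (UNIV - N) \<in> null_sets \<mu>s" by (rule null_sets.Un)
    show "{x \<in> space \<mu>s. S2 \<nu> \<mu> x \<noteq> \<infinity>} \<subseteq> Z \<union> (UNIV - N)" using that(3) by auto
  qed
  \<comment> \<open>If \<nu> vanishes, absolute continuity forces \<open>\<mu>a = 0\<close> and only
    the singular statement has content. Otherwise every tent has positive \<nu>-integral and the
    locale applies.\<close>
  show ?thesis
  proof (cases "emeasure \<nu> UNIV = 0")
    case True
    hence "UNIV \<in> null_sets \<nu>" using radon_sets[OF assms(2)] by auto
    hence "UNIV \<in> null_sets \<mu>a" using assms(7) by (auto simp: absolutely_continuous_def)
    hence "AE x in \<mu>a. S2 \<nu> \<mu> x < \<infinity>" by (rule AE_I') auto
    moreover obtain Z where "Z \<in> sets borel" "emeasure \<mu> Z = 0" "\<And>x. x \<notin> Z \<Longrightarrow> S2 \<nu> \<mu> x = \<infinity>"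
      using S2_infinite_of_null[OF assms(1,2) True] by blast
    ultimately show ?thesis using AE_sI by blast
  next
    case False
    obtain C where "0 < C" "\<And>c \<rho>. 0 < \<rho> \<Longrightarrow> 0 < integral\<^sup>L \<nu> (tent c \<rho>)"
      "\<And>c \<rho> c' \<rho>'. 0 < \<rho> \<Longrightarrow> 0 < \<rho>' \<Longrightarrow> \<bar>c - c'\<bar> + \<rho>' \<le> 64 * \<rho> \<Longrightarrow>
        integral\<^sup>L \<nu> (tent c' \<rho>') \<le> C * integral\<^sup>L \<nu> (tent c \<rho>)"
      by (rule tent_doubling_exists[OF assms(2,3) False]) blast
    hence "doubling_pair \<mu> \<nu> C" using assms(1,2) by unfold_locales
    then interpret doubling_pair \<mu> \<nu> C .
    have "AE x in \<mu>a. S2 \<nu> \<mu> x < \<infinity>" by (rule AE_S2_finite_abs_cont[OF assms(4) le_a assms(7)])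
    moreover obtain Z where "Z \<in> sets borel" "emeasure \<mu> Z = 0" "\<And>x. x \<in> N \<Longrightarrow> x \<notin> Z \<Longrightarrow> S2 \<nu> \<mu> x = \<infinity>"
      using S2_infinite_on_null[OF N(1,2)] by blast
    ultimately show ?thesis using AE_sI by blast
  qed
qed

end
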